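(* Let $p,c\in\mathbb{N}$ be constants and let $\varepsilon>0$ be a constant. There exists a randomized polynomial-time algorithm for \textsc{Packing-Covering Submodular Maximization}, running in time $n^{\mathrm{poly}(1/\varepsilon)}$, that outputs a set $S\subseteq\mathcal{N}$ satisfying (1) $f(S)\geq\left(1-\frac{1}{e}-\varepsilon\right)f(O)$ and (2) $\mathbf{P}\mathbf{1}_S\leq\mathbf{1}_p$ and $\mathbf{C}\mathbf{1}_S\geq(1-\varepsilon)\mathbf{1}_c$, where $O$ is an optimal solution.
   Context: \textsc{Packing-Covering Submodular Maximization}: we are given a ground set $\mathcal{N}=\{1,\dots,n\}$, a monotone submodular function $f:2^{\mathcal{N}}\to\mathbb{R}_+$ (accessed via a value oracle), a nonnegative packing matrix $\mathbf{P}\in\mathbb{R}_+^{p\times n}$ and a nonnegative covering matrix $\mathbf{C}\in\mathbb{R}_+^{c\times n}$. The goal is $\max\{f(S): S\subseteq\mathcal{N},\ \mathbf{P}\mathbf{1}_S\leq\mathbf{1}_p,\ \mathbf{C}\mathbf{1}_S\geq\mathbf{1}_c\}$, where $\mathbf{1}_S\in\mathbb{R}^n$ is the indicator vector of $S$ and $\mathbf{1}_k$ is the all-ones vector of dimension $k$. It is assumed that the instance is feasible, i.e., some $S$ satisfies both constraint systems. $O$ denotes an optimal solution. Running time counts value-oracle queries and arithmetic operations. *)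

theory Defs
  imports "HOL-Probability.Probability_Mass_Function" "HOL-Computational_Algebra.Polynomial"
begin

section \<open>Packing-covering submodular maximization\<close>

definition submodular_on :: "'a set \<Rightarrow> ('a set \<Rightarrow> real) \<Rightarrow> bool" where
  "submodular_on N f \<longleftrightarrow>
     (\<forall>A B. A \<subseteq> N \<longrightarrow> B \<subseteq> N \<longrightarrow> f (A \<union> B) + f (A \<inter> B) \<le> f A + f B)"

text \<open>Matrices are indexed by \<open>i \<in> {1..m}\<close> (rows) and \<open>j \<in> {1..n}\<close> (columns); since one
  algorithm has to serve every \<open>n\<close>, the dimension is not a type.\<close>

definition nonneg_mat :: "nat \<Rightarrow> nat \<Rightarrow> (nat \<Rightarrow> nat \<Rightarrow> real) \<Rightarrow> bool" where
  "nonneg_mat m n M \<longleftrightarrow> (\<forall>i\<in>{1..m}. \<forall>j\<in>{1..n}. 0 \<le> M i j)"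

definition mat_vec :: "nat \<Rightarrow> (nat \<Rightarrow> nat \<Rightarrow> real) \<Rightarrow> (nat \<Rightarrow> real) \<Rightarrow> nat \<Rightarrow> real" where
  "mat_vec n M x i = (\<Sum>j=1..n. M i j * x j)"

definition packing :: "nat \<Rightarrow> nat \<Rightarrow> (nat \<Rightarrow> nat \<Rightarrow> real) \<Rightarrow> nat set \<Rightarrow> bool" where
  "packing p n P S \<longleftrightarrow> (\<forall>i\<in>{1..p}. mat_vec n P (indicator S) i \<le> 1)"

text \<open>Covering up to the factor \<open>\<beta>\<close>; the exact constraint is \<open>\<beta> = 1\<close>.\<close>

definition covering :: "nat \<Rightarrow> nat \<Rightarrow> (nat \<Rightarrow> nat \<Rightarrow> real) \<Rightarrow> real \<Rightarrow> nat set \<Rightarrow> bool" where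
  "covering c n C \<beta> S \<longleftrightarrow> (\<forall>i\<in>{1..c}. \<beta> \<le> mat_vec n C (indicator S) i)"

definition feasible ::
  "nat \<Rightarrow> nat \<Rightarrow> nat \<Rightarrow> (nat \<Rightarrow> nat \<Rightarrow> real) \<Rightarrow> (nat \<Rightarrow> nat \<Rightarrow> real) \<Rightarrow> nat set \<Rightarrow> bool" where
  "feasible p c n P C S \<longleftrightarrow> S \<subseteq> {1..n} \<and> packing p n P S \<and> covering c n C 1 S"

definition pcsm_instance ::
  "nat \<Rightarrow> nat \<Rightarrow> nat \<Rightarrow> (nat set \<Rightarrow> real) \<Rightarrow> (nat \<Rightarrow> nat \<Rightarrow> real) \<Rightarrow> (nat \<Rightarrow> nat \<Rightarrow> real) \<Rightarrow> bool"
where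
  "pcsm_instance p c n f P C \<longleftrightarrow>
     1 \<le> n \<and>
     (\<forall>S\<subseteq>{1..n}. 0 \<le> f S) \<and> mono_on (Pow {1..n}) f \<and> submodular_on {1..n} f \<and>
     nonneg_mat p n P \<and> nonneg_mat c n C \<and>
     (\<exists>S. feasible p c n P C S)"

definition optimal ::
  "nat \<Rightarrow> nat \<Rightarrow> nat \<Rightarrow> (nat set \<Rightarrow> real) \<Rightarrow> (nat \<Rightarrow> nat \<Rightarrow> real) \<Rightarrow> (nat \<Rightarrow> nat \<Rightarrow> real)
     \<Rightarrow> nat set \<Rightarrow> bool" where
  "optimal p c n f P C S \<longleftrightarrow> is_arg_max f (feasible p c n P C) S"


section \<open>Randomized real-RAM programs with a value oracle\<close>

text \<open>A program is a finite piece of syntax that does not depend on \<open>n\<close>. It works on finitely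
  many named registers and arrays, over \<open>nat\<close> (for indices and control) and over \<open>real\<close>.
  The instruction set is kept weak on purpose: indices admit only addition and truncated
  subtraction, there is no rounding of reals to indices, and there are no real constants in
  programs, so that unit-cost arithmetic cannot hide extra computation or advice.
  The first argument of an instruction is its target, except that \<open>IStore a x y\<close> and
  \<open>RStore a x r\<close> write register \<open>y\<close> (resp. \<open>r\<close>) to the cell of array \<open>a\<close> whose index is
  in register \<open>x\<close>. Division by zero yields 0.\<close>

datatype instr =
    IConst nat nat
  | IAdd nat nat nat
  | ISub nat nat nat
  | ILoad nat nat nat
  | IStore nat nat nat
  | RNat nat nat
  | RAdd nat nat nat
  | RSub nat nat nat
  | RMul nat nat nat
  | RDiv nat nat nat
  | RLoad nat nat nat
  | RStore nat nat nat
  | Flip nat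
  | Query nat nat

datatype test = ILess nat nat | RLess nat nat

datatype com =
    SKIP
  | DO instr
  | SEQ com com
  | IF test com com
  | WHILE test com

record store =
  ireg :: "nat \<Rightarrow> nat"
  iarr :: "nat \<Rightarrow> nat \<Rightarrow> nat"
  rreg :: "nat \<Rightarrow> real"
  rarr :: "nat \<Rightarrow> nat \<Rightarrow> real"

definition set_ireg :: "nat \<Rightarrow> nat \<Rightarrow> store \<Rightarrow> store" where
  "set_ireg x v s = s\<lparr>ireg := (ireg s)(x := v)\<rparr>"

definition set_rreg :: "nat \<Rightarrow> real \<Rightarrow> store \<Rightarrow> store" where
  "set_rreg r v s = s\<lparr>rreg := (rreg s)(r := v)\<rparr>"

text \<open>Subsets of the ground set are represented by characteristic vectors in index arrays.\<close>

definition stored_set :: "nat \<Rightarrow> nat \<Rightarrow> store \<Rightarrow> nat set" where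
  "stored_set n a s = {j \<in> {1..n}. iarr s a j \<noteq> 0}"

primrec exec :: "nat \<Rightarrow> (nat set \<Rightarrow> real) \<Rightarrow> instr \<Rightarrow> store \<Rightarrow> store pmf" where
  "exec n f (IConst x k) s = return_pmf (set_ireg x k s)"
| "exec n f (IAdd x y z) s = return_pmf (set_ireg x (ireg s y + ireg s z) s)"
| "exec n f (ISub x y z) s = return_pmf (set_ireg x (ireg s y - ireg s z) s)"
| "exec n f (ILoad x a y) s = return_pmf (set_ireg x (iarr s a (ireg s y)) s)"
| "exec n f (IStore a x y) s =
     return_pmf (s\<lparr>iarr := (iarr s)(a := (iarr s a)(ireg s x := ireg s y))\<rparr>)"
| "exec n f (RNat r x) s = return_pmf (set_rreg r (real (ireg s x)) s)"
| "exec n f (RAdd r u v) s = return_pmf (set_rreg r (rreg s u + rreg s v) s)"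
| "exec n f (RSub r u v) s = return_pmf (set_rreg r (rreg s u - rreg s v) s)"
| "exec n f (RMul r u v) s = return_pmf (set_rreg r (rreg s u * rreg s v) s)"
| "exec n f (RDiv r u v) s = return_pmf (set_rreg r (rreg s u / rreg s v) s)"
| "exec n f (RLoad r a x) s = return_pmf (set_rreg r (rarr s a (ireg s x)) s)"
| "exec n f (RStore a x r) s =
     return_pmf (s\<lparr>rarr := (rarr s)(a := (rarr s a)(ireg s x := rreg s r))\<rparr>)"
| "exec n f (Flip x) s = map_pmf (\<lambda>b. set_ireg x (of_bool b) s) (bernoulli_pmf (1/2))"
| "exec n f (Query r a) s = return_pmf (set_rreg r (f (stored_set n a s)) s)"

primrec holds :: "test \<Rightarrow> store \<Rightarrow> bool" where
  "holds (ILess x y) s \<longleftrightarrow> ireg s x < ireg s y"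
| "holds (RLess u v) s \<longleftrightarrow> rreg s u < rreg s v"

text \<open>Small-step semantics. Each step executes at most one instruction or one test, so the number
  of steps bounds the number of oracle queries and arithmetic operations (and of everything else,
  including coin flips and comparisons). A configuration is halted iff its program is
  \<open>SKIP\<close>; halted configurations are fixed points.\<close>

primrec step :: "nat \<Rightarrow> (nat set \<Rightarrow> real) \<Rightarrow> com \<Rightarrow> store \<Rightarrow> (com \<times> store) pmf" where
  "step n f SKIP s = return_pmf (SKIP, s)"
| "step n f (DO i) s = map_pmf (Pair SKIP) (exec n f i s)"
| "step n f (SEQ c1 c2) s =
     (if c1 = SKIP then return_pmf (c2, s)
      else map_pmf (\<lambda>(c1', s'). (SEQ c1' c2, s')) (step n f c1 s))"
| "step n f (IF b c1 c2) s = return_pmf (if holds b s then c1 else c2, s)"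
| "step n f (WHILE b c) s =
     return_pmf (if holds b s then SEQ c (WHILE b c) else SKIP, s)"

text \<open>Distribution of the configuration after \<open>t\<close> steps.\<close>

primrec run ::
  "nat \<Rightarrow> (nat set \<Rightarrow> real) \<Rightarrow> nat \<Rightarrow> com \<Rightarrow> store \<Rightarrow> (com \<times> store) pmf" where
  "run n f 0 prg s = return_pmf (prg, s)"
| "run n f (Suc t) prg s = bind_pmf (run n f t prg s) (\<lambda>(prg', s'). step n f prg' s')"

text \<open>Worst case over all coin flips.\<close>

definition halts_within :: "nat \<Rightarrow> (nat set \<Rightarrow> real) \<Rightarrow> com \<Rightarrow> store \<Rightarrow> nat \<Rightarrow> bool" where
  "halts_within n f prg s t \<longleftrightarrow> (\<forall>cfg \<in> set_pmf (run n f t prg s). fst cfg = SKIP)"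

text \<open>Input: \<open>n\<close> is in index register 0, row \<open>i\<close> of \<open>P\<close> in real array \<open>i\<close>, row \<open>i\<close> of \<open>C\<close> in
  real array \<open>p + i\<close>, and everything else is 0; \<open>f\<close> is accessible only through \<open>Query\<close>.
  Output: the set stored in index array 0.\<close>

definition input_store ::
  "nat \<Rightarrow> nat \<Rightarrow> nat \<Rightarrow> (nat \<Rightarrow> nat \<Rightarrow> real) \<Rightarrow> (nat \<Rightarrow> nat \<Rightarrow> real) \<Rightarrow> store" where
  "input_store p c n P C =
     \<lparr>ireg = (\<lambda>_. 0)(0 := n),
      iarr = (\<lambda>_ _. 0),
      rreg = (\<lambda>_. 0),
      rarr = (\<lambda>a j. if j \<notin> {1..n} then 0
                     else if a \<in> {1..p} then P a j
                     else if a \<in> {p+1..p+c} then C (a - p) j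
                     else 0)\<rparr>"

definition output_pmf ::
  "nat \<Rightarrow> (nat set \<Rightarrow> real) \<Rightarrow> com \<Rightarrow> store \<Rightarrow> nat \<Rightarrow> nat set pmf" where
  "output_pmf n f prg s t = map_pmf (\<lambda>(_, s'). stored_set n 0 s') (run n f t prg s)"

end

theory Submission
  imports Defs
begin

text \<open>The algorithm is deterministic. Let \<open>T\<close> be a feasible set. It enumerates all small sets \<open>E\<close>; the
  right guess consists of the first elements that a greedy rule takes from \<open>T\<close>, once for \<open>f\<close> and once for every
  covering row. Then an element of \<open>T\<close> that is large compared with a packing capacity that \<open>E\<close> leaves
  can be given up: there are few of them, and each contributes little to \<open>f\<close> and to the covering rows.
  All elements that remain are small.

  The small elements are assigned by a local search that moves one element at a time between \<open>K\<close> slots.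
  Its potential is a weighted sum of the values \<open>f (S\<^sub>J \<union> E)\<close> over all sets \<open>J\<close> of slots, where \<open>S\<^sub>J\<close> is the union
  of the slots in \<open>J\<close>, minus quadratic penalties for the violated constraints. The weights make
  the derivative of the first part toward the optimum telescope to
  \<open>(\<rho>^K - 1) * f T - \<rho>^K * f S\<close> with \<open>\<rho>^K\<close> close to \<open>e\<close>, and since the elements are small the
  penalties are nearly differentiable and convex. Hence a local optimum has nearly
  satisfied constraints and value close to \<open>(1 - 1/e) * f T\<close>.\<close>

section \<open>Monotone submodular functions\<close>

text \<open>The search can be cut off after a fixed number of rounds only if its potential has a
  bounded range, but \<open>f\<close> may live on any scale. So \<open>f\<close> is divided by a
  guess \<open>V\<close> of the value of the optimum and capped at 1. The guessed set supplies the
  scale: its value is within a factor \<open>n + 1\<close> of the optimum, so polynomially many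
  multiples of it suffice as candidates for \<open>V\<close>. The weights discretise an integral.
  All sets of \<open>m\<close> slots together weigh \<open>\<rho> ^ (m - 1) / m\<close>; with t =
  m/K this is a Riemann sum of (e^t / t) dt against the average value of \<open>f\<close> on a
  fraction t of the slots. Constraints are shifted in steps of 1/K. The search aims at the target
  scaled by 1 - 1/K, and a local optimum violates a shifted constraint by at most 1/K; this restores
  exact packing. Covering loses 1/K three times: for elements given up, for the scaling, and for the
  violation. Wrong guesses are harmless, because only candidates that pass an explicit test compete
  for the output.\<close>

lemma submodular_onD:
  "submodular_on N g \<Longrightarrow> A \<subseteq> N \<Longrightarrow> B \<subseteq> N \<Longrightarrow> g (A \<union> B) + g (A \<inter> B) \<le> g A + g B"
  unfolding submodular_on_def by simp

text \<open>If \<open>j\<close> lies in \<open>B\<close>, the left side is 0 and monotonicity of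
  \<open>g\<close> makes the right side nonnegative; so no side condition
  \<open>j \<notin> B\<close> has to be carried along later.\<close>

lemma submodular_marginal_antimono:
  assumes sub: "submodular_on N g" and mono: "mono_on (Pow N) g"
    and AB: "A \<subseteq> B" "B \<subseteq> N" and j: "j \<in> N"
  shows "g (insert j B) - g B \<le> g (insert j A) - g A"
proof (cases "j \<in> B")
  case True
  have "g A \<le> g (insert j A)"
    using AB j by (intro mono_onD[OF mono]) auto
  then show ?thesis using True by (simp add: insert_absorb)
next
  case False
  have "g (insert j A \<union> B) + g (insert j A \<inter> B) \<le> g (insert j A) + g B"
    using AB j by (intro submodular_onD[OF sub]) auto
  moreover have "insert j A \<union> B = insert j B" "insert j A \<inter> B = A" using AB False by auto
  ultimately show ?thesis by simp
qed

lemma submodular_sum_additions: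
  assumes sub: "submodular_on N g" and mono: "mono_on (Pow N) g"
    and "A \<subseteq> N" "B \<subseteq> N" "finite B"
  shows "g (A \<union> B) - g A \<le> (\<Sum>j\<in>B. g (insert j A) - g A)"
  using \<open>finite B\<close> \<open>B \<subseteq> N\<close>
proof (induction B)
  case (insert j B)
  have "g (insert j (A \<union> B)) - g (A \<union> B) \<le> g (insert j A) - g A"
    using insert.prems \<open>A \<subseteq> N\<close> by (intro submodular_marginal_antimono[OF sub mono]) auto
  moreover have "g (A \<union> B) - g A \<le> (\<Sum>j\<in>B. g (insert j A) - g A)"
    using insert by simp
  ultimately show ?case using insert by simp
qed simp

text \<open>If the elements of \<open>B\<close> are removed one after another, each removal costs at
  least what it would cost at the full set \<open>A\<close>, where marginals are smallest.\<close>

lemma submodular_sum_removals: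
  assumes sub: "submodular_on N g" and mono: "mono_on (Pow N) g"
    and "B \<subseteq> A" "A \<subseteq> N" "finite B"
  shows "(\<Sum>j\<in>B. g A - g (A - {j})) \<le> g A - g (A - B)"
  using \<open>finite B\<close> \<open>B \<subseteq> A\<close>
proof (induction B)
  case (insert j B)
  have "g (insert j (A - {j})) - g (A - {j}) \<le> g (insert j (A - insert j B)) - g (A - insert j B)"
    using insert.prems \<open>A \<subseteq> N\<close> by (intro submodular_marginal_antimono[OF sub mono]) auto
  moreover have "insert j (A - {j}) = A" "insert j (A - insert j B) = A - B"
    using insert by auto
  ultimately show ?case using insert by simp
qed simp

section \<open>Contraction by the guessed set and truncation at the guessed value\<close>

lemma submodular_on_contract:
  assumes "submodular_on N f" "E \<union> N' \<subseteq> N"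
  shows "submodular_on N' (\<lambda>A. f (A \<union> E))"
  unfolding submodular_on_def
proof (intro allI impI)
  fix A B assume "A \<subseteq> N'" "B \<subseteq> N'"
  then have "f ((A \<union> E) \<union> (B \<union> E)) + f ((A \<union> E) \<inter> (B \<union> E)) \<le> f (A \<union> E) + f (B \<union> E)"
    using assms(2) by (intro submodular_onD[OF assms(1)]) auto
  moreover have "(A \<union> E) \<union> (B \<union> E) = A \<union> B \<union> E" "(A \<union> E) \<inter> (B \<union> E) = A \<inter> B \<union> E" by auto
  ultimately show "f (A \<union> B \<union> E) + f (A \<inter> B \<union> E) \<le> f (A \<union> E) + f (B \<union> E)" by simp
qed

lemma mono_on_contract:
  assumes "mono_on (Pow N) f" "E \<union> N' \<subseteq> N"
  shows "mono_on (Pow N') (\<lambda>A. f (A \<union> E))"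
  using assms by (intro mono_onI) (auto intro!: mono_onD[OF assms(1)])

text \<open>Capping needs monotonicity: the values at \<open>A\<close> and \<open>B\<close> lie
  between those at \<open>A \<inter> B\<close> and \<open>A \<union> B\<close>, so the cap acts from
  the top. For \<open>V = 0\<close> the quotient is constantly 0, which does no harm.\<close>

lemma submodular_on_truncate:
  assumes sub: "submodular_on N f" and mono: "mono_on (Pow N) f" and V: "0 \<le> (V::real)"
  shows "submodular_on N (\<lambda>A. min (f A / V) b)"
  unfolding submodular_on_def
proof (intro allI impI)
  fix A B assume AB: "A \<subseteq> N" "B \<subseteq> N"
  have "(f (A \<union> B) + f (A \<inter> B)) / V \<le> (f A + f B) / V"
    using AB V by (intro divide_right_mono submodular_onD[OF sub])
  then have 1: "f (A \<union> B) / V + f (A \<inter> B) / V \<le> f A / V + f B / V" by (simp add: add_divide_distrib)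
  have mono': "f X / V \<le> f Y / V" if "X \<subseteq> Y" "Y \<subseteq> N" for X Y
    using that V by (intro divide_right_mono mono_onD[OF mono]) auto
  have "f (A \<inter> B) / V \<le> f A / V" "f (A \<inter> B) / V \<le> f B / V"
    "f A / V \<le> f (A \<union> B) / V" "f B / V \<le> f (A \<union> B) / V"
    using AB by (auto intro!: mono')
  with 1 show "min (f (A \<union> B) / V) b + min (f (A \<inter> B) / V) b \<le> min (f A / V) b + min (f B / V) b"
    by linarith
qed

lemma mono_on_truncate:
  assumes mono: "mono_on (Pow N) f" and V: "0 \<le> (V::real)"
  shows "mono_on (Pow N) (\<lambda>A. min (f A / V) b)"
  using assms by (intro mono_onI min.mono divide_right_mono mono_onD[OF mono]) auto

text \<open>Rows of a matrix are modular functions, so the greedy rule below serves the covering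
  rows as well as \<open>f\<close>.\<close>

lemma submodular_on_sum: "submodular_on N (\<lambda>S. \<Sum>j\<in>S. w j :: real)" if "finite N"
  unfolding submodular_on_def
proof (intro allI impI)
  fix A B assume "A \<subseteq> N" "B \<subseteq> N"
  then have "finite A" "finite B" using that finite_subset by auto
  then show "sum w (A \<union> B) + sum w (A \<inter> B) \<le> sum w A + sum w B"
    by (simp add: sum.union_inter)
qed

text \<open>Greedy choice inside \<open>Q\<close>: after \<open>m\<close> steps the marginal of
  every element left over is at most an \<open>m\<close>-th of the value collected, because
  marginals only shrink and each step gained at least as much as any other element would
  have.\<close>

lemma greedy_prefix:
  assumes sub: "submodular_on N g" and mono: "mono_on (Pow N) g"
    and "finite Q" "Q \<subseteq> N" and nonneg: "\<And>S. S \<subseteq> N \<Longrightarrow> 0 \<le> g S"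
  shows "\<exists>T\<subseteq>Q. card T \<le> m \<and> (\<forall>j\<in>Q - T. real m * (g (insert j T) - g T) \<le> g T)"
proof (induction m)
  case 0
  then show ?case using nonneg by (intro exI[of _ "{}"]) auto
next
  case (Suc m)
  then obtain T where T: "T \<subseteq> Q" "card T \<le> m"
    and le: "\<And>j. j \<in> Q - T \<Longrightarrow> real m * (g (insert j T) - g T) \<le> g T" by blast
  show ?case
  proof (cases "Q - T = {}")
    case True
    then show ?thesis using T by (intro exI[of _ T]) auto
  next
    case False
    obtain i where i: "i \<in> Q - T" and
      max: "\<And>j. j \<in> Q - T \<Longrightarrow> g (insert j T) \<le> g (insert i T)"
    proof -
      let ?h = "\<lambda>j. g (insert j T)"
      have fin: "finite (?h ` (Q - T))" "?h ` (Q - T) \<noteq> {}"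
        using \<open>finite Q\<close> False by blast+
      then obtain i where i: "i \<in> Q - T" "Max (?h ` (Q - T)) = ?h i"
        using Max_in[OF fin] by blast
      have "?h j \<le> ?h i" if "j \<in> Q - T" for j
        unfolding i(2)[symmetric] using fin(1) that by (intro Max_ge imageI)
      then show ?thesis using that i(1) by blast
    qed
    show ?thesis
    proof (intro exI[of _ "insert i T"] conjI ballI)
      show "insert i T \<subseteq> Q" using i T by auto
      show "card (insert i T) \<le> Suc m"
        using T finite_subset[OF T(1) \<open>finite Q\<close>] by (simp add: card_insert_if)
      fix j assume j: "j \<in> Q - insert i T"
      have a: "g (insert j (insert i T)) - g (insert i T) \<le> g (insert j T) - g T"
        using i j T \<open>Q \<subseteq> N\<close> by (intro submodular_marginal_antimono[OF sub mono]) auto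
      have b: "g (insert j T) \<le> g (insert i T)" using max j by auto
      have c: "real m * (g (insert j T) - g T) \<le> g T" using le j by auto
      have "real m * (g (insert j (insert i T)) - g (insert i T)) \<le> real m * (g (insert j T) - g T)"
        using a by (intro mult_left_mono) auto
      \<comment> \<open>Of the \<open>Suc m\<close> copies of the new marginal, \<open>m\<close> are
        paid by \<open>g T\<close> through the induction hypothesis; the last one is paid by the
        gain of \<open>i\<close>, which was chosen to maximise it.\<close>
      then show "real (Suc m) * (g (insert j (insert i T)) - g (insert i T)) \<le> g (insert i T)"
        using a b c by (simp add: algebra_simps)
    qed
  qed
qed

section \<open>The local search potential\<close>

definition slots :: "nat set \<Rightarrow> (nat \<Rightarrow> nat) \<Rightarrow> nat set \<Rightarrow> nat set" where
  "slots N z J = {j \<in> N. z j \<in> J}"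

text \<open>The weight of a set of \<open>m\<close> slots, chosen for \<open>coef_telescope\<close>. Division by zero makes it \<open>0\<close>
  for \<open>m = 0\<close>.\<close>

definition coef :: "real \<Rightarrow> nat \<Rightarrow> nat \<Rightarrow> real" where
  "coef \<rho> l m = \<rho> ^ (m - 1) / (real m * real (l choose m))"

definition gain :: "nat set \<Rightarrow> real \<Rightarrow> nat \<Rightarrow> (nat set \<Rightarrow> real) \<Rightarrow> (nat \<Rightarrow> nat) \<Rightarrow> real" where
  "gain N \<rho> l g z = (\<Sum>J\<in>Pow {1..l}. coef \<rho> l (card J) * g (slots N z J))"

text \<open>The derivative of \<open>H\<close> at the assignment \<open>z\<close> in the direction from \<open>z\<close> to the fractional
  assignment that puts \<open>\<theta> / l\<close> of every element of \<open>Q\<close> into each of the \<open>l\<close> slots.\<close>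

definition toward ::
  "nat set \<Rightarrow> nat set \<Rightarrow> real \<Rightarrow> nat \<Rightarrow> ((nat \<Rightarrow> nat) \<Rightarrow> real) \<Rightarrow> (nat \<Rightarrow> nat) \<Rightarrow> real" where
  "toward N Q \<theta> l H z = (\<Sum>j\<in>N.
     (if j \<in> Q then \<theta> / real l * (\<Sum>k=1..l. H (z(j := k)) - H z) else 0)
     + (1 - (if j \<in> Q then \<theta> else 0)) * (H (z(j := 0)) - H z))"

lemma slots_upd:
  "j \<in> N \<Longrightarrow> slots N (z(j := k)) J = (if k \<in> J then insert j (slots N z J) else slots N z J - {j})"
  by (auto simp: slots_def)

lemma sum_Pow_card:
  fixes h :: "nat \<Rightarrow> real"
  assumes "finite L"
  shows "(\<Sum>J\<in>Pow L. h (card J)) = (\<Sum>m\<le>card L. real (card L choose m) * h m)"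
proof -
  have "(\<Sum>J\<in>Pow L. h (card J)) = (\<Sum>m\<le>card L. \<Sum>J\<in>{J \<in> Pow L. card J = m}. h (card J))"
    using assms by (intro sum.group[symmetric]) (auto intro: card_mono)
  also have "\<dots> = (\<Sum>m\<le>card L. real (card {J. J \<subseteq> L \<and> card J = m}) * h m)"
    by (intro sum.cong) (auto simp: Pow_def)
  finally show ?thesis using assms by (simp add: n_subsets)
qed

text \<open>Double counting of the pairs \<open>(J, k)\<close> with \<open>k \<in> J\<close> by the
  smaller set \<open>J - {k}\<close>: a set \<open>J\<close> arises from
  \<open>card L - card J\<close> larger sets. It collects all occurrences of one value
  \<open>h J\<close>, so that the weights can telescope.\<close>

lemma sum_remove_one:
  fixes \<phi> :: "nat \<Rightarrow> real"
  assumes "finite L"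
  shows "(\<Sum>J\<in>Pow L. \<phi> (card J) * (\<Sum>k\<in>J. h (J - {k})))
    = (\<Sum>J\<in>Pow L. (real (card L) - real (card J)) * \<phi> (card J + 1) * h J)"
proof -
  have fin: "finite J" if "J \<subseteq> L" for J using that assms finite_subset by auto
  have "(\<Sum>J\<in>Pow L. \<phi> (card J) * (\<Sum>k\<in>J. h (J - {k})))
      = (\<Sum>J\<in>Pow L. \<Sum>k\<in>J. \<phi> (card J) * h (J - {k}))"
    by (simp add: sum_distrib_left)
  also have "\<dots> = (\<Sum>(J, k)\<in>Sigma (Pow L) (\<lambda>J. J). \<phi> (card J) * h (J - {k}))"
    using assms fin by (intro sum.Sigma) auto
  also have "\<dots> = (\<Sum>(J, k)\<in>Sigma (Pow L) (\<lambda>J. L - J). \<phi> (card J + 1) * h J)"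
    by (rule sum.reindex_bij_witness[where i = "\<lambda>(J, k). (insert k J, k)" and j = "\<lambda>(J, k). (J - {k}, k)"])
      (auto simp: fin insert_absorb card_Suc_Diff1 simp del: card_Diff_insert)
  also have "\<dots> = (\<Sum>J\<in>Pow L. \<Sum>k\<in>L - J. \<phi> (card J + 1) * h J)"
    using assms fin by (intro sum.Sigma[symmetric]) auto
  also have "\<dots> = (\<Sum>J\<in>Pow L. (real (card L) - real (card J)) * \<phi> (card J + 1) * h J)"
    using assms fin by (intro sum.cong) (auto simp: card_Diff_subset of_nat_diff card_mono)
  finally show ?thesis .
qed

lemma coef_nonneg: "0 \<le> \<rho> \<Longrightarrow> 0 \<le> coef \<rho> l m"
  by (simp add: coef_def)

lemma gain_diff:
  "gain N \<rho> l g z' - gain N \<rho> l g z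
    = (\<Sum>J\<in>Pow {1..l}. coef \<rho> l (card J) * (g (slots N z' J) - g (slots N z J)))"
  by (simp add: gain_def sum_subtractf right_diff_distrib)

text \<open>For a fixed \<open>J\<close>, \<open>card J\<close> of the \<open>l\<close> slots lie in
  \<open>J\<close>, which gives the factor in front of the additions. The removal loss of each
  element is charged with total weight 1, no matter whether the element belongs to
  \<open>Q\<close>.\<close>

lemma toward_gain_expand:
  assumes mono: "mono_on (Pow N) g" and fin: "finite N" and Q: "Q \<subseteq> N"
    and \<theta>: "0 \<le> \<theta>" and \<rho>: "0 \<le> \<rho>" and l: "0 < l"
  shows "toward N Q \<theta> l (gain N \<rho> l g) z \<ge> (\<Sum>J\<in>Pow {1..l}. coef \<rho> l (card J) *
     (\<theta> / l * card J * (\<Sum>j\<in>Q. g (insert j (slots N z J)) - g (slots N z J))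
      - (\<Sum>j\<in>N. g (slots N z J) - g (slots N z J - {j}))))"
proof -
  define A where "A J j = g (insert j (slots N z J)) - g (slots N z J)" for J j
  define R where "R J j = g (slots N z J) - g (slots N z J - {j})" for J j
  define a where "a J = coef \<rho> l (card J)" for J :: "nat set"
  have a: "0 \<le> a J" for J using coef_nonneg[OF \<rho>] by (simp add: a_def)
  have R: "0 \<le> R J j" for J j
    unfolding R_def using mono_onD[OF mono, of "slots N z J - {j}" "slots N z J"] by (auto simp: slots_def)
  have rem: "gain N \<rho> l g (z(j := 0)) - gain N \<rho> l g z = - (\<Sum>J\<in>Pow {1..l}. a J * R J j)"
    if "j \<in> N" for j
    unfolding gain_diff sum_negf[symmetric]
    using that by (intro sum.cong) (auto simp: slots_upd R_def a_def right_diff_distrib)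
  have add: "(\<Sum>k=1..l. gain N \<rho> l g (z(j := k)) - gain N \<rho> l g z)
      \<ge> (\<Sum>J\<in>Pow {1..l}. a J * (card J * A J j - l * R J j))" if "j \<in> N" for j
  proof -
    have "(\<Sum>J\<in>Pow {1..l}. a J * (card J * A J j - l * R J j))
        = (\<Sum>J\<in>Pow {1..l}. \<Sum>k=1..l. a J * ((if k \<in> J then A J j else 0) - R J j))"
    proof (rule sum.cong)
      fix J assume "J \<in> Pow {1..l}"
      then have "{1..l} \<inter> J = J" by auto
      then have "(\<Sum>k=1..l. if k \<in> J then A J j else 0) = card J * A J j"
        by (simp flip: sum.inter_restrict)
      then show "a J * (card J * A J j - l * R J j)
          = (\<Sum>k=1..l. a J * ((if k \<in> J then A J j else 0) - R J j))"
        by (simp add: sum_subtractf flip: sum_distrib_left)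
    qed simp
    also have "\<dots> = (\<Sum>k=1..l. \<Sum>J\<in>Pow {1..l}. a J * ((if k \<in> J then A J j else 0) - R J j))"
      by (rule sum.swap)
    also have "\<dots> \<le> (\<Sum>k=1..l. gain N \<rho> l g (z(j := k)) - gain N \<rho> l g z)"
      unfolding gain_diff
    proof (intro sum_mono)
      fix k J
      \<comment> \<open>For \<open>k \<in> J\<close> the change is \<open>A J j\<close> and
        subtracting \<open>R J j\<close> only weakens the bound; for \<open>k \<notin> J\<close> the
        change is exactly \<open>- R J j\<close>.\<close>
      have "(if k \<in> J then A J j else 0) - R J j \<le> g (slots N (z(j := k)) J) - g (slots N z J)"
        using R[of J j] \<open>j \<in> N\<close> by (auto simp: slots_upd A_def R_def)
      then show "a J * ((if k \<in> J then A J j else 0) - R J j)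
          \<le> coef \<rho> l (card J) * (g (slots N (z(j := k)) J) - g (slots N z J))"
        unfolding a_def[symmetric] using a by (rule mult_left_mono)
    qed
    finally show ?thesis .
  qed
  have "(\<Sum>J\<in>Pow {1..l}. a J * (\<theta> / l * card J * (\<Sum>j\<in>Q. A J j) - (\<Sum>j\<in>N. R J j)))
    = (\<Sum>J\<in>Pow {1..l}. \<Sum>j\<in>N. a J * ((if j \<in> Q then \<theta> / l * card J * A J j else 0) - R J j))"
  proof (rule sum.cong)
    fix J :: "nat set"
    have "N \<inter> Q = Q" using Q by auto
    then have "(\<Sum>j\<in>N. if j \<in> Q then \<theta> / l * card J * A J j else 0) = \<theta> / l * card J * (\<Sum>j\<in>Q. A J j)"
      using fin by (simp add: sum_distrib_left flip: sum.inter_restrict)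
    then show "a J * (\<theta> / l * card J * (\<Sum>j\<in>Q. A J j) - (\<Sum>j\<in>N. R J j))
      = (\<Sum>j\<in>N. a J * ((if j \<in> Q then \<theta> / l * card J * A J j else 0) - R J j))"
      by (simp add: sum_subtractf flip: sum_distrib_left)
  qed simp
  also have "\<dots> = (\<Sum>j\<in>N. \<Sum>J\<in>Pow {1..l}. a J * ((if j \<in> Q then \<theta> / l * card J * A J j else 0) - R J j))"
    by (rule sum.swap)
  also have "\<dots> \<le> toward N Q \<theta> l (gain N \<rho> l g) z"
    unfolding toward_def
  proof (rule sum_mono)
    fix j assume j: "j \<in> N"
    show "(\<Sum>J\<in>Pow {1..l}. a J * ((if j \<in> Q then \<theta> / l * card J * A J j else 0) - R J j))
      \<le> (if j \<in> Q then \<theta> / l * (\<Sum>k=1..l. gain N \<rho> l g (z(j := k)) - gain N \<rho> l g z) else 0)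
        + (1 - (if j \<in> Q then \<theta> else 0)) * (gain N \<rho> l g (z(j := 0)) - gain N \<rho> l g z)"
    proof (cases "j \<in> Q")
      case True
      \<comment> \<open>The removal loss splits into weight \<open>\<theta>\<close> from the moves
        into slots and \<open>1 - \<theta>\<close> from the move to 0.\<close>
      have "(\<Sum>J\<in>Pow {1..l}. a J * (\<theta> / l * card J * A J j - R J j))
        = \<theta> / l * (\<Sum>J\<in>Pow {1..l}. a J * (card J * A J j - l * R J j))
          + (1 - \<theta>) * (- (\<Sum>J\<in>Pow {1..l}. a J * R J j))"
        unfolding sum_distrib_left sum_negf[symmetric] sum.distrib[symmetric]
        using l by (intro sum.cong) (auto simp: field_simps)
      also have "\<dots> \<le> \<theta> / l * (\<Sum>k=1..l. gain N \<rho> l g (z(j := k)) - gain N \<rho> l g z)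
          + (1 - \<theta>) * (gain N \<rho> l g (z(j := 0)) - gain N \<rho> l g z)"
        unfolding rem[OF j] using add[OF j] \<theta> by (intro add_right_mono mult_left_mono) auto
      finally show ?thesis using True by simp
    next
      case False
      then show ?thesis by (simp add: rem[OF j] sum_negf)
    qed
  qed
  finally show ?thesis unfolding a_def A_def R_def .
qed

text \<open>The first product is what a set of \<open>m\<close> slots receives from the sets with
  one more slot, the second what it loses itself. Both equal
  \<open>\<rho> ^ m / (l choose m)\<close>, the second because
  \<open>\<theta> / l * m + m = \<rho> * m\<close>. They cancel except at the ends: for
  \<open>m = l\<close> there is no larger set, and for \<open>m = 0\<close> nothing is lost.\<close>

lemma coef_telescope:
  assumes l: "0 < l" and m: "m \<le> l" and \<rho>: "\<rho> = 1 + \<theta> / l" "0 \<le> \<theta>"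
  shows "(real l - real m) * coef \<rho> l (m + 1) - coef \<rho> l m * (\<theta> / l * m + m)
    = (if m = l then - (\<rho> ^ l) else if m = 0 then 1 else 0)"
proof -
  have \<rho>0: "0 < \<rho>" using \<rho> by (simp add: add_pos_nonneg)
  have up: "(real l - real m) * coef \<rho> l (m + 1) = \<rho> ^ m / real (l choose m)" if "m < l"
  proof -
    have "Suc m * (l choose Suc m) = (l - m) * (l choose m)"
      by (metis binomial_absorb_comp binomial_absorption)
    then have "real (Suc m) * real (l choose Suc m) = (real l - real m) * real (l choose m)"
      using m by (metis of_nat_diff of_nat_mult)
    moreover have "real l - real m \<noteq> 0" using that by simp
    ultimately show ?thesis by (simp add: coef_def)
  qed
  have down: "coef \<rho> l m * (\<theta> / l * m + m) = \<rho> ^ m / real (l choose m)" if "0 < m"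
  proof -
    have "\<theta> / l * m + m = \<rho> * m" using \<rho> by (simp add: algebra_simps)
    moreover have "\<rho> ^ m = \<rho> ^ (m - 1) * \<rho>" using that by (simp flip: power_Suc2)
    ultimately show ?thesis using that by (simp add: coef_def)
  qed
  show ?thesis
    using up down l m by (cases "m = l"; cases "m = 0") (auto simp: coef_def)
qed

text \<open>Adding all of \<open>Q\<close> to \<open>S J\<close> gains at least
  \<open>g Q - g (S J)\<close>, and emptying slot \<open>k\<close> costs at most
  \<open>g (S J) - g (S (J - {k}))\<close>. Summed with the weights \<open>coef\<close>, all
  intermediate \<open>g (S J)\<close> cancel and only the full set of slots remains on the negative
  side. The factor of \<open>g Q\<close> is a geometric sum.\<close>

lemma toward_gain:
  assumes sub: "submodular_on N g" and mono: "mono_on (Pow N) g" and nonneg: "0 \<le> g {}"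
    and fin: "finite N" and Q: "Q \<subseteq> N" and \<theta>: "0 \<le> \<theta>" and l: "0 < l" and \<rho>: "\<rho> = 1 + \<theta> / l"
  shows "toward N Q \<theta> l (gain N \<rho> l g) z \<ge> (\<rho> ^ l - 1) * g Q - \<rho> ^ l * g (slots N z {1..l})"
proof -
  define S where "S J = slots N z J" for J
  define a where "a J = coef \<rho> l (card J)" for J :: "nat set"
  have \<rho>0: "0 \<le> \<rho>" using \<rho> \<theta> by simp
  have a: "0 \<le> a J" for J using coef_nonneg[OF \<rho>0] by (simp add: a_def)
  have SN: "S J \<subseteq> N" for J by (auto simp: S_def slots_def)
  have finS: "finite (S J)" for J using finite_subset[OF SN fin] .
  have mono': "g X \<le> g Y" if "X \<subseteq> Y" "Y \<subseteq> N" for X Y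
    using that by (intro mono_onD[OF mono]) auto
  have Jfin: "finite J" if "J \<subseteq> {1..l}" for J :: "nat set" using that finite_subset by auto
  have per: "\<theta> / l * card J * (\<Sum>j\<in>Q. g (insert j (S J)) - g (S J)) - (\<Sum>j\<in>N. g (S J) - g (S J - {j}))
    \<ge> \<theta> / l * card J * g Q - (\<theta> / l * card J + card J) * g (S J) + (\<Sum>k\<in>J. g (S (J - {k})))"
    if "J \<subseteq> {1..l}" for J
  proof -
    have "g Q - g (S J) \<le> g (S J \<union> Q) - g (S J)" using SN Q by (simp add: mono')
    also have "\<dots> \<le> (\<Sum>j\<in>Q. g (insert j (S J)) - g (S J))"
      using submodular_sum_additions[OF sub mono SN Q] fin Q finite_subset by auto
    finally have 1: "\<theta> / l * card J * (g Q - g (S J))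
        \<le> \<theta> / l * card J * (\<Sum>j\<in>Q. g (insert j (S J)) - g (S J))"
      using \<theta> by (intro mult_left_mono) auto
    have "(\<Sum>j\<in>N. g (S J) - g (S J - {j})) = (\<Sum>j\<in>S J. g (S J) - g (S J - {j}))"
      using fin SN by (intro sum.mono_neutral_right) auto
    \<comment> \<open>Grouping by slot matters: applied to all of \<open>S J\<close> at once, the
      removal inequality would only yield \<open>g (S J) - g {}\<close> instead of a sum of
      \<open>card J\<close> differences.\<close>
    also have "\<dots> = (\<Sum>k\<in>J. \<Sum>j\<in>{j \<in> S J. z j = k}. g (S J) - g (S J - {j}))"
      using finS Jfin[OF that] by (intro sum.group[symmetric]) (auto simp: S_def slots_def)
    also have "\<dots> \<le> (\<Sum>k\<in>J. g (S J) - g (S (J - {k})))"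
    proof (rule sum_mono)
      fix k assume "k \<in> J"
      have "(\<Sum>j\<in>{j \<in> S J. z j = k}. g (S J) - g (S J - {j}))
          \<le> g (S J) - g (S J - {j \<in> S J. z j = k})"
        using finS SN by (intro submodular_sum_removals[OF sub mono]) auto
      also have "S J - {j \<in> S J. z j = k} = S (J - {k})" by (auto simp: S_def slots_def)
      finally show "(\<Sum>j\<in>{j \<in> S J. z j = k}. g (S J) - g (S J - {j})) \<le> g (S J) - g (S (J - {k}))" .
    qed
    also have "\<dots> = card J * g (S J) - (\<Sum>k\<in>J. g (S (J - {k})))" by (simp add: sum_subtractf)
    finally show ?thesis using 1 by (simp add: algebra_simps diff_divide_distrib)
  qed
  \<comment> \<open>The binomial coefficients and the factors \<open>m\<close> cancel against
    \<open>coef\<close>, leaving the geometric series with ratio \<open>\<rho>\<close> and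
    \<open>\<theta> / l = \<rho> - 1\<close>.\<close>
  have tot: "(\<Sum>J\<in>Pow {1..l}. a J * (\<theta> / l * card J)) = \<rho> ^ l - 1"
  proof -
    have "(\<Sum>J\<in>Pow {1..l}. a J * (\<theta> / l * card J)) = \<theta> / l * (\<Sum>J\<in>Pow {1..l}. coef \<rho> l (card J) * card J)"
      by (simp add: a_def sum_distrib_left algebra_simps)
    also have "(\<Sum>J\<in>Pow {1..l}. coef \<rho> l (card J) * card J)
        = (\<Sum>m\<le>l. real (l choose m) * (coef \<rho> l m * m))"
      using sum_Pow_card[of "{1..l}" "\<lambda>m. coef \<rho> l m * m"] by simp
    also have "\<dots> = (\<Sum>m\<in>{1..l}. \<rho> ^ (m - 1))"
      by (rule sum.mono_neutral_cong_right) (auto simp: coef_def)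
    also have "\<dots> = (\<Sum>m<l. \<rho> ^ m)"
      by (rule sum.reindex_bij_witness[where i = Suc and j = "\<lambda>m. m - 1"]) auto
    also have "\<theta> / l * \<dots> = \<rho> ^ l - 1" using power_diff_1_eq[of \<rho> l] \<rho> by simp
    finally show ?thesis .
  qed
  have "(\<rho> ^ l - 1) * g Q - \<rho> ^ l * g (S {1..l})
    \<le> (\<rho> ^ l - 1) * g Q + (\<Sum>J\<in>Pow {1..l}.
        ((real l - card J) * coef \<rho> l (card J + 1) - a J * (\<theta> / l * card J + card J)) * g (S J))"
  proof -
    have "- (\<rho> ^ l * g (S {1..l})) = (\<Sum>J\<in>Pow {1..l}. if J = {1..l} then - (\<rho> ^ l * g (S J)) else 0)"
      by simp
    also have "\<dots> \<le> (\<Sum>J\<in>Pow {1..l}.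
        ((real l - card J) * coef \<rho> l (card J + 1) - a J * (\<theta> / l * card J + card J)) * g (S J))"
    proof (rule sum_mono)
      fix J assume J: "J \<in> Pow {1..l}"
      then have c: "card J \<le> l" using card_mono[of "{1..l}" J] by auto
      have e: "card J = l \<longleftrightarrow> J = {1..l}" using J card_subset_eq[of "{1..l}" J] by auto
      \<comment> \<open>This discards the surviving term of the empty set of slots, which has weight
        1.\<close>
      have "0 \<le> g (S J)" using nonneg mono'[of "{}" "S J"] SN by auto
      then show "(if J = {1..l} then - (\<rho> ^ l * g (S J)) else 0)
        \<le> ((real l - card J) * coef \<rho> l (card J + 1) - a J * (\<theta> / l * card J + card J)) * g (S J)"
        unfolding a_def coef_telescope[OF l c \<rho> \<theta>] using e by auto
    qed
    finally show ?thesis by simp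
  qed
  also have "\<dots> = (\<Sum>J\<in>Pow {1..l}. a J * (\<theta> / l * card J * g Q - (\<theta> / l * card J + card J) * g (S J)))
      + (\<Sum>J\<in>Pow {1..l}. (real l - card J) * coef \<rho> l (card J + 1) * g (S J))"
    unfolding tot[symmetric] sum_distrib_right sum.distrib[symmetric]
    by (intro sum.cong) (auto simp: algebra_simps)
  also have "(\<Sum>J\<in>Pow {1..l}. (real l - card J) * coef \<rho> l (card J + 1) * g (S J))
      = (\<Sum>J\<in>Pow {1..l}. a J * (\<Sum>k\<in>J. g (S (J - {k}))))"
    unfolding a_def by (subst sum_remove_one) auto
  also have "(\<Sum>J\<in>Pow {1..l}. a J * (\<theta> / l * card J * g Q - (\<theta> / l * card J + card J) * g (S J))) + \<dots>
      \<le> (\<Sum>J\<in>Pow {1..l}. a J * (\<theta> / l * card J * (\<Sum>j\<in>Q. g (insert j (S J)) - g (S J))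
          - (\<Sum>j\<in>N. g (S J) - g (S J - {j}))))"
    unfolding sum.distrib[symmetric] distrib_left[symmetric]
    using per a by (intro sum_mono mult_left_mono) auto
  also have "\<dots> \<le> toward N Q \<theta> l (gain N \<rho> l g) z"
    using toward_gain_expand[OF mono fin Q \<theta> \<rho>0 l] by (simp add: a_def S_def)
  finally show ?thesis by (simp add: S_def)
qed

section \<open>Quadratic penalties along the direction toward the target\<close>

lemma pos_sq_add:
  fixes w h d :: real
  assumes "0 \<le> h" "h \<le> d"
  shows "(max 0 (w + h))\<^sup>2 - (max 0 w)\<^sup>2 \<le> (2 * max 0 w + d) * h"
proof -
  have "max 0 (w + h) \<le> max 0 w + h" using assms by auto
  then have "(max 0 (w + h))\<^sup>2 \<le> (max 0 w + h)\<^sup>2" by (intro power_mono) auto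
  \<comment> \<open>The second-order term is made linear in \<open>h\<close>, so that summed over
    all elements it is bounded by \<open>d\<close> times a load.\<close>
  moreover have "h * h \<le> d * h" using assms by (intro mult_right_mono) auto
  ultimately show ?thesis by (simp add: power2_eq_square algebra_simps)
qed

lemma pos_sq_sub:
  fixes w h d :: real
  assumes "0 \<le> h" "h \<le> d"
  shows "(max 0 (w - h))\<^sup>2 - (max 0 w)\<^sup>2 \<le> - (2 * max 0 w - d) * h"
proof -
  have *: "(max 0 (w - h))\<^sup>2 \<le> (max 0 w - h)\<^sup>2"
  proof (cases "w \<ge> h")
    case True
    then show ?thesis using assms by (simp add: max_def)
  next
    case False
    then show ?thesis by (simp add: max_def)
  qed
  have "h * h \<le> d * h" using assms by (intro mult_right_mono) auto
  then show ?thesis using * by (simp add: power2_eq_square algebra_simps)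
qed

text \<open>For every element the moves carry nonnegative weights with sum 1, so the derivative is
  an average of single-move gains per element.\<close>

lemma toward_le:
  fixes \<eta> :: real
  assumes le: "\<And>j k. j \<in> N \<Longrightarrow> k \<le> l \<Longrightarrow> H (z(j := k)) \<le> H z + \<eta>"
    and \<theta>: "0 \<le> \<theta>" "\<theta> \<le> 1" and l: "0 < l"
  shows "toward N Q \<theta> l H z \<le> card N * \<eta>"
proof -
  have "toward N Q \<theta> l H z \<le> (\<Sum>j\<in>N. \<eta>)"
    unfolding toward_def
  proof (rule sum_mono)
    fix j assume j: "j \<in> N"
    have 0: "H (z(j := 0)) - H z \<le> \<eta>" using le[OF j, of 0] by simp
    have "(\<Sum>k=1..l. H (z(j := k)) - H z) \<le> (\<Sum>k=1..l. \<eta>)"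
    proof (rule sum_mono)
      fix k assume "k \<in> {1..l}"
      then show "H (z(j := k)) - H z \<le> \<eta>" using le[OF j, of k] by simp
    qed
    then have "\<theta> / l * (\<Sum>k=1..l. H (z(j := k)) - H z) \<le> \<theta> / l * (l * \<eta>)"
      using \<theta> by (intro mult_left_mono) auto
    moreover have "(1 - \<theta>) * (H (z(j := 0)) - H z) \<le> (1 - \<theta>) * \<eta>"
      using \<theta> 0 by (intro mult_left_mono) auto
    ultimately show "(if j \<in> Q then \<theta> / l * (\<Sum>k=1..l. H (z(j := k)) - H z) else 0)
        + (1 - (if j \<in> Q then \<theta> else 0)) * (H (z(j := 0)) - H z) \<le> \<eta>"
      using 0 l by (auto simp: algebra_simps)
  qed
  then show ?thesis by simp
qed

lemma toward_linear:
  "toward N Q \<theta> l (\<lambda>z. F z + c * H z) z = toward N Q \<theta> l F z + c * toward N Q \<theta> l H z"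
proof -
  define D where "D F j = (\<Sum>k=1..l. F (z(j := k)) - F z)" for F :: "(nat \<Rightarrow> nat) \<Rightarrow> real" and j
  have *: "(\<Sum>k=1..l. F (z(j := k)) + c * H (z(j := k)) - (F z + c * H z)) = D F j + c * D H j" for j
    unfolding D_def sum_distrib_left sum.distrib[symmetric]
    by (intro sum.cong) (simp_all add: algebra_simps)
  \<comment> \<open>Used with \<open>t = \<theta> / l\<close> for elements of \<open>Q\<close> and
    with \<open>t = 0\<close> for the others.\<close>
  have "t * (A + c * B) + w * (x + c * y - (x' + c * y')) = t * A + w * (x - x') + c * (t * B + w * (y - y'))"
    for t A B w x y x' y' :: real by (simp add: algebra_simps)
  from this[of "\<theta> / real l"] this[of 0] show ?thesis
    unfolding toward_def * D_def[symmetric] sum_distrib_left[where r = c] sum.distrib[symmetric]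
    by (intro sum.cong) auto
qed

lemma toward_sum: "toward N Q \<theta> l (\<lambda>z. \<Sum>i\<in>I. H i z) z = (\<Sum>i\<in>I. toward N Q \<theta> l (H i) z)"
proof -
  have zero: "toward N Q \<theta> l (\<lambda>z. 0) z = 0" by (auto simp: toward_def intro!: sum.neutral)
  show ?thesis
  proof (cases "finite I")
    case True
    then show ?thesis
    proof (induction I)
      case (insert i I)
      then show ?case
        using toward_linear[of N Q \<theta> l "H i" 1 "\<lambda>z. \<Sum>i\<in>I. H i z" z] by simp
    qed (simp add: zero)
  qed (simp add: zero)
qed

lemma toward_mono:
  assumes add: "\<And>j k. j \<in> N \<Longrightarrow> j \<in> Q \<Longrightarrow> 1 \<le> k \<Longrightarrow> k \<le> l \<Longrightarrow> H (z(j := k)) - H z \<le> (if z j = 0 then A j else 0)"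
    and rem: "\<And>j. j \<in> N \<Longrightarrow> z j \<noteq> 0 \<Longrightarrow> H (z(j := 0)) - H z \<le> - B j"
    and AB: "\<And>j. j \<in> N \<Longrightarrow> B j \<le> A j"
    and fin: "finite N" and Q: "Q \<subseteq> N" and \<theta>: "0 \<le> \<theta>" "\<theta> \<le> 1" and l: "0 < l"
  shows "toward N Q \<theta> l H z \<le> \<theta> * (\<Sum>j\<in>Q. A j) - (\<Sum>j\<in>{j \<in> N. z j \<noteq> 0}. B j)"
proof -
  have "N \<inter> Q = Q" using Q by auto
  then have "\<theta> * (\<Sum>j\<in>Q. A j) - (\<Sum>j\<in>{j \<in> N. z j \<noteq> 0}. B j)
    = (\<Sum>j\<in>N. (if j \<in> Q then \<theta> * A j else 0) - (if z j \<noteq> 0 then B j else 0))"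
    using fin by (simp add: sum_subtractf sum_distrib_left sum.inter_filter flip: sum.inter_restrict)
  moreover have "toward N Q \<theta> l H z \<le> \<dots>"
    unfolding toward_def
  proof (rule sum_mono)
    fix j assume j: "j \<in> N"
    have z0: "z(j := 0) = z" if "z j = 0" using that by auto
    have 1: "\<theta> / l * (\<Sum>k=1..l. H (z(j := k)) - H z) \<le> \<theta> * (if z j = 0 then A j else 0)" if "j \<in> Q"
    proof -
      have "(\<Sum>k=1..l. H (z(j := k)) - H z) \<le> (\<Sum>k=1..l. if z j = 0 then A j else 0)"
        using add[OF j that] by (intro sum_mono) auto
      then have "\<theta> / l * (\<Sum>k=1..l. H (z(j := k)) - H z) \<le> \<theta> / l * (l * (if z j = 0 then A j else 0))"
        using \<theta> by (intro mult_left_mono) auto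
      then show ?thesis using l by simp
    qed
    have 2: "(1 - \<theta>) * (H (z(j := 0)) - H z) \<le> (1 - \<theta>) * (if z j \<noteq> 0 then - B j else 0)"
      using rem[OF j] z0 \<theta> by (intro mult_left_mono) auto
    have 3: "H (z(j := 0)) - H z \<le> (if z j \<noteq> 0 then - B j else 0)"
      using rem[OF j] z0 by auto
    \<comment> \<open>Needed for a used \<open>j \<in> Q\<close>: only the move to 0 counts, with
      weight \<open>1 - \<theta>\<close>, and \<open>- (1 - \<theta>) * B j\<close> has to be below
      \<open>\<theta> * A j - B j\<close>.\<close>
    have 4: "\<theta> * B j \<le> \<theta> * A j" using AB[OF j] \<theta> by (intro mult_left_mono) auto
    show "(if j \<in> Q then \<theta> / l * (\<Sum>k=1..l. H (z(j := k)) - H z) else 0)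
        + (1 - (if j \<in> Q then \<theta> else 0)) * (H (z(j := 0)) - H z)
      \<le> (if j \<in> Q then \<theta> * A j else 0) - (if z j \<noteq> 0 then B j else 0)"
      using 1 2 3 4 by (cases "j \<in> Q"; cases "z j = 0") (auto simp: algebra_simps)
  qed
  ultimately show ?thesis by simp
qed

definition load :: "nat set \<Rightarrow> (nat \<Rightarrow> real) \<Rightarrow> (nat \<Rightarrow> nat) \<Rightarrow> real" where
  "load N a z = (\<Sum>j\<in>{j \<in> N. z j \<noteq> 0}. a j)"

lemma load_upd:
  assumes "finite N" "j \<in> N"
  shows "load N a (z(j := k))
    = load N a z - (if z j \<noteq> 0 then a j else 0) + (if k \<noteq> 0 then a j else 0)"
proof -
  have *: "load N a y = (if y j \<noteq> 0 then a j else 0) + (\<Sum>i\<in>{i \<in> N - {j}. y i \<noteq> 0}. a i)" for y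
  proof -
    have "{i \<in> N. y i \<noteq> 0} = (if y j \<noteq> 0 then insert j {i \<in> N - {j}. y i \<noteq> 0} else {i \<in> N - {j}. y i \<noteq> 0})"
      using assms(2) by auto
    then show ?thesis using assms(1) by (simp add: load_def)
  qed
  have "{i \<in> N - {j}. (z(j := k)) i \<noteq> 0} = {i \<in> N - {j}. z i \<noteq> 0}" by auto
  then show ?thesis using *[of z] *[of "z(j := k)"] by simp
qed

text \<open>The penalties are convex, so their derivative in the direction of a feasible point is at most minus
  their value; single moves add second-order terms of at most \<open>a j * a j \<le> d * a j\<close> each.\<close>

lemma toward_packing_penalty:
  assumes fin: "finite N" and Q: "Q \<subseteq> N" and \<theta>: "0 \<le> \<theta>" "\<theta> \<le> 1" and l: "0 < l"
    and a: "\<And>j. j \<in> N \<Longrightarrow> 0 \<le> a j" "\<And>j. j \<in> N \<Longrightarrow> a j \<le> d"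
    and d: "0 \<le> d" "d \<le> 1" and aQ: "(\<Sum>j\<in>Q. a j) \<le> 1"
  shows "toward N Q \<theta> l (\<lambda>z. (max 0 (load N a z - \<theta>))\<^sup>2) z \<le> 3 * d - (max 0 (load N a z - \<theta>))\<^sup>2"
proof -
  define u where "u = load N a z"
  define v where "v = max 0 (u - \<theta>)"
  have u0: "0 \<le> u" unfolding u_def load_def using a by (intro sum_nonneg) auto
  have v0: "0 \<le> v" by (simp add: v_def)
  have "toward N Q \<theta> l (\<lambda>z. (max 0 (load N a z - \<theta>))\<^sup>2) z
    \<le> \<theta> * (\<Sum>j\<in>Q. (2 * v + d) * a j) - (\<Sum>j\<in>{j \<in> N. z j \<noteq> 0}. (2 * v - d) * a j)"
  proof (rule toward_mono[OF _ _ _ fin Q \<theta> l])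
    fix j k :: nat assume j: "j \<in> N" and k: "1 \<le> k" "k \<le> l"
    show "(max 0 (load N a (z(j := k)) - \<theta>))\<^sup>2 - (max 0 (load N a z - \<theta>))\<^sup>2
      \<le> (if z j = 0 then (2 * v + d) * a j else 0)"
      using pos_sq_add[OF a[OF j], of "u - \<theta>"] k
      by (auto simp: load_upd[OF fin j] u_def v_def algebra_simps)
  next
    fix j assume j: "j \<in> N" and z: "z j \<noteq> 0"
    show "(max 0 (load N a (z(j := 0)) - \<theta>))\<^sup>2 - (max 0 (load N a z - \<theta>))\<^sup>2 \<le> - ((2 * v - d) * a j)"
      using pos_sq_sub[OF a[OF j], of "u - \<theta>"] z
      by (auto simp: load_upd[OF fin j] u_def v_def algebra_simps)
  next
    fix j assume "j \<in> N"
    then show "(2 * v - d) * a j \<le> (2 * v + d) * a j" using a d by (intro mult_right_mono) auto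
  qed
  also have "\<dots> = \<theta> * ((2 * v + d) * (\<Sum>j\<in>Q. a j)) - (2 * v - d) * u"
    by (simp add: u_def load_def sum_distrib_left)
  also have "\<dots> \<le> \<theta> * ((2 * v + d) * 1) - (2 * v - d) * u"
    using aQ v0 d \<theta> by (intro diff_right_mono mult_left_mono) auto
  also have "\<dots> \<le> 3 * d - v\<^sup>2"
  \<comment> \<open>Without violation only the error \<open>d * (\<theta> + u)\<close> remains, at
    most \<open>2 * d\<close>. With violation \<open>v\<close> the first-order terms give exactly
    minus twice the square of \<open>v\<close>.\<close>
  proof (cases "u \<le> \<theta>")
    case True
    have "d * \<theta> \<le> d" "d * u \<le> d" using True d \<theta> u0 by (auto intro: mult_left_le)
    moreover have "v = 0" using True by (simp add: v_def)
    ultimately show ?thesis using d by (simp add: algebra_simps)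
  next
    case False
    then have u: "u = \<theta> + v" by (simp add: v_def)
    have "d * \<theta> \<le> d" using d \<theta> by (auto intro: mult_left_le)
    \<comment> \<open>No bound on \<open>v\<close> is available; one of the two negative squares of
      \<open>v\<close> absorbs this error term.\<close>
    moreover have "d * v \<le> v\<^sup>2 + d"
    proof -
      have "0 \<le> (v - d / 2)\<^sup>2" by simp
      moreover have "d * d \<le> d" using d by (intro mult_left_le) auto
      ultimately show ?thesis using d by (simp add: power2_eq_square algebra_simps)
    qed
    ultimately show ?thesis by (simp add: u power2_eq_square algebra_simps)
  qed
  finally show ?thesis by (simp add: u_def v_def)
qed

text \<open>Unlike a packing load, the load of a covering row is not bounded above, neither for
  \<open>z\<close> nor for \<open>Q\<close>, and a row with \<open>1 \<le> e\<close> may contain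
  large elements. Both difficulties occur only where the penalty vanishes locally or can be cut off
  at 0.\<close>

lemma toward_covering_penalty:
  assumes fin: "finite N" and Q: "Q \<subseteq> N" and \<theta>: "0 \<le> \<theta>" "\<theta> \<le> 1" and l: "0 < l"
    and a: "\<And>j. j \<in> N \<Longrightarrow> 0 \<le> a j" and small: "(\<forall>j\<in>N. a j \<le> d) \<or> 1 \<le> e"
    and d: "0 < d" "d \<le> 1" and e: "0 \<le> e" and aQ: "r \<le> e + (\<Sum>j\<in>Q. a j)" "0 \<le> r" "r \<le> 1"
    and \<beta>: "0 \<le> \<beta>" "\<beta> \<le> \<theta> * r"
  shows "toward N Q \<theta> l (\<lambda>z. (max 0 (\<beta> - (e + load N a z)))\<^sup>2) z
    \<le> 5 * d - (max 0 (\<beta> - (e + load N a z)))\<^sup>2"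
proof -
  define u where "u = e + load N a z"
  define v where "v = max 0 (\<beta> - u)"
  have load0: "0 \<le> load N a y" for y unfolding load_def using a by (intro sum_nonneg) auto
  have v0: "0 \<le> v" by (simp add: v_def)
  have \<theta>r: "\<theta> * r \<le> 1" using \<theta> aQ by (simp add: mult_le_one)
  show ?thesis
  \<comment> \<open>Here the penalty is 0 at \<open>z\<close> and stays 0 after any single move:
    either the guessed elements alone reach \<open>\<beta>\<close>, or the surplus exceeds
    \<open>d\<close>, the largest loss of one move.\<close>
  proof (cases "1 \<le> e \<or> \<beta> + d < u")
    case True
    have zero: "max 0 (\<beta> - (e + load N a (z(j := k)))) = 0" if j: "j \<in> N" for j k
    proof (cases "1 \<le> e")
      case False
      then have "a j \<le> d" "\<beta> + d < u" using small j True by auto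
      then show ?thesis using a[OF j] by (auto simp: u_def load_upd[OF fin j])
    next
      case True
      then have "\<beta> \<le> e" using \<beta> \<theta>r by linarith
      then show ?thesis using load0[of "z(j := k)"] by simp
    qed
    have "max 0 (\<beta> - (e + load N a z)) = 0"
    proof (cases "1 \<le> e")
      case True
      then have "\<beta> \<le> e" using \<beta> \<theta>r by linarith
      then show ?thesis using load0[of z] by simp
    qed (use True d in \<open>auto simp: u_def\<close>)
    moreover from this zero
    have "toward N Q \<theta> l (\<lambda>z. (max 0 (\<beta> - (e + load N a z)))\<^sup>2) z = 0"
      unfolding toward_def by (intro sum.neutral) (auto intro!: sum.neutral)
    ultimately show ?thesis using d by simp
  next
    case False
    then have ad: "a j \<le> d" if "j \<in> N" for j using small that by auto
    have e1: "e < 1" and ud: "u \<le> \<beta> + d" using False by auto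
    have "toward N Q \<theta> l (\<lambda>z. (max 0 (\<beta> - (e + load N a z)))\<^sup>2) z
      \<le> \<theta> * (\<Sum>j\<in>Q. min 0 (- (2 * v - d) * a j)) - (\<Sum>j\<in>{j \<in> N. z j \<noteq> 0}. - (2 * v + d) * a j)"
    proof (rule toward_mono[OF _ _ _ fin Q \<theta> l])
      fix j k :: nat assume j: "j \<in> N" and k: "1 \<le> k" "k \<le> l"
      \<comment> \<open>Adding an element never raises the penalty. The resulting
        \<open>min 0\<close> is essential: the sum of \<open>a j\<close> over \<open>Q\<close> has
        no upper bound, so a positive error \<open>d * a j\<close> could not be summed.\<close>
      have "(max 0 (\<beta> - u - a j))\<^sup>2 \<le> (max 0 (\<beta> - u))\<^sup>2"
        using a[OF j] by (intro power_mono) auto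
      then have "(max 0 (\<beta> - u - a j))\<^sup>2 - (max 0 (\<beta> - u))\<^sup>2 \<le> min 0 (- (2 * v - d) * a j)"
        using pos_sq_sub[OF a[OF j] ad[OF j], of "\<beta> - u"] unfolding v_def by linarith
      moreover have "load N a (z(j := k)) = (if z j = 0 then load N a z + a j else load N a z)"
        using k by (simp add: load_upd[OF fin j])
      ultimately show "(max 0 (\<beta> - (e + load N a (z(j := k)))))\<^sup>2 - (max 0 (\<beta> - (e + load N a z)))\<^sup>2
        \<le> (if z j = 0 then min 0 (- (2 * v - d) * a j) else 0)"
        by (cases "z j = 0") (simp_all add: u_def algebra_simps)
    next
      fix j assume j: "j \<in> N" and z: "z j \<noteq> 0"
      show "(max 0 (\<beta> - (e + load N a (z(j := 0)))))\<^sup>2 - (max 0 (\<beta> - (e + load N a z)))\<^sup>2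
        \<le> - (- (2 * v + d) * a j)"
        using pos_sq_add[OF a[OF j] ad[OF j], of "\<beta> - u"] z
        by (auto simp: load_upd[OF fin j] u_def v_def algebra_simps)
    next
      fix j assume j: "j \<in> N"
      have "0 \<le> v * a j" "0 \<le> d * a j" using a[OF j] d v0 by auto
      then show "- (2 * v + d) * a j \<le> min 0 (- (2 * v - d) * a j)"
        by (simp add: algebra_simps)
    qed
    also have "(\<Sum>j\<in>{j \<in> N. z j \<noteq> 0}. - (2 * v + d) * a j) = - (2 * v + d) * (u - e)"
      by (simp only: u_def load_def sum_distrib_left add_diff_cancel_left')
    also have "\<theta> * (\<Sum>j\<in>Q. min 0 (- (2 * v - d) * a j)) - (- (2 * v + d) * (u - e))
      = \<theta> * (\<Sum>j\<in>Q. min 0 (- (2 * v - d) * a j)) + (2 * v + d) * (u - e)"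
      by (simp only: minus_mult_left[symmetric] diff_minus_eq_add)
    also have "\<dots> \<le> 5 * d - v\<^sup>2"
    proof (cases "2 * v \<le> d")
      case True
      have "(\<Sum>j\<in>Q. min 0 (- (2 * v - d) * a j)) \<le> 0" by (intro sum_nonpos) auto
      then have "\<theta> * (\<Sum>j\<in>Q. min 0 (- (2 * v - d) * a j)) \<le> 0"
        using \<theta> by (simp add: mult_nonneg_nonpos)
      \<comment> \<open>\<open>u \<le> \<beta> + d \<le> 2\<close> bounds the load. The
        \<open>4 * d\<close> obtained here and the square of \<open>v\<close>, at most
        \<open>d\<close>, make up the constant 5.\<close>
      moreover have "(2 * v + d) * (u - e) \<le> (2 * d) * 2"
        using True ud d e v0 \<beta> \<theta>r load0[of z] by (intro mult_mono) (auto simp: u_def)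
      moreover have "v\<^sup>2 \<le> d"
      proof -
        have "v * v \<le> d * 1" using True v0 d by (intro mult_mono) auto
        then show ?thesis by (simp add: power2_eq_square)
      qed
      ultimately show ?thesis by linarith
    next
      case False
      then have v: "v = \<beta> - u" using d by (auto simp: v_def max_def split: if_splits)
      have "(\<Sum>j\<in>Q. min 0 (- (2 * v - d) * a j)) \<le> (\<Sum>j\<in>Q. - (2 * v - d) * a j)"
        by (intro sum_mono) auto
      also have "\<dots> = - ((2 * v - d) * (\<Sum>j\<in>Q. a j))"
        by (simp only: sum_distrib_left mult_minus_left sum_negf)
      also have "\<dots> \<le> - ((2 * v - d) * (r - e))"
        using aQ False by (simp add: mult_left_mono)
      finally have "\<theta> * (\<Sum>j\<in>Q. min 0 (- (2 * v - d) * a j)) \<le> \<theta> * - ((2 * v - d) * (r - e))"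
        using \<theta> by (intro mult_left_mono) auto
      \<comment> \<open>The scaled target reaches \<open>e + \<theta> * (r - e)\<close>, which is at
        least \<open>\<theta> * r\<close> and hence at least \<open>\<beta>\<close>; so along this
        direction the deficit \<open>v\<close> closes completely.\<close>
      moreover have "2 * v * ((u - e) - \<theta> * (r - e)) \<le> 2 * v * (- v)"
      proof -
        have "\<theta> * e \<le> e" using \<theta> e by (simp add: mult_left_le_one_le)
        then have "(u - e) - \<theta> * (r - e) \<le> - v" using \<beta> v by (simp add: algebra_simps)
        then show ?thesis using v0 by (intro mult_left_mono) auto
      qed
      moreover have "d * ((u - e) + \<theta> * (r - e)) \<le> d * 2"
      proof -
        have "0 \<le> \<theta> * e" using \<theta> e by simp
        then have "(u - e) + \<theta> * (r - e) \<le> 2"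
          using \<theta>r \<beta> v v0 e by (simp add: algebra_simps)
        then show ?thesis using d by (intro mult_left_mono) auto
      qed
      moreover have "\<theta> * - ((2 * v - d) * (r - e)) + (2 * v + d) * (u - e)
          = 2 * v * ((u - e) - \<theta> * (r - e)) + d * ((u - e) + \<theta> * (r - e))"
        by (simp add: algebra_simps)
      moreover have "2 * v * (- v) = - 2 * v\<^sup>2" "0 \<le> v\<^sup>2" by (simp_all add: power2_eq_square)
      ultimately show ?thesis using d by linarith
    qed
    finally show ?thesis by (simp add: u_def v_def)
  qed
qed

section \<open>The combined potential and its approximate local optima\<close>

text \<open>\<open>0\<close> stands for an unused element, \<open>1, \<dots>, l\<close> are the slots and \<open>Suc l\<close> marks a guessed element.\<close>

definition chosen :: "nat \<Rightarrow> nat \<Rightarrow> (nat \<Rightarrow> nat) \<Rightarrow> nat set \<Rightarrow> nat set" where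
  "chosen n l z J = {j \<in> {1..n}. z j \<in> J \<or> z j = Suc l}"

text \<open>The rows \<open>1, \<dots>, p\<close> of \<open>R\<close> are the packing rows and \<open>p + 1, \<dots>, p + c\<close> the covering rows; \<open>e i\<close>
  is what the guessed elements contribute to row \<open>i\<close>. If \<open>e i = 1\<close> for a packing row then its
  penalty is \<open>0\<close> by division by zero; this is harmless, since then only elements that do not
  occur in the row are moved.\<close>

definition potential :: "nat \<Rightarrow> nat \<Rightarrow> nat \<Rightarrow> nat \<Rightarrow> (nat set \<Rightarrow> real) \<Rightarrow> (nat \<Rightarrow> nat \<Rightarrow> real)
    \<Rightarrow> (nat \<Rightarrow> real) \<Rightarrow> real \<Rightarrow> (nat \<Rightarrow> nat) \<Rightarrow> real" where
  "potential p c K n f R e V z =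
    (\<Sum>J\<in>Pow {1..K}. coef (1 + (1 - 1 / K) / K) K (card J) * min (f (chosen n K z J) / V) 1)
    - (\<Sum>i=1..p. 4 * K\<^sup>2 *
        (max 0 (((\<Sum>j\<in>chosen n K z {1..K}. R i j) - e i) / (1 - e i) - (1 - 1 / K)))\<^sup>2)
    - (\<Sum>i=p+1..p+c. 4 * K\<^sup>2 *
        (max 0 ((1 - 2 / K) - (\<Sum>j\<in>chosen n K z {1..K}. R i j)))\<^sup>2)"

text \<open>\<open>K * ln \<rho>\<close> lies between \<open>1 - 2 / K\<close> and
  \<open>1 - 1 / K\<close>: the upper bound is the compound interest inequality, the lower one
  follows from ln (1 + x) being at least x minus its square. Hence \<open>1 / \<rho> ^ K\<close>
  exceeds 1/e by O(1/K).\<close>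

lemma rho_power_bounds:
  fixes K :: nat
  assumes "2 \<le> K" and \<rho>: "\<rho> = 1 + (1 - 1 / K) / K"
  shows "1 \<le> \<rho> ^ K" "\<rho> ^ K \<le> 3" "1 / \<rho> ^ K \<le> 1 / exp 1 + 2 / K"
proof -
  define x where "x = (1 - 1 / real K) / K"
  have x: "0 \<le> x" "x \<le> 1 / K" "\<rho> = 1 + x" using assms by (auto simp: x_def divide_right_mono)
  then show 1: "1 \<le> \<rho> ^ K" by simp
  have "1 / real K \<le> 1" using assms by simp
  then have "- real K \<le> 1 - 1 / real K" by linarith
  then have "\<rho> ^ K \<le> exp (1 - 1 / K)"
    using exp_ge_one_plus_x_over_n_power_n[of K "1 - 1 / K"] assms by simp
  also have "\<dots> \<le> exp 1" by simp
  finally show "\<rho> ^ K \<le> 3" using exp_le by linarith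
  have x1: "x \<le> 1" using x assms by (auto elim!: order_trans)
  have "K * (x * x) \<le> K * (1 / K * (1 / K))" using x by (intro mult_left_mono mult_mono) auto
  then have "K * (x * x) \<le> 1 / K" using assms by simp
  moreover have "K * x = 1 - 1 / K" using assms by (simp add: x_def)
  ultimately have "1 - 2 / K \<le> K * (x - x\<^sup>2)" by (simp add: power2_eq_square algebra_simps)
  also have "\<dots> \<le> K * ln (1 + x)"
    using ln_one_plus_pos_lower_bound[OF x(1) x1] by (intro mult_left_mono) auto
  also have "\<dots> = ln (\<rho> ^ K)" using x by (simp add: ln_realpow)
  finally have "exp (1 - 2 / K) \<le> \<rho> ^ K" using x by (simp add: ln_ge_iff)
  then have "1 / \<rho> ^ K \<le> 1 / exp (1 - 2 / K)" by (intro divide_left_mono) (auto intro: mult_pos_pos order_less_le_trans[OF zero_less_one 1])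
  also have "\<dots> = exp (2 / K) / exp 1" by (simp add: exp_diff)
  also have "\<dots> \<le> (1 + 4 / K) / exp 1"
  proof -
    have k: "2 / real K \<le> 1" using assms by simp
    have "(2 / real K) * (2 / real K) \<le> 2 / real K" using k by (intro mult_left_le) auto
    then have "(2 / real K)\<^sup>2 \<le> 2 / K" unfolding power2_eq_square .
    then show ?thesis using exp_bound[OF _ k] by (intro divide_right_mono) auto
  qed
  also have "\<dots> = 1 / exp 1 + (4 / K) / exp 1" by (simp add: add_divide_distrib)
  also have "(4 / K) / exp 1 \<le> (4 / real K) / 2"
    using exp_ge_add_one_self[of 1] by (intro divide_left_mono) auto
  finally show "1 / \<rho> ^ K \<le> 1 / exp 1 + 2 / K" by simp
qed

lemma chosen_eq:
  assumes "E \<union> N \<subseteq> {1..n}" "E \<inter> N = {}"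
    and "\<And>j. j \<in> E \<Longrightarrow> z j = Suc l" "\<And>j. j \<in> N \<Longrightarrow> z j \<le> l"
    and "\<And>j. j \<in> {1..n} - E - N \<Longrightarrow> z j = 0" and "J \<subseteq> {1..l}"
  shows "chosen n l z J = slots N z J \<union> E"
proof (rule set_eqI)
  fix j
  consider "j \<in> E" | "j \<in> N" | "j \<in> {1..n} - E - N" | "j \<notin> {1..n}" using assms(1) by blast
  then show "j \<in> chosen n l z J \<longleftrightarrow> j \<in> slots N z J \<union> E"
  proof cases
    case 1
    then show ?thesis using assms(1,3) by (auto simp: chosen_def)
  next
    case 2
    then have "z j \<noteq> Suc l" "j \<in> {1..n}" "j \<notin> E" using assms(1,2) assms(4)[OF 2] by auto
    then show ?thesis using 2 by (simp add: chosen_def slots_def)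
  next
    case 3
    then have "z j = 0" "0 \<notin> J" using assms(5,6) by auto
    then show ?thesis using 3 by (simp add: chosen_def slots_def)
  next
    case 4
    then show ?thesis using assms(1) by (auto simp: chosen_def slots_def)
  qed
qed

text \<open>At a local optimum the derivative toward \<open>Q\<close> is at most
  \<open>n * \<eta>\<close>. Inserting the bounds for the gain and the penalties leaves one
  inequality, \<open>main\<close>, between the value of \<open>Q\<close>, the value of
  \<open>S\<close> and the total penalty \<open>PS\<close>. The values lie in [0, 1], so it bounds
  \<open>PS\<close> and thereby every violation; dropping \<open>PS\<close> from it gives the value
  of \<open>S\<close>.\<close>

lemma local_optimum:
  fixes K p c n :: nat and d \<eta> V :: real
  assumes f: "submodular_on {1..n} f" "mono_on (Pow {1..n}) f" "\<And>S. S \<subseteq> {1..n} \<Longrightarrow> 0 \<le> f S"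
    and R: "\<And>i j. i \<in> {1..p+c} \<Longrightarrow> j \<in> {1..n} \<Longrightarrow> 0 \<le> R i j"
    and EN: "E \<union> N \<subseteq> {1..n}" "E \<inter> N = {}"
    and e: "\<And>i. i \<in> {1..p+c} \<Longrightarrow> e i = (\<Sum>j\<in>E. R i j)"
    and eP: "\<And>i. i \<in> {1..p} \<Longrightarrow> e i \<le> 1"
    and smallP: "\<And>i j. i \<in> {1..p} \<Longrightarrow> j \<in> N \<Longrightarrow> R i j \<le> d * (1 - e i)"
    and smallC: "\<And>i j. i \<in> {p+1..p+c} \<Longrightarrow> j \<in> N \<Longrightarrow> R i j \<le> d \<or> 1 \<le> e i"
    and zE: "\<And>j. j \<in> E \<Longrightarrow> z j = Suc K" and zN: "\<And>j. j \<in> N \<Longrightarrow> z j \<le> K"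
    and z0: "\<And>j. j \<in> {1..n} - E - N \<Longrightarrow> z j = 0"
    and opt: "\<And>j k. j \<in> N \<Longrightarrow> k \<le> K \<Longrightarrow>
        potential p c K n f R e V (z(j := k)) \<le> potential p c K n f R e V z + \<eta>"
    and Q: "Q \<subseteq> N" and QP: "\<And>i. i \<in> {1..p} \<Longrightarrow> (\<Sum>j\<in>Q. R i j) \<le> 1 - e i"
    and QC: "\<And>i. i \<in> {p+1..p+c} \<Longrightarrow> 1 - 1 / K \<le> e i + (\<Sum>j\<in>Q. R i j)"
    and K: "2 \<le> K" and d: "0 < d" "d \<le> 1" and \<eta>: "0 \<le> \<eta>" and V: "0 \<le> V"
    and err: "n * \<eta> + 4 * K\<^sup>2 * d * (3 * p + 5 * c) \<le> 1 / K"
  defines "S \<equiv> chosen n K z {1..K}"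
  shows "\<And>i. i \<in> {1..p} \<Longrightarrow> (\<Sum>j\<in>S. R i j) \<le> 1"
    and "\<And>i. i \<in> {p+1..p+c} \<Longrightarrow> 1 - 3 / K \<le> (\<Sum>j\<in>S. R i j)"
    and "min (f S / V) 1 \<ge> (1 - 1 / exp 1 - 2 / K) * min (f (Q \<union> E) / V) 1 - 1 / K"
proof -
  define \<theta> where "\<theta> = 1 - 1 / real K"
  define \<rho> where "\<rho> = 1 + \<theta> / K"
  define g where "g A = min (f (A \<union> E) / V) 1" for A
  define a where "a i j = R i j / (1 - e i)" for i j
  define PP where "PP i = (\<lambda>z. (max 0 (load N (a i) z - \<theta>))\<^sup>2)" for i
  define PC where "PC i = (\<lambda>z. (max 0 ((1 - 2 / K) - (e i + load N (R i) z)))\<^sup>2)" for i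
  define H where "H = (\<lambda>z. gain N \<rho> K g z + (- 4 * K\<^sup>2) * ((\<Sum>i=1..p. PP i z) + (\<Sum>i=p+1..p+c. PC i z)))"
  have \<theta>: "0 \<le> \<theta>" "\<theta> \<le> 1" and K0: "0 < K" using K by (auto simp: \<theta>_def)
  have fin: "finite N" "finite E" using EN finite_subset[of _ "{1..n}"] by auto
  note rb = rho_power_bounds[OF K \<rho>_def[unfolded \<theta>_def]]
  have sumRN: "(\<Sum>j\<in>chosen n K y {1..K}. R i j) = e i + load N (R i) y"
    if y: "\<And>j. j \<in> E \<Longrightarrow> y j = Suc K" "\<And>j. j \<in> N \<Longrightarrow> y j \<le> K"
      "\<And>j. j \<in> {1..n} - E - N \<Longrightarrow> y j = 0" and i: "i \<in> {1..p+c}" for y i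
  proof -
    have "chosen n K y {1..K} = {j \<in> N. y j \<noteq> 0} \<union> E"
      using y(2) by (subst chosen_eq[OF EN y]) (auto simp: slots_def)
    moreover have "{j \<in> N. y j \<noteq> 0} \<inter> E = {}" using EN by auto
    ultimately show ?thesis
      using fin e[OF i] by (simp add: sum.union_disjoint load_def)
  qed
  have pot: "potential p c K n f R e V y = H y"
    if y: "\<And>j. j \<in> E \<Longrightarrow> y j = Suc K" "\<And>j. j \<in> N \<Longrightarrow> y j \<le> K"
      "\<And>j. j \<in> {1..n} - E - N \<Longrightarrow> y j = 0" for y
  proof -
    have "(\<Sum>J\<in>Pow {1..K}. coef (1 + (1 - 1 / K) / K) K (card J) * min (f (chosen n K y J) / V) 1)
      = gain N \<rho> K g y"
      unfolding gain_def \<rho>_def \<theta>_def g_def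
    proof (rule sum.cong)
      fix J assume "J \<in> Pow {1..K}"
      then have "chosen n K y J = slots N y J \<union> E" by (intro chosen_eq[OF EN y]) auto
      then show "coef (1 + (1 - 1 / K) / K) K (card J) * min (f (chosen n K y J) / V) 1
        = coef (1 + (1 - 1 / K) / K) K (card J) * min (f (slots N y J \<union> E) / V) 1" by simp
    qed simp
    moreover have "((\<Sum>j\<in>chosen n K y {1..K}. R i j) - e i) / (1 - e i) = load N (a i) y"
      if "i \<in> {1..p}" for i
      using sumRN[of y i, OF y] that by (simp add: load_def a_def sum_divide_distrib)
    ultimately show ?thesis
      unfolding potential_def H_def PP_def PC_def \<theta>_def
      using sumRN[of y, OF y] by (simp add: sum_distrib_left sum_negf algebra_simps)
  qed
  have "H (z(j := k)) \<le> H z + \<eta>" if "j \<in> N" "k \<le> K" for j k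
  proof -
    have "potential p c K n f R e V (z(j := k)) = H (z(j := k))"
      using that zE zN z0 EN by (intro pot) auto
    then show ?thesis using opt[OF that] pot[OF zE zN z0] by simp
  qed
  then have "toward N Q \<theta> K H z \<le> card N * \<eta>" by (intro toward_le \<theta> K0)
  also have "\<dots> \<le> n * \<eta>"
    using card_mono[of "{1..n}" N] EN \<eta> by (intro mult_right_mono) auto
  finally have up: "toward N Q \<theta> K H z \<le> n * \<eta>" .
  have sg: "submodular_on N g" and mg: "mono_on (Pow N) g" 
    unfolding g_def
    using submodular_on_contract[OF submodular_on_truncate[OF f(1,2) V, of 1] EN(1)]
      mono_on_contract[OF mono_on_truncate[OF f(2) V, of 1] EN(1)] by auto
  have g0: "0 \<le> g A" "g A \<le> 1" if "A \<subseteq> N" for A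
    using f(3)[of "A \<union> E"] that EN V by (auto simp: g_def)
  have T1: "toward N Q \<theta> K (gain N \<rho> K g) z \<ge> (\<rho> ^ K - 1) * g Q - \<rho> ^ K * g (slots N z {1..K})"
    using toward_gain[OF sg mg g0(1) fin(1) Q \<theta>(1) K0 \<rho>_def] by simp
  have a0: "0 \<le> a i j" "a i j \<le> d" if "i \<in> {1..p}" "j \<in> N" for i j
  proof -
    have "0 \<le> R i j" using R[of i j] that EN by auto
    then show "0 \<le> a i j" using eP[OF that(1)] by (simp add: a_def)
    show "a i j \<le> d"
      using smallP[OF that] eP[OF that(1)] d by (cases "e i = 1") (auto simp: a_def divide_le_eq)
  qed
  have T2: "toward N Q \<theta> K (PP i) z \<le> 3 * d - PP i z" if i: "i \<in> {1..p}" for i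
  proof -
    have "(\<Sum>j\<in>Q. a i j) \<le> 1"
      unfolding a_def sum_divide_distrib[symmetric]
      using QP[OF i] eP[OF i] by (cases "e i = 1") (auto simp: divide_le_eq)
    then show ?thesis
      unfolding PP_def using a0[OF i] d by (intro toward_packing_penalty[OF fin(1) Q \<theta> K0]) auto
  qed
  have T3: "toward N Q \<theta> K (PC i) z \<le> 5 * d - PC i z" if i: "i \<in> {p+1..p+c}" for i
    unfolding PC_def
  \<comment> \<open>The target covers only \<open>1 - 1 / K\<close>; scaling by
    \<open>\<theta>\<close> leaves the square of \<open>1 - 1 / K\<close>, which exceeds the
    threshold \<open>1 - 2 / K\<close> of the penalty.\<close>
  proof (rule toward_covering_penalty[OF fin(1) Q \<theta> K0, where r = "1 - 1 / K"])
    show "0 \<le> R i j" if "j \<in> N" for j using R[of i j] that EN i by auto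
    show "(\<forall>j\<in>N. R i j \<le> d) \<or> 1 \<le> e i" using smallC[OF i] by blast
    show "0 \<le> e i" using e[of i] R[of i] EN i by (auto intro!: sum_nonneg)
    show "1 - 1 / K \<le> e i + (\<Sum>j\<in>Q. R i j)" using QC[OF i] .
    show "1 - 2 / real K \<le> \<theta> * (1 - 1 / real K)" by (simp add: \<theta>_def algebra_simps)
  qed (use K d in auto)
  define PS where "PS = (\<Sum>i=1..p. PP i z) + (\<Sum>i=p+1..p+c. PC i z)"
  have "toward N Q \<theta> K H z = toward N Q \<theta> K (gain N \<rho> K g) z + (- 4 * K\<^sup>2) *
     ((\<Sum>i=1..p. toward N Q \<theta> K (PP i) z) + (\<Sum>i=p+1..p+c. toward N Q \<theta> K (PC i) z))"
    unfolding H_def by (simp only: toward_linear toward_linear[where c = 1, simplified mult_1] toward_sum)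
  moreover have "(\<Sum>i=1..p. toward N Q \<theta> K (PP i) z) + (\<Sum>i=p+1..p+c. toward N Q \<theta> K (PC i) z)
      \<le> d * (3 * p + 5 * c) - PS"
  proof -
    have "(\<Sum>i=1..p. toward N Q \<theta> K (PP i) z) \<le> (\<Sum>i=1..p. 3 * d - PP i z)"
      using T2 by (intro sum_mono) auto
    moreover have "(\<Sum>i=p+1..p+c. toward N Q \<theta> K (PC i) z) \<le> (\<Sum>i=p+1..p+c. 5 * d - PC i z)"
      using T3 by (intro sum_mono) auto
    ultimately show ?thesis by (simp add: PS_def sum_subtractf algebra_simps)
  qed
  then have "4 * K\<^sup>2 * ((\<Sum>i=1..p. toward N Q \<theta> K (PP i) z) + (\<Sum>i=p+1..p+c. toward N Q \<theta> K (PC i) z))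
      \<le> 4 * K\<^sup>2 * (d * (3 * p + 5 * c) - PS)"
    by (intro mult_left_mono) auto
  ultimately have main: "(\<rho> ^ K - 1) * g Q - \<rho> ^ K * g (slots N z {1..K}) + 4 * K\<^sup>2 * PS \<le> 1 / K"
    using T1 up err by (simp add: algebra_simps)
  have gS: "g (slots N z {1..K}) = min (f S / V) 1"
    unfolding S_def g_def by (subst chosen_eq[OF EN zE zN z0]) auto
  have slN: "slots N z {1..K} \<subseteq> N" by (auto simp: slots_def)
  have PP0: "0 \<le> PP i z" and PC0: "0 \<le> PC i z" for i by (auto simp: PP_def PC_def)
  have "0 \<le> (\<rho> ^ K - 1) * g Q" using rb g0[OF Q] by simp
  moreover have "\<rho> ^ K * g (slots N z {1..K}) \<le> 3 * 1"
    using rb g0[OF slN] by (intro mult_mono) auto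
  moreover have "1 / real K \<le> 1" using K by simp
  \<comment> \<open>The value term contributes at most 3 and the error at most 1. The factor 4 in
    the penalty weight matches this sum, so that a single violation is at most
    \<open>1 / K\<close>.\<close>
  ultimately have "4 * K\<^sup>2 * PS \<le> 4" using main by linarith
  then have PS: "PS \<le> 1 / K\<^sup>2" using K by (simp add: field_simps)
  have sq: "w \<le> 1 / K" if "(max 0 w)\<^sup>2 \<le> 1 / K\<^sup>2" for w :: real
  proof -
    have "(max 0 w)\<^sup>2 \<le> (1 / K)\<^sup>2" using that by (simp add: power_divide)
    then have "max 0 w \<le> 1 / K" by (rule power2_le_imp_le) auto
    then show ?thesis by simp
  qed
  show "(\<Sum>j\<in>S. R i j) \<le> 1" if i: "i \<in> {1..p}" for i
  proof -
    have "PP i z \<le> (\<Sum>i=1..p. PP i z)" using i PP0 by (intro member_le_sum) auto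
    also have "\<dots> \<le> PS" using PC0 by (simp add: PS_def sum_nonneg)
    \<comment> \<open>The penalty starts at \<open>\<theta> = 1 - 1 / K\<close>, so a violation of
      \<open>1 / K\<close> still means that the packing constraint holds exactly.\<close>
    finally have "load N (a i) z - \<theta> \<le> 1 / K" using PS unfolding PP_def by (intro sq) auto
    then have l1: "load N (R i) z / (1 - e i) \<le> 1"
      by (simp add: \<theta>_def load_def a_def sum_divide_distrib)
    have "load N (R i) z \<le> 1 - e i"
    \<comment> \<open>With no capacity left the rescaled load says nothing; then
      \<open>smallP\<close> forces the entries of all movable elements to be at most 0.\<close>
    proof (cases "e i = 1")
      case True
      then show ?thesis unfolding load_def using smallP[OF i] by (auto intro!: sum_nonpos)
    next
      case False
      then show ?thesis using l1 eP[OF i] by (simp add: divide_le_eq)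
    qed
    then show ?thesis using sumRN[of z i, OF zE zN z0] i by (simp add: S_def)
  qed
  show "1 - 3 / K \<le> (\<Sum>j\<in>S. R i j)" if i: "i \<in> {p+1..p+c}" for i
  proof -
    have "PC i z \<le> (\<Sum>i=p+1..p+c. PC i z)" using i PC0 by (intro member_le_sum) auto
    also have "\<dots> \<le> PS" using PP0 by (simp add: PS_def sum_nonneg)
    finally have "(1 - 2 / K) - (e i + load N (R i) z) \<le> 1 / K"
      using PS unfolding PC_def by (intro sq) auto
    then show ?thesis using sumRN[of z i, OF zE zN z0] i by (simp add: S_def)
  qed
  have "0 \<le> PS" using PP0 PC0 by (simp add: PS_def sum_nonneg)
  then have "0 \<le> 4 * K\<^sup>2 * PS" by simp
  then have "(\<rho> ^ K - 1) * g Q - 1 / K \<le> \<rho> ^ K * g (slots N z {1..K})" using main by linarith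
  then have "((\<rho> ^ K - 1) * g Q - 1 / K) / \<rho> ^ K \<le> g (slots N z {1..K})"
    using rb by (simp add: divide_le_eq mult.commute)
  moreover have "((\<rho> ^ K - 1) * g Q - 1 / K) / \<rho> ^ K = (1 - 1 / \<rho> ^ K) * g Q - 1 / K / \<rho> ^ K"
  proof -
    have "\<rho> ^ K \<noteq> 0" using rb(1) by linarith
    then show ?thesis by (simp add: diff_divide_distrib left_diff_distrib)
  qed
  moreover have "(1 - 1 / exp 1 - 2 / K) * g Q \<le> (1 - 1 / \<rho> ^ K) * g Q"
    using rb g0[OF Q] by (intro mult_right_mono) auto
  moreover have "1 / K / \<rho> ^ K \<le> 1 / K / 1" using rb(1) by (intro divide_left_mono) auto
  ultimately show "min (f S / V) 1 \<ge> (1 - 1 / exp 1 - 2 / K) * min (f (Q \<union> E) / V) 1 - 1 / K"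
    unfolding gS[symmetric] by (simp add: g_def)
qed

section \<open>Guessing\<close>

text \<open>Packing rows are rescaled so that the capacity left by the guess becomes 1, hence small
  means small relative to \<open>1 - e i\<close>. Covering rows are not rescaled; once the guess
  covers a row, its entries need not be small.\<close>

definition eligible :: "nat \<Rightarrow> nat \<Rightarrow> nat \<Rightarrow> (nat \<Rightarrow> nat \<Rightarrow> real) \<Rightarrow> (nat \<Rightarrow> real) \<Rightarrow> real \<Rightarrow> nat \<Rightarrow> bool" where
  "eligible p c n R e d j \<longleftrightarrow> (\<forall>i\<in>{1..p}. R i j \<le> d * (1 - e i)) \<and> (\<forall>i\<in>{p+1..p+c}. R i j \<le> d \<or> 1 \<le> e i)"

text \<open>\<open>E\<close> unites greedy prefixes of \<open>T\<close> for \<open>f\<close> and for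
  each covering row, so every other element of \<open>T\<close> contributes at most an
  \<open>m\<close>-th of what \<open>E\<close> has. The set \<open>B\<close> of elements that are
  large for a packing row is dropped rather than guessed: guessing it would shrink the remaining
  capacities and could make further elements large. As \<open>B\<close> has at most
  \<open>p * D\<close> elements, dropping it costs at most a fraction \<open>1 / K\<close>
  everywhere.\<close>

lemma good_guess:
  fixes n p c K D m :: nat and T :: "nat set" and f :: "nat set \<Rightarrow> real" and R :: "nat \<Rightarrow> nat \<Rightarrow> real"
  assumes f: "submodular_on {1..n} f" "mono_on (Pow {1..n}) f" "\<And>S. S \<subseteq> {1..n} \<Longrightarrow> 0 \<le> f S"
    and R: "\<And>i j. i \<in> {1..p+c} \<Longrightarrow> j \<in> {1..n} \<Longrightarrow> 0 \<le> R i j"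
    and T: "T \<subseteq> {1..n}" "\<And>i. i \<in> {1..p} \<Longrightarrow> (\<Sum>j\<in>T. R i j) \<le> 1"
      "\<And>i. i \<in> {p+1..p+c} \<Longrightarrow> 1 \<le> (\<Sum>j\<in>T. R i j)"
    and K: "0 < K" and D: "0 < D" and m: "p * D * K \<le> m" "D \<le> m"
  shows "\<exists>E Q. E \<subseteq> T \<and> card E \<le> (c + 1) * m \<and> f T \<le> (n + 1) * f E \<and>
    Q \<subseteq> {j \<in> {1..n} - E. eligible p c n R (\<lambda>i. \<Sum>j\<in>E. R i j) (1 / D) j} \<and>
    (\<forall>i\<in>{1..p}. (\<Sum>j\<in>E. R i j) \<le> 1 \<and> (\<Sum>j\<in>Q. R i j) \<le> 1 - (\<Sum>j\<in>E. R i j)) \<and>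
    (\<forall>i\<in>{p+1..p+c}. 1 - 1 / K \<le> (\<Sum>j\<in>E. R i j) + (\<Sum>j\<in>Q. R i j)) \<and>
    (1 - 1 / K) * f T \<le> f (Q \<union> E)"
proof -
  have finT: "finite T" using T(1) finite_subset by auto
  have m0: "0 < m" using m D by simp
  obtain T0 where T0: "T0 \<subseteq> T" "card T0 \<le> m"
    "\<And>j. j \<in> T - T0 \<Longrightarrow> real m * (f (insert j T0) - f T0) \<le> f T0"
    using greedy_prefix[OF f(1,2) finT T(1) f(3), of m] by blast
  have "\<exists>U\<subseteq>T. card U \<le> m \<and> (\<forall>j\<in>T - U. m * R i j \<le> (\<Sum>j\<in>U. R i j))" if i: "i \<in> {p+1..p+c}" for i
  proof -
    have Ri: "0 \<le> R i j" if "j \<in> {1..n}" for j using R[of i j] i that by auto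
    have "mono_on (Pow {1..n}) (\<lambda>S. \<Sum>j\<in>S. R i j)"
      using Ri by (intro mono_onI sum_mono2) (auto intro: finite_subset[OF _ finite_atLeastAtMost])
    moreover have "0 \<le> (\<Sum>j\<in>S. R i j)" if "S \<subseteq> {1..n}" for S
      using Ri that by (intro sum_nonneg) auto
    ultimately obtain U where U: "U \<subseteq> T" "card U \<le> m"
      "\<And>j. j \<in> T - U \<Longrightarrow> real m * ((\<Sum>j\<in>insert j U. R i j) - (\<Sum>j\<in>U. R i j)) \<le> (\<Sum>j\<in>U. R i j)"
      using greedy_prefix[OF submodular_on_sum _ finT T(1), of "\<lambda>j. R i j" m] by auto
    have "finite U" using U(1) finT finite_subset by auto
    then have "m * R i j \<le> (\<Sum>j\<in>U. R i j)" if "j \<in> T - U" for j using U(3)[OF that] that by simp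
    then show ?thesis using U by blast
  qed
  then obtain U where U: "\<And>i. i \<in> {p+1..p+c} \<Longrightarrow> U i \<subseteq> T" "\<And>i. i \<in> {p+1..p+c} \<Longrightarrow> card (U i) \<le> m"
    "\<And>i j. i \<in> {p+1..p+c} \<Longrightarrow> j \<in> T - U i \<Longrightarrow> m * R i j \<le> (\<Sum>j\<in>U i. R i j)"
    by metis
  define E where "E = T0 \<union> (\<Union>i\<in>{p+1..p+c}. U i)"
  define e where "e i = (\<Sum>j\<in>E. R i j)" for i
  have ET: "E \<subseteq> T" unfolding E_def using T0(1) U(1) by (intro Un_least UN_least)
  have En: "E \<subseteq> {1..n}" using ET T(1) by auto
  have finE: "finite E" using ET finT finite_subset by auto
  have cardE: "card E \<le> (c + 1) * m"
  proof -
    have "card E \<le> card T0 + card (\<Union>i\<in>{p+1..p+c}. U i)" unfolding E_def by (rule card_Un_le)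
    also have "card (\<Union>i\<in>{p+1..p+c}. U i) \<le> (\<Sum>i\<in>{p+1..p+c}. card (U i))" by (intro card_UN_le) auto
    also have "\<dots> \<le> (\<Sum>i\<in>{p+1..p+c}. m)" using U(2) by (intro sum_mono) auto
    finally show ?thesis using T0(2) by simp
  qed
  have R0: "0 \<le> R i j" if "i \<in> {1..p+c}" "j \<in> T" for i j using R[of i j] that T(1) by auto
  have e_sum: "(\<Sum>j\<in>T. R i j) = e i + (\<Sum>j\<in>T - E. R i j)" for i
    unfolding e_def using finT ET by (simp add: sum.subset_diff)
  have fsmall: "m * (f (insert j E) - f E) \<le> f E" if j: "j \<in> T - E" for j
  proof -
    have "f (insert j E) - f E \<le> f (insert j T0) - f T0"
      using j En T(1) by (intro submodular_marginal_antimono[OF f(1,2)]) (auto simp: E_def)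
    then have "m * (f (insert j E) - f E) \<le> m * (f (insert j T0) - f T0)" by (intro mult_left_mono) auto
    also have "\<dots> \<le> f T0" using T0(3) j by (auto simp: E_def)
    also have "\<dots> \<le> f E" using En by (intro mono_onD[OF f(2)]) (auto simp: E_def)
    finally show ?thesis .
  qed
  have Rsmall: "m * R i j \<le> e i" if i: "i \<in> {p+1..p+c}" and j: "j \<in> T - E" for i j
  proof -
    have "m * R i j \<le> (\<Sum>j\<in>U i. R i j)" using U(3)[OF i, of j] i j by (auto simp: E_def)
    also have "\<dots> \<le> e i"
      unfolding e_def using i R0[of i] ET finE by (intro sum_mono2) (auto simp: E_def)
    finally show ?thesis .
  qed
  have fE: "0 \<le> f E" "f E \<le> f T" using f(3)[OF En] ET T(1) by (auto intro!: mono_onD[OF f(2)])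
  have fT: "f T \<le> (n + 1) * f E"
  proof -
    have "f (E \<union> (T - E)) - f E \<le> (\<Sum>j\<in>T - E. f (insert j E) - f E)"
      using En T(1) finT by (intro submodular_sum_additions[OF f(1,2)]) auto
    also have "\<dots> \<le> (\<Sum>j\<in>T - E. f E)"
    proof (rule sum_mono)
      fix j assume j: "j \<in> T - E"
      then have "0 \<le> f (insert j E) - f E"
        using En T(1) by (auto intro!: mono_onD[OF f(2)])
      then have "1 * (f (insert j E) - f E) \<le> m * (f (insert j E) - f E)"
        using m0 by (intro mult_right_mono) auto
      then show "f (insert j E) - f E \<le> f E" using fsmall[OF j] by simp
    qed
    also have "\<dots> \<le> n * f E"
    proof -
      have "T - E \<subseteq> {1..n}" using T(1) by auto
      then have "card (T - E) \<le> n" using card_mono[of "{1..n}" "T - E"] by simp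
      then show ?thesis using fE by (simp add: mult_right_mono)
    qed
    also have "E \<union> (T - E) = T" using ET by auto
    finally show ?thesis by (simp add: algebra_simps)
  qed
  define B where "B = {j \<in> T - E. \<exists>i\<in>{1..p}. 1 / D * (1 - e i) < R i j}"
  have eP: "e i \<le> 1" "(\<Sum>j\<in>T - E. R i j) \<le> 1 - e i" if i: "i \<in> {1..p}" for i
  proof -
    show "(\<Sum>j\<in>T - E. R i j) \<le> 1 - e i" using T(2)[OF i] e_sum[of i] by simp
    moreover have "0 \<le> (\<Sum>j\<in>T - E. R i j)" using i R0[of i] by (intro sum_nonneg) auto
    ultimately show "e i \<le> 1" by simp
  qed
  have cardB: "card B * K \<le> m"
  proof -
    \<comment> \<open>More than \<open>D\<close> elements above a \<open>D\<close>-th of the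
      remaining capacity would not fit into \<open>T\<close>. If no capacity remains, a single such
      element is already too much.\<close>
    have B1: "card {j \<in> T - E. 1 / D * (1 - e i) < R i j} \<le> D" (is "card ?Bi \<le> D") if i: "i \<in> {1..p}" for i
    proof -
      have fBi: "finite ?Bi" using finT by simp
      have "(\<Sum>j\<in>?Bi. R i j) \<le> (\<Sum>j\<in>T - E. R i j)"
        using finT i R0[of i] by (intro sum_mono2) auto
      then have le: "(\<Sum>j\<in>?Bi. R i j) \<le> 1 - e i" using eP[OF i] by simp
      show ?thesis
      proof (cases "e i = 1")
        case True
        have Bi0: "?Bi = {}"
        proof (rule ccontr)
          assume "?Bi \<noteq> {}"
          then have "0 < (\<Sum>j\<in>?Bi. R i j)" using fBi True by (intro sum_pos) auto
          then show False using le True by simp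
        qed
        show ?thesis unfolding Bi0 by simp
      next
        case False
        then have pos: "0 < 1 - e i" using eP[OF i] by simp
        have "card ?Bi * (1 / D * (1 - e i)) = (\<Sum>j\<in>?Bi. 1 / D * (1 - e i))" by simp
        also have "\<dots> \<le> (\<Sum>j\<in>?Bi. R i j)" by (intro sum_mono) auto
        finally have "card ?Bi / D * (1 - e i) \<le> 1 * (1 - e i)" using le by simp
        then have "card ?Bi / D \<le> 1" using pos by (rule mult_right_le_imp_le)
        then show ?thesis using D by (simp add: divide_le_eq)
      qed
    qed
    have "B = (\<Union>i\<in>{1..p}. {j \<in> T - E. 1 / D * (1 - e i) < R i j})" by (auto simp: B_def)
    then have "card B \<le> (\<Sum>i\<in>{1..p}. card {j \<in> T - E. 1 / D * (1 - e i) < R i j})"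
      by (simp only:) (intro card_UN_le, auto)
    also have "\<dots> \<le> (\<Sum>i\<in>{1..p}. D)" using B1 by (intro sum_mono) auto
    finally have "card B * K \<le> p * D * K" by simp
    then show ?thesis using m by linarith
  qed
  have BT: "B \<subseteq> T - E" and finB: "finite B" using finT by (auto simp: B_def)
  \<comment> \<open>Stated for an arbitrary \<open>h\<close>, since it is applied to the marginals
    of \<open>f\<close> and to the covering rows.\<close>
  have Bsum: "(\<Sum>j\<in>B. h j) \<le> x / K" if h: "\<And>j. j \<in> B \<Longrightarrow> m * h j \<le> x" and x: "0 \<le> x" for h :: "nat \<Rightarrow> real" and x
  proof -
    have "(\<Sum>j\<in>B. h j) \<le> (\<Sum>j\<in>B. x / m)"
      using h m0 by (intro sum_mono) (simp add: pos_le_divide_eq mult.commute)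
    also have "\<dots> = card B * x / m" by simp
    also have "\<dots> \<le> x / K"
    proof -
      have "real (card B * K) * x \<le> real m * x" using cardB x by (intro mult_right_mono of_nat_mono)
      then show ?thesis using m0 K by (simp add: field_simps)
    qed
    finally show ?thesis .
  qed
  define Q where "Q = T - E - B"
  have QT: "Q \<subseteq> T - E" by (auto simp: Q_def)
  have "eligible p c n R e (1 / D) j" if j: "j \<in> Q" for j
    unfolding eligible_def
  proof (intro conjI ballI)
    show "R i j \<le> 1 / D * (1 - e i)" if "i \<in> {1..p}" for i
      using j that by (auto simp: Q_def B_def not_less)
    show "R i j \<le> 1 / D \<or> 1 \<le> e i" if i: "i \<in> {p+1..p+c}" for i
    proof (rule disjCI)
      assume "\<not> 1 \<le> e i"
      \<comment> \<open>Outside \<open>E\<close> an entry is at most an \<open>m\<close>-th of the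
        guessed load, and that load is below 1 as the row is not covered yet.\<close>
      then have "m * R i j \<le> 1" using Rsmall[OF i] j QT by force
      moreover have "D * R i j \<le> m * R i j"
        using m R0[of i j] i j QT by (intro mult_right_mono) auto
      ultimately have "D * R i j \<le> 1" by linarith
      then show "R i j \<le> 1 / D" using D by (simp add: field_simps)
    qed
  qed
  then have QN: "Q \<subseteq> {j \<in> {1..n} - E. eligible p c n R e (1 / D) j}" using QT T(1) by auto
  have QP: "(\<Sum>j\<in>Q. R i j) \<le> 1 - e i" if i: "i \<in> {1..p}" for i
  proof -
    have "(\<Sum>j\<in>Q. R i j) \<le> (\<Sum>j\<in>T - E. R i j)"
      using i finT QT R0[of i] by (intro sum_mono2) auto
    then show ?thesis using eP[OF i] by simp
  qed
  have K1: "0 \<le> 1 - 1 / real K" using K by simp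
  have QC: "1 - 1 / K \<le> e i + (\<Sum>j\<in>Q. R i j)" if i: "i \<in> {p+1..p+c}" for i
  proof -
    have e_le: "e i \<le> (\<Sum>j\<in>T. R i j)"
      unfolding e_def using i finT ET R0[of i] by (intro sum_mono2) auto
    \<comment> \<open>The loss is measured against the load of the whole of \<open>T\<close>, which
      may exceed 1; what remains is \<open>1 - 1 / K\<close> times a load of at least 1.\<close>
    have "(\<Sum>j\<in>B. R i j) \<le> (\<Sum>j\<in>T. R i j) / K"
    proof (rule Bsum)
      show "m * R i j \<le> (\<Sum>j\<in>T. R i j)" if "j \<in> B" for j
        using Rsmall[OF i, of j] that BT e_le by force
      show "0 \<le> (\<Sum>j\<in>T. R i j)" using T(3)[OF i] by simp
    qed
    moreover have "(\<Sum>j\<in>T - E. R i j) = (\<Sum>j\<in>Q. R i j) + (\<Sum>j\<in>B. R i j)"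
      unfolding Q_def using finT BT by (intro sum.subset_diff) auto
    moreover have "1 - 1 / K \<le> (\<Sum>j\<in>T. R i j) - (\<Sum>j\<in>T. R i j) / K"
      using mult_left_mono[OF T(3)[OF i] K1] by (simp add: left_diff_distrib)
    ultimately show ?thesis using e_sum[of i] by linarith
  qed
  have fQ: "(1 - 1 / K) * f T \<le> f (Q \<union> E)"
  proof -
    have QE: "Q \<union> E = T - B" using ET BT by (auto simp: Q_def)
    have TB: "T - B \<union> B = T" using BT by auto
    have "f T - f (T - B) \<le> (\<Sum>j\<in>B. f (insert j (T - B)) - f (T - B))"
      using submodular_sum_additions[OF f(1,2) _ _ finB, of "T - B"] T(1) BT unfolding TB by auto
    also have "\<dots> \<le> f T / K"
    proof (rule Bsum)
      fix j assume j: "j \<in> B"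
      have "f (insert j (T - B)) - f (T - B) \<le> f (insert j E) - f E"
        using j T(1) ET BT by (intro submodular_marginal_antimono[OF f(1,2)]) auto
      then have "m * (f (insert j (T - B)) - f (T - B)) \<le> m * (f (insert j E) - f E)"
        by (intro mult_left_mono) auto
      also have "\<dots> \<le> f E" using fsmall j BT by auto
      finally show "m * (f (insert j (T - B)) - f (T - B)) \<le> f T" using fE by simp
    qed (use fE in simp)
    finally show ?thesis unfolding QE by (simp add: algebra_simps)
  qed
  show ?thesis
    by (rule exI[of _ E], rule exI[of _ Q])
      (use ET cardE fT QN QP QC fQ eP in \<open>simp add: e_def[symmetric]\<close>)
qed

text \<open>Rounding \<open>F\<close> down to a multiple of \<open>x / K\<close> loses at most
  \<open>x / K\<close>, which is at most \<open>F / K\<close>. Since \<open>F\<close> is at most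
  \<open>n + 1\<close> times \<open>x\<close>, the multiplier stays below
  \<open>(n + 1) * K\<close>; the bound \<open>2 * K * n\<close> is chosen because a sum of
  \<open>2 * K\<close> counters in 0..n can represent it.\<close>

lemma guess_value:
  fixes n K :: nat and F x :: real
  assumes "0 \<le> x" "x \<le> F" "F \<le> (n + 1) * x" "1 \<le> n" "0 < K"
  shows "\<exists>k \<le> 2 * K * n. x * k / K \<le> F \<and> (1 - 1 / K) * F \<le> x * k / K"
proof (cases "x = 0")
  case True
  then show ?thesis using assms by (intro exI[of _ 0]) auto
next
  case False
  then have x: "0 < x" using assms by simp
  define k where "k = nat \<lfloor>F * K / x\<rfloor>"
  have F0: "0 \<le> F * K / x" using assms by simp
  then have k: "real k \<le> F * K / x" "F * K / x \<le> real k + 1" unfolding k_def by linarith+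
  have "F * K / x \<le> (n + 1) * K"
    using mult_right_mono[OF assms(3), of K] x by (simp add: divide_le_eq algebra_simps)
  then have "real k \<le> real ((n + 1) * K)" using k by simp
  then have "k \<le> (n + 1) * K" by (simp only: of_nat_le_iff)
  also have "\<dots> \<le> 2 * K * n" using assms(4) by (simp add: algebra_simps)
  finally have "k \<le> 2 * K * n" .
  moreover have "x * k \<le> F * K" "F * K \<le> x * k + x"
    using k x by (simp_all add: field_simps)
  moreover from this have "x * k / K \<le> F" using assms by (simp add: divide_le_eq)
  moreover have "(1 - 1 / K) * F \<le> x * k / K"
  proof -
    have "(F * K - F) / K \<le> x * k / K"
      using \<open>F * K \<le> x * k + x\<close> assms by (intro divide_right_mono) auto
    then show ?thesis using assms by (simp add: diff_divide_distrib algebra_simps)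
  qed
  ultimately show ?thesis by blast
qed

section \<open>A structured deterministic sublanguage\<close>

text \<open>Registers 1 and 2 are reserved: they hold \<open>n + 1\<close> and \<open>1\<close>, so that \<open>For x\<close> can let register
  \<open>x\<close> run through \<open>0, \<dots>, n\<close>.\<close>

datatype sprog =
    Nop
  | Do instr
  | Seq sprog sprog
  | If test sprog sprog
  | For nat sprog

primrec compile :: "sprog \<Rightarrow> com" where
  "compile Nop = SKIP"
| "compile (Do i) = DO i"
| "compile (Seq a b) = SEQ (compile a) (compile b)"
| "compile (If t a b) = IF t (compile a) (compile b)"
| "compile (For x b) =
     SEQ (DO (IConst x 0)) (WHILE (ILess x 1) (SEQ (compile b) (DO (IAdd x x 2))))"

primrec ins :: "nat \<Rightarrow> (nat set \<Rightarrow> real) \<Rightarrow> instr \<Rightarrow> store \<Rightarrow> store" where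
  "ins n f (IConst x k) s = set_ireg x k s"
| "ins n f (IAdd x y z) s = set_ireg x (ireg s y + ireg s z) s"
| "ins n f (ISub x y z) s = set_ireg x (ireg s y - ireg s z) s"
| "ins n f (ILoad x a y) s = set_ireg x (iarr s a (ireg s y)) s"
| "ins n f (IStore a x y) s = s\<lparr>iarr := (iarr s)(a := (iarr s a)(ireg s x := ireg s y))\<rparr>"
| "ins n f (RNat r x) s = set_rreg r (real (ireg s x)) s"
| "ins n f (RAdd r u v) s = set_rreg r (rreg s u + rreg s v) s"
| "ins n f (RSub r u v) s = set_rreg r (rreg s u - rreg s v) s"
| "ins n f (RMul r u v) s = set_rreg r (rreg s u * rreg s v) s"
| "ins n f (RDiv r u v) s = set_rreg r (rreg s u / rreg s v) s"
| "ins n f (RLoad r a x) s = set_rreg r (rarr s a (ireg s x)) s"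
| "ins n f (RStore a x r) s = s\<lparr>rarr := (rarr s)(a := (rarr s a)(ireg s x := rreg s r))\<rparr>"
| "ins n f (Flip x) s = s"
| "ins n f (Query r a) s = set_rreg r (f (stored_set n a s)) s"

primrec sem :: "nat \<Rightarrow> (nat set \<Rightarrow> real) \<Rightarrow> sprog \<Rightarrow> store \<Rightarrow> store" where
  "sem n f Nop s = s"
| "sem n f (Do i) s = ins n f i s"
| "sem n f (Seq a b) s = sem n f b (sem n f a s)"
| "sem n f (If t a b) s = (if holds t s then sem n f a s else sem n f b s)"
| "sem n f (For x b) s = set_ireg x (Suc n) (fold (\<lambda>v s. sem n f b (set_ireg x v s)) [0..<Suc n] s)"

text \<open>An iteration of \<open>For\<close> pays four steps besides its body: the test, the
  increment and the disposal of two finished \<open>SKIP\<close>s. The 3 covers the initial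
  assignment, one \<open>SKIP\<close> and the failing test.\<close>

primrec cost :: "nat \<Rightarrow> sprog \<Rightarrow> nat" where
  "cost n Nop = 0"
| "cost n (Do i) = 1"
| "cost n (Seq a b) = cost n a + cost n b + 1"
| "cost n (If t a b) = max (cost n a) (cost n b) + 1"
| "cost n (For x b) = (n + 1) * (cost n b + 4) + 3"

text \<open>A whole array counts as one location. This is coarse, but it turns every frame argument
  into a membership question about a syntactic set.\<close>

datatype loc = I nat | IA nat | R nat | RA nat

primrec ins_writes :: "instr \<Rightarrow> loc" where
  "ins_writes (IConst x k) = I x"
| "ins_writes (IAdd x y z) = I x"
| "ins_writes (ISub x y z) = I x"
| "ins_writes (ILoad x a y) = I x"
| "ins_writes (IStore a x y) = IA a"
| "ins_writes (RNat r x) = R r"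
| "ins_writes (RAdd r u v) = R r"
| "ins_writes (RSub r u v) = R r"
| "ins_writes (RMul r u v) = R r"
| "ins_writes (RDiv r u v) = R r"
| "ins_writes (RLoad r a x) = R r"
| "ins_writes (RStore a x r) = RA a"
| "ins_writes (Flip x) = I x"
| "ins_writes (Query r a) = R r"

primrec writes :: "sprog \<Rightarrow> loc set" where
  "writes Nop = {}"
| "writes (Do i) = {ins_writes i}"
| "writes (Seq a b) = writes a \<union> writes b"
| "writes (If t a b) = writes a \<union> writes b"
| "writes (For x b) = insert (I x) (writes b)"

text \<open>Excludes coin flips, so that execution is a function on stores, protects the loop bound
  and the increment in registers 1 and 2, and forbids a loop body to write its own counter; thus
  each loop makes exactly \<open>n + 1\<close> rounds.\<close>

primrec wf_sprog :: "sprog \<Rightarrow> bool" where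
  "wf_sprog Nop \<longleftrightarrow> True"
| "wf_sprog (Do i) \<longleftrightarrow> (\<forall>x. i \<noteq> Flip x) \<and> ins_writes i \<noteq> I 1 \<and> ins_writes i \<noteq> I 2"
| "wf_sprog (Seq a b) \<longleftrightarrow> wf_sprog a \<and> wf_sprog b"
| "wf_sprog (If t a b) \<longleftrightarrow> wf_sprog a \<and> wf_sprog b"
| "wf_sprog (For x b) \<longleftrightarrow> wf_sprog b \<and> x \<noteq> 1 \<and> x \<noteq> 2 \<and> I x \<notin> writes b"

lemma ireg_set_ireg [simp]: "ireg (set_ireg x v s) y = (if y = x then v else ireg s y)"
  and iarr_set_ireg [simp]: "iarr (set_ireg x v s) = iarr s"
  and rreg_set_ireg [simp]: "rreg (set_ireg x v s) = rreg s"
  and rarr_set_ireg [simp]: "rarr (set_ireg x v s) = rarr s"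
  and ireg_set_rreg [simp]: "ireg (set_rreg r w s) = ireg s"
  and iarr_set_rreg [simp]: "iarr (set_rreg r w s) = iarr s"
  and rreg_set_rreg [simp]: "rreg (set_rreg r w s) u = (if u = r then w else rreg s u)"
  and rarr_set_rreg [simp]: "rarr (set_rreg r w s) = rarr s"
  by (simp_all add: set_ireg_def set_rreg_def)

lemma ins_frame:
  "I x \<noteq> ins_writes i \<Longrightarrow> ireg (ins n f i s) x = ireg s x"
  "IA a \<noteq> ins_writes i \<Longrightarrow> iarr (ins n f i s) a = iarr s a"
  "R r \<noteq> ins_writes i \<Longrightarrow> rreg (ins n f i s) r = rreg s r"
  "RA a \<noteq> ins_writes i \<Longrightarrow> rarr (ins n f i s) a = rarr s a"
  by (cases i; simp)+

lemma fold_invariant_upt: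
  assumes "P 0 s" "\<And>v s. v < m \<Longrightarrow> P v s \<Longrightarrow> P (Suc v) (F v s)"
  shows "P m (fold F [0..<m] s)"
proof -
  have "k \<le> m \<Longrightarrow> P k (fold F [0..<k] s)" for k
    by (induction k) (use assms in auto)
  then show ?thesis by simp
qed

text \<open>\<open>P\<close> is indexed by the number of completed rounds; the passage from
  \<open>P\<close> to \<open>Q\<close> absorbs the exit value of the counter.\<close>

lemma For_rule:
  assumes "P 0 s" "\<And>v s. v \<le> n \<Longrightarrow> P v s \<Longrightarrow> P (Suc v) (sem n f b (set_ireg x v s))"
    and "\<And>s. P (Suc n) s \<Longrightarrow> Q (set_ireg x (Suc n) s)"
  shows "Q (sem n f (For x b) s)"
  unfolding sem.simps
  by (rule assms(3), rule fold_invariant_upt[where P = P]) (use assms(1,2) in auto)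

lemma sem_frame:
  "I x \<notin> writes c \<Longrightarrow> ireg (sem n f c s) x = ireg s x"
  "IA a \<notin> writes c \<Longrightarrow> iarr (sem n f c s) a = iarr s a"
  "R r \<notin> writes c \<Longrightarrow> rreg (sem n f c s) r = rreg s r"
  "RA a \<notin> writes c \<Longrightarrow> rarr (sem n f c s) a = rarr s a"
proof (induction c arbitrary: s)
  case (For y b)
  {
    case 1
    show ?case by (rule For_rule[where P = "\<lambda>_ s'. ireg s' x = ireg s x"]) (use 1 For in auto)
  next
    case 2
    show ?case by (rule For_rule[where P = "\<lambda>_ s'. iarr s' a = iarr s a"]) (use 2 For in auto)
  next
    case 3
    show ?case by (rule For_rule[where P = "\<lambda>_ s'. rreg s' r = rreg s r"]) (use 3 For in auto)
  next
    case 4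
    show ?case by (rule For_rule[where P = "\<lambda>_ s'. rarr s' a = rarr s a"]) (use 4 For in auto)
  }
qed (auto simp: ins_frame)

section \<open>Deterministic executions and the running time of compiled programs\<close>

inductive steps :: "nat \<Rightarrow> (nat set \<Rightarrow> real) \<Rightarrow> nat \<Rightarrow> com \<Rightarrow> store \<Rightarrow> com \<Rightarrow> store \<Rightarrow> bool" for n f where
  steps_refl: "steps n f 0 c s c s"
| steps_step: "c \<noteq> SKIP \<Longrightarrow> step n f c s = return_pmf (c', s') \<Longrightarrow> steps n f t c' s' c'' s''
    \<Longrightarrow> steps n f (Suc t) c s c'' s''"

lemma steps_trans: "steps n f t c s c' s' \<Longrightarrow> steps n f u c' s' c'' s'' \<Longrightarrow> steps n f (t + u) c s c'' s''"
  by (induction rule: steps.induct) (auto intro: steps.intros)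

lemma steps_SEQ: "steps n f t c s c' s' \<Longrightarrow> steps n f t (SEQ c d) s (SEQ c' d) s'"
proof (induction rule: steps.induct)
  case (steps_step c s c' s' t c'' s'')
  then show ?case by (intro steps.steps_step[where c' = "SEQ c' d" and s' = s']) auto
qed (rule steps_refl)

text \<open>\<open>run\<close> appends its last step, whereas \<open>steps\<close> peels off the
  first one; associativity of \<open>bind_pmf\<close> reconciles them.\<close>

lemma run_Suc: "run n f (Suc t) c s = bind_pmf (step n f c s) (\<lambda>(c', s'). run n f t c' s')"
proof (induction t)
  case (Suc t)
  have "run n f (Suc (Suc t)) c s = bind_pmf (run n f (Suc t) c s) (\<lambda>(c', s'). step n f c' s')"
    by simp
  also have "\<dots> = bind_pmf (step n f c s) (\<lambda>(c', s'). run n f (Suc t) c' s')"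
    unfolding Suc.IH by (simp add: bind_assoc_pmf case_prod_beta')
  finally show ?case .
qed (simp add: bind_return_pmf bind_return_pmf')

lemma steps_run: "steps n f t c s c' s' \<Longrightarrow> run n f t c s = return_pmf (c', s')"
proof (induction rule: steps.induct)
  case (steps_step c s c' s' t c'' s'')
  then show ?case unfolding run_Suc by (simp add: bind_return_pmf)
qed simp

lemma steps_one: "c \<noteq> SKIP \<Longrightarrow> step n f c s = return_pmf (c', s') \<Longrightarrow> steps n f 1 c s c' s'"
  using steps_step[OF _ _ steps_refl] by simp

lemma steps_SEQ_SKIP: "steps n f 1 (SEQ SKIP c) s c s"
  by (rule steps_one) simp_all

lemma steps_seq:
  assumes "steps n f t c s SKIP s'" "steps n f u d s' SKIP s''"
  shows "steps n f (t + u + 1) (SEQ c d) s SKIP s''"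
  using steps_trans[OF steps_trans[OF steps_SEQ[OF assms(1)] steps_SEQ_SKIP] assms(2)] by simp

lemma exec_ins: "\<forall>x. i \<noteq> Flip x \<Longrightarrow> exec n f i s = return_pmf (ins n f i s)"
  by (cases i) auto

lemma steps_DO: "\<forall>x. i \<noteq> Flip x \<Longrightarrow> steps n f 1 (DO i) s SKIP (ins n f i s)"
  by (rule steps_one) (simp_all add: exec_ins)

lemma wf_writes: "wf_sprog c \<Longrightarrow> I (Suc 0) \<notin> writes c" "wf_sprog c \<Longrightarrow> I 2 \<notin> writes c"
  by (induction c) auto

lemma compile_correct:
  "wf_sprog c \<Longrightarrow> ireg s 1 = Suc n \<Longrightarrow> ireg s 2 = 1 \<Longrightarrow>
    \<exists>t\<le>cost n c. steps n f t (compile c) s SKIP (sem n f c s)"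
proof (induction c arbitrary: s)
  case Nop
  then show ?case using steps_refl by auto
next
  case (Do i)
  then show ?case using steps_DO[of i n f s] by auto
next
  case (Seq a b)
  obtain t where t: "t \<le> cost n a" "steps n f t (compile a) s SKIP (sem n f a s)"
    using Seq.IH(1)[of s] Seq.prems by auto
  obtain u where u: "u \<le> cost n b" "steps n f u (compile b) (sem n f a s) SKIP (sem n f b (sem n f a s))"
    using Seq.IH(2)[of "sem n f a s"] Seq.prems by (auto simp: sem_frame wf_writes)
  show ?case using t u steps_seq[OF t(2) u(2)] by (intro exI[of _ "t + u + 1"]) auto
next
  case (If b c1 c2)
  define d where "d = (if holds b s then c1 else c2)"
  obtain t where t: "t \<le> cost n d" "steps n f t (compile d) s SKIP (sem n f d s)"
    using If.IH(1)[of s] If.IH(2)[of s] If.prems unfolding d_def by (cases "holds b s") auto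
  have "steps n f (Suc t) (compile (If b c1 c2)) s SKIP (sem n f d s)"
    using t(2) by (intro steps_step[where c' = "compile d" and s' = s]) (auto simp: d_def)
  then show ?case using t(1) by (intro exI[of _ "Suc t"]) (auto simp: d_def split: if_splits)
next
  case (For x b)
  let ?F = "\<lambda>v s. sem n f b (set_ireg x v s)"
  let ?body = "SEQ (compile b) (DO (IAdd x x 2))"
  let ?W = "WHILE (ILess x 1) ?body"
  \<comment> \<open>The execution is observed whenever control returns to the loop head. There the
    store is that of the \<open>fold\<close>, with the counter already advanced to
    \<open>k\<close>.\<close>
  have iter: "ireg (fold ?F [0..<k] s) 1 = Suc n \<and> ireg (fold ?F [0..<k] s) 2 = 1 \<and>
    (\<exists>t\<le>k * (cost n b + 4). steps n f t ?W (set_ireg x 0 s) ?W (set_ireg x k (fold ?F [0..<k] s)))"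
    if "k \<le> Suc n" for k
    using that
  proof (induction k)
    case 0
    then show ?case using For.prems by (auto intro: steps_refl)
  next
    case (Suc k)
    define s1 where "s1 = set_ireg x k (fold ?F [0..<k] s)"
    have IH: "ireg s1 1 = Suc n" "ireg s1 2 = 1" using Suc For.prems by (auto simp: s1_def)
    obtain t where t: "t \<le> k * (cost n b + 4)" "steps n f t ?W (set_ireg x 0 s) ?W s1"
      using Suc by (auto simp: s1_def)
    obtain u where u: "u \<le> cost n b" "steps n f u (compile b) s1 SKIP (sem n f b s1)"
      using For.IH[of s1] For.prems IH by auto
    have s2: "ireg (sem n f b s1) x = k" "ireg (sem n f b s1) 1 = Suc n" "ireg (sem n f b s1) 2 = 1"
      using For.prems IH by (auto simp: sem_frame wf_writes s1_def)
    have a: "steps n f 1 ?W s1 (SEQ ?body ?W) s1"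
      using Suc.prems IH For.prems by (intro steps_one) (auto simp: s1_def)
    have "steps n f 1 (DO (IAdd x x 2)) (sem n f b s1) SKIP (set_ireg x (Suc k) (sem n f b s1))"
      using steps_DO[of "IAdd x x 2" n f "sem n f b s1"] s2 by simp
    from steps_seq[OF u(2) this]
    have "steps n f (u + 2) ?body s1 SKIP (set_ireg x (Suc k) (sem n f b s1))" by simp
    from steps_trans[OF t(2) steps_trans[OF a steps_trans[OF steps_SEQ[OF this] steps_SEQ_SKIP]]]
    have "steps n f (t + (1 + (u + 2 + 1))) ?W (set_ireg x 0 s) ?W (set_ireg x (Suc k) (sem n f b s1))" .
    moreover have "t + (1 + (u + 2 + 1)) \<le> Suc k * (cost n b + 4)" using t u by simp
    moreover have "fold ?F [0..<Suc k] s = sem n f b s1" by (simp add: s1_def)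
    ultimately show ?case using s2 by (intro conjI exI[of _ "t + (1 + (u + 2 + 1))"]) auto
  qed
  define s' where "s' = set_ireg x (Suc n) (fold ?F [0..<Suc n] s)"
  obtain t where t: "t \<le> Suc n * (cost n b + 4)" "steps n f t ?W (set_ireg x 0 s) ?W s'"
    using iter[of "Suc n"] unfolding s'_def by blast
  have "steps n f 1 ?W s' SKIP s'"
    using iter[of "Suc n"] For.prems by (intro steps_one) (auto simp: s'_def simp del: upt_Suc)
  from steps_trans[OF t(2) this] have "steps n f (t + 1) ?W (set_ireg x 0 s) SKIP s'" .
  moreover have "steps n f 1 (DO (IConst x 0)) s SKIP (set_ireg x 0 s)"
    using steps_DO[of "IConst x 0" n f s] by simp
  ultimately have "steps n f (1 + (t + 1) + 1) (compile (For x b)) s SKIP s'"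
    unfolding compile.simps by (intro steps_seq)
  moreover have "1 + (t + 1) + 1 \<le> cost n (For x b)" using t by simp
  ultimately show ?case unfolding s'_def sem.simps by blast
qed

primrec code_size :: "sprog \<Rightarrow> nat" where
  "code_size Nop = 1"
| "code_size (Do i) = 1"
| "code_size (Seq a b) = code_size a + code_size b + 1"
| "code_size (If t a b) = code_size a + code_size b + 1"
| "code_size (For x b) = code_size b + 7"

primrec depth :: "sprog \<Rightarrow> nat" where
  "depth Nop = 0"
| "depth (Do i) = 0"
| "depth (Seq a b) = max (depth a) (depth b)"
| "depth (If t a b) = max (depth a) (depth b)"
| "depth (For x b) = Suc (depth b)"

text \<open>Program size and nesting depth do not depend on \<open>n\<close>, so the input size
  enters only through the number of nested loops; this number becomes the exponent of the running
  time.\<close>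

lemma cost_le: "cost n c \<le> code_size c * (n + 1) ^ depth c"
proof (induction c)
  case (Seq a b)
  have "code_size a * (n + 1) ^ depth a \<le> code_size a * (n + 1) ^ max (depth a) (depth b)"
    "code_size b * (n + 1) ^ depth b \<le> code_size b * (n + 1) ^ max (depth a) (depth b)"
    by (intro mult_left_mono power_increasing; simp)+
  moreover have "1 \<le> (n + 1) ^ max (depth a) (depth b)" by simp
  ultimately show ?case using Seq by (simp only: cost.simps code_size.simps depth.simps add_mult_distrib)
next
  case (If t a b)
  have "code_size a * (n + 1) ^ depth a \<le> code_size a * (n + 1) ^ max (depth a) (depth b)"
    "code_size b * (n + 1) ^ depth b \<le> code_size b * (n + 1) ^ max (depth a) (depth b)"
    by (intro mult_left_mono power_increasing; simp)+
  moreover have "1 \<le> (n + 1) ^ max (depth a) (depth b)" by simp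
  ultimately show ?case using If by (simp only: cost.simps code_size.simps depth.simps add_mult_distrib)
next
  case (For x b)
  have 1: "1 \<le> (n + 1) ^ depth b" by simp
  then have 2: "n + 1 \<le> (n + 1) * (n + 1) ^ depth b" by (metis mult_le_mono2 mult.right_neutral)
  have "(n + 1) * cost n b \<le> (n + 1) * (code_size b * (n + 1) ^ depth b)" using For by (intro mult_left_mono) auto
  then show ?case using 2 by (simp add: algebra_simps)
qed auto

section \<open>Generated sequences and nests of loops\<close>

definition seqs :: "sprog list \<Rightarrow> sprog" where
  "seqs cs = foldr Seq cs Nop"

lemma seqs_simps [simp]: "seqs [] = Nop" "seqs (c # cs) = Seq c (seqs cs)"
  by (simp_all add: seqs_def)

lemma sem_seqs: "sem n f (seqs cs) s = fold (sem n f) cs s"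
  by (induction cs arbitrary: s) auto

lemma writes_seqs: "writes (seqs cs) = (\<Union>c\<in>set cs. writes c)"
  by (induction cs) auto

lemma wf_seqs: "wf_sprog (seqs cs) \<longleftrightarrow> (\<forall>c\<in>set cs. wf_sprog c)"
  by (induction cs) auto

text \<open>Loops whose length depends only on the parameters are unrolled when the program is
  generated; \<open>P\<close> is indexed by the part of the list already processed.\<close>

lemma fold_map_invariant:
  assumes "P [] s" "\<And>xs x ys s. zs = xs @ x # ys \<Longrightarrow> P xs s \<Longrightarrow> P (xs @ [x]) (sem n f (h x) s)"
  shows "P zs (sem n f (seqs (map h zs)) s)"
proof -
  have "P xs (fold (sem n f) (map h xs) s)" if "\<exists>ys. zs = xs @ ys" for xs
    using that
  proof (induction xs rule: rev_induct)
    case (snoc x xs)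
    then show ?case using assms(2)[of xs x] by auto
  qed (use assms(1) in simp)
  then show ?thesis by (auto simp: sem_seqs)
qed

primrec nest :: "nat list \<Rightarrow> sprog \<Rightarrow> sprog" where
  "nest [] b = b"
| "nest (x # xs) b = For x (nest xs b)"

lemma writes_nest: "writes (nest xs b) = I ` set xs \<union> writes b"
  by (induction xs) auto

lemma wf_nest: "wf_sprog b \<Longrightarrow> distinct xs \<Longrightarrow> (\<And>x. x \<in> set xs \<Longrightarrow> x \<noteq> 1 \<and> x \<noteq> 2 \<and> I x \<notin> writes b)
    \<Longrightarrow> wf_sprog (nest xs b)"
  by (induction xs) (auto simp: writes_nest)

section \<open>The program\<close>

text \<open>Index arrays: 0 is the output, 1 the assignment of elements to slots (\<open>0\<close>: unused,
  \<open>1, \<dots>, K\<close>: slots, \<open>K + 1\<close>: guessed), 2 the indicator of a set of slots, 3 the set that is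
  queried, 4 marks the elements that may be moved. Real registers: 8 is the guessed value, 10 the
  potential, 11 the result of a subprogram, 13 the current potential, 14 the best value found,
  and \<open>20 + i\<close> the contribution of the guessed set to row \<open>i\<close>.\<close>

definition base :: "nat \<Rightarrow> nat \<Rightarrow> nat \<Rightarrow> (nat \<Rightarrow> nat \<Rightarrow> real) \<Rightarrow> store \<Rightarrow> bool" where
  "base K D n M s \<longleftrightarrow> ireg s 0 = n \<and> ireg s 1 = Suc n \<and> ireg s 2 = 1 \<and> ireg s 3 = 0 \<and>
     rreg s 0 = 0 \<and> rreg s 1 = 1 \<and> rreg s 2 = 1 / D \<and> rreg s 3 = 1 - 1 / K \<and> rreg s 4 = 1 - 2 / K \<and>
     rreg s 5 = 1 - 3 / K \<and> rreg s 6 = 4 * (real K)\<^sup>2 \<and> rreg s 7 = 1 / (2 * K) / (n + 1) \<and> rarr s = M"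

lemma base_frame:
  assumes "base K D n M s" "writes c \<inter> (I ` {..3} \<union> R ` {..7} \<union> range RA) = {}"
  shows "base K D n M (sem n f c s)"
proof -
  have "ireg (sem n f c s) x = ireg s x" if "x \<le> 3" for x
    using assms(2) that by (intro sem_frame) auto
  moreover have "rreg (sem n f c s) x = rreg s x" if "x \<le> 7" for x
    using assms(2) that by (intro sem_frame) auto
  moreover have "rarr (sem n f c s) = rarr s"
    using assms(2) by (intro ext[of "rarr (sem n f c s)"] sem_frame) auto
  ultimately show ?thesis using assms(1) by (simp add: base_def)
qed

text \<open>Programs have no real constants, so a rational is computed as a quotient of two
  numerals.\<close>

definition lit :: "nat \<Rightarrow> nat \<Rightarrow> nat \<Rightarrow> sprog" where
  "lit r a b = seqs [Do (IConst 4 a), Do (RNat r 4), Do (IConst 4 b), Do (RNat 12 4), Do (RDiv r r 12)]"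

lemma lit_writes: "writes (lit r a b) = {I 4, R r, R 12}"
  by (auto simp: lit_def)

text \<open>Membership in \<open>J\<close> is decided when the program is generated and written into
  a table in array 2; a run-time lookup through the slot number then replaces all comparisons.
  Registers 2 and 3 hold 1 and 0. The slot number \<open>Suc K\<close> is always marked, so guessed
  elements belong to every queried set.\<close>

definition mark :: "nat \<Rightarrow> nat set \<Rightarrow> sprog" where
  "mark K J = Seq
     (seqs (map (\<lambda>k. Seq (Do (IConst 4 k)) (Do (IStore 2 4 (if k \<in> J \<or> k = Suc K then 2 else 3)))) [0..<K + 2]))
     (For 6 (seqs [Do (ILoad 4 1 6), Do (ILoad 4 2 4), Do (IStore 3 6 4)]))"

lemma mark_writes: "writes (mark K J) \<subseteq> {I 4, I 6, IA 2, IA 3}"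
  by (auto simp: mark_def writes_seqs)

lemma mark_sem:
  assumes s: "ireg s 2 = 1" "ireg s 3 = 0" and z: "\<forall>j\<le>n. iarr s 1 j \<le> Suc K"
  shows "\<forall>j\<le>n. iarr (sem n f (mark K J) s) 3 j = of_bool (iarr s 1 j \<in> J \<or> iarr s 1 j = Suc K)"
proof -
  let ?A = "seqs (map (\<lambda>k. Seq (Do (IConst 4 k)) (Do (IStore 2 4 (if k \<in> J \<or> k = Suc K then 2 else 3)))) [0..<K + 2])"
  let ?P = "\<lambda>xs s'. ireg s' 2 = 1 \<and> ireg s' 3 = 0 \<and> iarr s' 1 = iarr s 1 \<and>
      (\<forall>k\<in>set xs. iarr s' 2 k = of_bool (k \<in> J \<or> k = Suc K))"
  define s1 where "s1 = sem n f ?A s"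
  define ks where "ks = [0..<K + 2]"
  have ks: "set ks = {..Suc K}" by (auto simp: ks_def)
  have "?P ks s1"
    unfolding s1_def ks_def[symmetric] by (rule fold_map_invariant[where P = ?P]) (use s in auto)
  then have s1: "iarr s1 1 = iarr s 1" "\<forall>k\<le>Suc K. iarr s1 2 k = of_bool (k \<in> J \<or> k = Suc K)"
    using ks by auto
  define w :: "nat \<Rightarrow> nat" where "w j = of_bool (iarr s 1 j \<in> J \<or> iarr s 1 j = Suc K)" for j
  have w: "iarr s1 2 (iarr s 1 j) = w j" if "j \<le> n" for j using that z s1(2) by (simp add: w_def)
  have "\<forall>j\<le>n. iarr (sem n f (For 6 (seqs [Do (ILoad 4 1 6), Do (ILoad 4 2 4), Do (IStore 3 6 4)])) s1) 3 j = w j"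
    by (rule For_rule[where P = "\<lambda>v s'. iarr s' 1 = iarr s 1 \<and> iarr s' 2 = iarr s1 2 \<and> (\<forall>j<v. iarr s' 3 j = w j)"
        and Q = "\<lambda>s'. \<forall>j\<le>n. iarr s' 3 j = w j"])
      (use s1(1) w in \<open>auto elim!: less_SucE intro: le_imp_less_Suc\<close>)
  then show ?thesis unfolding w_def by (simp add: mark_def s1_def)
qed

lemma mark_stored_set:
  assumes "ireg s 2 = 1" "ireg s 3 = 0" "\<forall>j\<le>n. iarr s 1 j \<le> Suc K"
  shows "stored_set n 3 (sem n f (mark K J) s) = chosen n K (iarr s 1) J"
  using mark_sem[OF assms, of f J] by (auto simp: stored_set_def chosen_def)

text \<open>The loop also visits index 0, which is not in the ground set; the rows have entry 0
  there.\<close>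

definition dot :: "nat \<Rightarrow> sprog" where
  "dot i = Seq (Do (RNat 11 3)) (For 6 (Seq (Do (ILoad 4 3 6))
     (If (ILess 3 4) (Seq (Do (RLoad 12 i 6)) (Do (RAdd 11 11 12))) Nop)))"

lemma dot_writes: "writes (dot i) = {I 4, I 6, R 11, R 12}"
  by (auto simp: dot_def)

lemma dot_sem:
  assumes "ireg s 3 = 0" "rarr s i 0 = 0"
  shows "rreg (sem n f (dot i) s) 11 = (\<Sum>j\<in>stored_set n 3 s. rarr s i j)"
proof -
  define h where "h j = (if iarr s 3 j \<noteq> 0 then rarr s i j else 0)" for j
  have "rreg (sem n f (dot i) s) 11 = (\<Sum>j<Suc n. h j)"
    unfolding dot_def sem.simps(3)
    by (rule For_rule[where P = "\<lambda>v s'. ireg s' 3 = 0 \<and> iarr s' 3 = iarr s 3 \<and> rarr s' = rarr s \<and>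
        rreg s' 11 = (\<Sum>j<v. h j)"]) (use assms in \<open>auto simp: h_def\<close>)
  also have "\<dots> = (\<Sum>j\<in>{..n}. h j)" by (simp only: lessThan_Suc_atMost)
  also have "\<dots> = (\<Sum>j\<in>stored_set n 3 s. rarr s i j)"
  proof (rule sum.mono_neutral_cong_right)
    show "\<forall>j\<in>{..n} - stored_set n 3 s. h j = 0"
    proof
      fix j assume "j \<in> {..n} - stored_set n 3 s"
      then show "h j = 0" using assms(2) by (cases "j = 0") (auto simp: stored_set_def h_def)
    qed
  qed (auto simp: stored_set_def h_def)
  finally show ?thesis .
qed

definition gterm :: "nat \<Rightarrow> nat list \<Rightarrow> sprog" where
  "gterm K J = seqs [mark K (set J), Do (Query 11 3), Do (RDiv 11 11 8),
     If (RLess 1 11) (Do (RAdd 11 1 0)) Nop,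
     lit 15 ((K * K + K - 1) ^ (card (set J) - 1))
       ((K * K) ^ (card (set J) - 1) * (card (set J) * (K choose card (set J)))),
     Do (RMul 11 11 15), Do (RAdd 10 10 11)]"

text \<open>With the slack \<open>1 - 1 / K\<close> the base \<open>\<rho>\<close> is a quotient of
  natural numbers, so the weights can be produced by \<open>lit\<close>.\<close>

lemma coef_rational:
  assumes "0 < K"
  shows "coef (1 + (1 - 1 / K) / K) K m
    = real ((K * K + K - 1) ^ (m - 1)) / real ((K * K) ^ (m - 1) * (m * (K choose m)))"
proof -
  have "real (K * K + K - 1) = real K * real K + real K - 1" using assms by (simp add: of_nat_diff)
  then have "1 + (1 - 1 / real K) / real K = real (K * K + K - 1) / real (K * K)"
    using assms by (simp add: field_simps)
  then show ?thesis by (simp add: coef_def power_divide)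
qed

lemma gterm_writes: "writes (gterm K J) \<subseteq> {I 4, I 6, IA 2, IA 3, R 10, R 11, R 12, R 15}"
  using mark_writes[of K "set J"] by (auto simp: gterm_def lit_writes)

lemma gterm_sem:
  assumes b: "base K D n M s" and z: "\<forall>j\<le>n. iarr s 1 j \<le> Suc K" and K: "0 < K"
  shows "rreg (sem n f (gterm K J) s) 10 = rreg s 10
    + coef (1 + (1 - 1 / K) / K) K (card (set J)) * min (f (chosen n K (iarr s 1) (set J)) / rreg s 8) 1"
proof -
  define s1 where "s1 = sem n f (mark K (set J)) s"
  have fr: "ireg s1 x = ireg s x" if "x \<noteq> 4" "x \<noteq> 6" for x
    unfolding s1_def using that mark_writes by (intro sem_frame) blast
  have fr': "rreg s1 x = rreg s x" for x
    unfolding s1_def using mark_writes by (intro sem_frame) blast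
  have st: "stored_set n 3 s1 = chosen n K (iarr s 1) (set J)"
    unfolding s1_def using b z by (intro mark_stored_set) (auto simp: base_def)
  have one: "rreg s1 0 = 0" "rreg s1 1 = 1" using b by (auto simp: fr' base_def)
  define s2 where "s2 = sem n f (seqs [Do (Query 11 3), Do (RDiv 11 11 8), If (RLess 1 11) (Do (RAdd 11 1 0)) Nop]) s1"
  have s2: "rreg s2 11 = min (f (chosen n K (iarr s 1) (set J)) / rreg s 8) 1" "rreg s2 10 = rreg s 10"
    using one by (auto simp: s2_def st fr')
  have "rreg (sem n f (seqs [lit 15 A B, Do (RMul 11 11 15), Do (RAdd 10 10 11)]) s2) 10
      = rreg s2 10 + real A / real B * rreg s2 11" for A B
    by (simp add: lit_def)
  then show ?thesis
    unfolding coef_rational[OF K] s2[symmetric] gterm_def by (simp only: s2_def s1_def seqs_simps sem.simps)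
qed

definition pen :: sprog where
  "pen = If (RLess 0 11) (seqs [Do (RMul 11 11 11), Do (RMul 11 11 6), Do (RSub 10 10 11)]) Nop"

lemma pen_writes: "writes pen = {R 10, R 11}"
  by (auto simp: pen_def)

lemma pen_sem:
  "rreg s 0 = 0 \<Longrightarrow> rreg (sem n f pen s) 10 = rreg s 10 - rreg s 6 * (max 0 (rreg s 11))\<^sup>2"
  by (simp add: pen_def max_def power2_eq_square)

definition ppen :: "nat \<Rightarrow> sprog" where
  "ppen i = seqs [dot i, Do (RSub 11 11 (20 + i)), Do (RSub 12 1 (20 + i)), Do (RDiv 11 11 12),
     Do (RSub 11 11 3), pen]"

definition cpen :: "nat \<Rightarrow> sprog" where
  "cpen i = seqs [dot i, Do (RSub 11 4 11), pen]"

lemma ppen_writes: "writes (ppen i) = {I 4, I 6, R 10, R 11, R 12}"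
  and cpen_writes: "writes (cpen i) = {I 4, I 6, R 10, R 11, R 12}"
  by (auto simp: ppen_def cpen_def dot_writes pen_writes)

lemma pen_terms_sem:
  assumes b: "base K D n M s" and M: "M i 0 = 0" and S: "stored_set n 3 s = S"
  shows "rreg (sem n f (ppen i) s) 10 = rreg s 10 - 4 * (real K)\<^sup>2 *
      (max 0 (((\<Sum>j\<in>S. M i j) - rreg s (20 + i)) / (1 - rreg s (20 + i)) - (1 - 1 / K)))\<^sup>2"
    and "rreg (sem n f (cpen i) s) 10 = rreg s 10 - 4 * (real K)\<^sup>2 * (max 0 ((1 - 2 / K) - (\<Sum>j\<in>S. M i j)))\<^sup>2"
proof -
  define s1 where "s1 = sem n f (dot i) s"
  have fr: "rreg s1 r = rreg s r" if "r \<noteq> 11" "r \<noteq> 12" for r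
    unfolding s1_def using that by (intro sem_frame) (simp add: dot_writes)
  have s1: "rreg s1 11 = (\<Sum>j\<in>S. M i j)"
    unfolding s1_def using b M S by (subst dot_sem) (auto simp: base_def)
  show "rreg (sem n f (ppen i) s) 10 = rreg s 10 - 4 * (real K)\<^sup>2 *
      (max 0 (((\<Sum>j\<in>S. M i j) - rreg s (20 + i)) / (1 - rreg s (20 + i)) - (1 - 1 / K)))\<^sup>2"
    using b by (simp add: ppen_def s1_def[symmetric] pen_sem fr s1 base_def)
  show "rreg (sem n f (cpen i) s) 10 = rreg s 10 - 4 * (real K)\<^sup>2 * (max 0 ((1 - 2 / K) - (\<Sum>j\<in>S. M i j)))\<^sup>2"
    using b by (simp add: cpen_def s1_def[symmetric] pen_sem fr s1 base_def)
qed

definition eval_pot :: "nat \<Rightarrow> nat \<Rightarrow> nat \<Rightarrow> sprog" where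
  "eval_pot p c K = seqs [Do (RNat 10 3), seqs (map (gterm K) (subseqs [1..<K + 1])), mark K {1..K},
     seqs (map ppen [1..<p + 1]), seqs (map cpen [p + 1..<p + c + 1])]"

lemma eval_writes: "writes (eval_pot p c K) \<subseteq> {I 4, I 6, IA 2, IA 3, R 10, R 11, R 12, R 15}"
proof -
  have "writes (gterm K J) \<subseteq> {I 4, I 6, IA 2, IA 3, R 10, R 11, R 12, R 15}" for J by (rule gterm_writes)
  then show ?thesis
    using mark_writes[of K "{1..K}"]
    by (auto simp: eval_pot_def writes_seqs ppen_writes cpen_writes simp del: upt_Suc)
qed

text \<open>Each subprogram adds a term that depends only on locations outside \<open>W\<close>, and
  all of them write only inside \<open>W\<close>. So every term may be evaluated in the initial
  store.\<close>

lemma accumulate_sem: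
  assumes W: "\<And>x. x \<in> set xs \<Longrightarrow> writes (h x) \<subseteq> W"
    and step: "\<And>x s'. x \<in> set xs \<Longrightarrow> (\<And>y. I y \<notin> W \<Longrightarrow> ireg s' y = ireg s y) \<Longrightarrow>
      (\<And>y. IA y \<notin> W \<Longrightarrow> iarr s' y = iarr s y) \<Longrightarrow> (\<And>y. R y \<notin> W \<Longrightarrow> rreg s' y = rreg s y) \<Longrightarrow>
      (\<And>y. RA y \<notin> W \<Longrightarrow> rarr s' y = rarr s y) \<Longrightarrow> rreg (sem n f (h x) s') r = rreg s' r + t x"
  shows "rreg (sem n f (seqs (map h xs)) s) r = rreg s r + sum_list (map t xs)"
proof -
  let ?P = "\<lambda>ys s'. (\<forall>y. I y \<notin> W \<longrightarrow> ireg s' y = ireg s y) \<and> (\<forall>y. IA y \<notin> W \<longrightarrow> iarr s' y = iarr s y) \<and>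
    (\<forall>y. R y \<notin> W \<longrightarrow> rreg s' y = rreg s y) \<and> (\<forall>y. RA y \<notin> W \<longrightarrow> rarr s' y = rarr s y) \<and>
    rreg s' r = rreg s r + sum_list (map t ys)"
  have "?P xs (sem n f (seqs (map h xs)) s)"
  proof (rule fold_map_invariant[where P = ?P])
    fix ys x zs and s' :: store assume xs: "xs = ys @ x # zs" and P: "?P ys s'"
    then have x: "x \<in> set xs" by simp
    have "l \<notin> writes (h x)" if "l \<notin> W" for l using W[OF x] that by auto
    then show "?P (ys @ [x]) (sem n f (h x) s')"
      using P step[OF x, of s'] by (simp add: sem_frame)
  qed simp
  then show ?thesis by simp
qed

lemma eval_sem:
  assumes b: "base K D n M s" and z: "\<forall>j\<le>n. iarr s 1 j \<le> Suc K" and K: "0 < K"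
    and M: "\<And>i. M i 0 = 0"
  shows "rreg (sem n f (eval_pot p c K) s) 10
    = potential p c K n f M (\<lambda>i. rreg s (20 + i)) (rreg s 8) (iarr s 1)"
proof -
  let ?W = "{I 4, I 6, IA 2, IA 3, R 10, R 11, R 12, R 15}"
  let ?z = "iarr s 1"
  let ?S = "chosen n K ?z {1..K}"
  define g where "g J = coef (1 + (1 - 1 / K) / K) K (card J) * min (f (chosen n K ?z J) / rreg s 8) 1" for J
  have base_W: "base K D n M s'" if "\<And>y. I y \<notin> ?W \<Longrightarrow> ireg s' y = ireg s y"
    "\<And>y. R y \<notin> ?W \<Longrightarrow> rreg s' y = rreg s y" "\<And>y. RA y \<notin> ?W \<Longrightarrow> rarr s' y = rarr s y" for s'
  proof -
    have "rarr s' = rarr s" using that(3) by auto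
    then show ?thesis using that(1,2) b by (simp add: base_def)
  qed
  define s0 where "s0 = sem n f (Do (RNat 10 3)) s"
  define s1 where "s1 = sem n f (seqs (map (gterm K) (subseqs [1..<K + 1]))) s0"
  define s2 where "s2 = sem n f (mark K {1..K}) s1"
  define s3 where "s3 = sem n f (seqs (map ppen [1..<p + 1])) s2"
  have s0: "rreg s0 10 = 0" "base K D n M s0" "iarr s0 = iarr s" "\<And>y. y \<noteq> 10 \<Longrightarrow> rreg s0 y = rreg s y"
    using b by (auto simp: s0_def base_def)
  have "rreg s1 10 = rreg s0 10 + sum_list (map (\<lambda>J. g (set J)) (subseqs [1..<K + 1]))"
    unfolding s1_def
  proof (rule accumulate_sem[where W = ?W])
    fix J and s' :: store
    assume 1: "\<And>y. I y \<notin> ?W \<Longrightarrow> ireg s' y = ireg s0 y" "\<And>y. IA y \<notin> ?W \<Longrightarrow> iarr s' y = iarr s0 y"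
      "\<And>y. R y \<notin> ?W \<Longrightarrow> rreg s' y = rreg s0 y" "\<And>y. RA y \<notin> ?W \<Longrightarrow> rarr s' y = rarr s0 y"
    have "iarr s' 1 = ?z" "rreg s' 8 = rreg s 8" using 1(2,3) s0 by auto
    moreover have "base K D n M s'"
      using 1 s0 by (intro base_W) (auto simp: s0_def)
    ultimately show "rreg (sem n f (gterm K J) s') 10 = rreg s' 10 + g (set J)"
      using gterm_sem[of K D n M s' f J] z K by (simp add: g_def)
  qed (rule gterm_writes)
  moreover have "sum_list (map (\<lambda>J. g (set J)) (subseqs [1..<K + 1])) = (\<Sum>J\<in>Pow {1..K}. g J)"
  proof -
    have "distinct (map set (subseqs [1..<K + 1]))" by (intro distinct_set_subseqs) simp
    then have "sum_list (map g (map set (subseqs [1..<K + 1]))) = sum g (set (map set (subseqs [1..<K + 1])))"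
      by (rule sum_list_distinct_conv_sum_set)
    also have "set (map set (subseqs [1..<K + 1])) = Pow {1..K}"
      unfolding set_map subseqs_powset by (simp add: atLeastLessThanSuc_atLeastAtMost del: upt_Suc)
    finally show ?thesis by (simp add: comp_def del: upt_Suc)
  qed
  ultimately have s1: "rreg s1 10 = (\<Sum>J\<in>Pow {1..K}. g J)" using s0 by simp
  have W1: "writes (seqs (map (gterm K) (subseqs [1..<K + 1]))) \<subseteq> ?W"
    using gterm_writes by (auto simp: writes_seqs simp del: upt_Suc)
  have fr1: "base K D n M s1" "iarr s1 1 = ?z" "\<And>y. y \<notin> {10,11,12,15} \<Longrightarrow> rreg s1 y = rreg s y"
  proof -
    show "base K D n M s1" unfolding s1_def using s0(2) W1 by (intro base_frame) auto
    show "iarr s1 1 = ?z" unfolding s1_def using s0(3) W1 by (subst sem_frame) auto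
    show "rreg s1 y = rreg s y" if "y \<notin> {10,11,12,15}" for y
      unfolding s1_def using s0(4) that W1 by (subst sem_frame) auto
  qed
  have m1: "ireg s1 2 = 1" "ireg s1 3 = 0" "\<forall>j\<le>n. iarr s1 1 j \<le> Suc K"
    using fr1 z by (auto simp: base_def)
  have fr2: "base K D n M s2" "stored_set n 3 s2 = ?S" "\<And>y. rreg s2 y = rreg s1 y"
  proof -
    show "base K D n M s2" unfolding s2_def using fr1(1) mark_writes[of K "{1..K}"] by (intro base_frame) auto
    show "stored_set n 3 s2 = ?S" unfolding s2_def using mark_stored_set[OF m1] fr1(2) by simp
    show "rreg s2 y = rreg s1 y" for y
      unfolding s2_def using mark_writes[of K "{1..K}"] by (intro sem_frame) auto
  qed
  define P1 where "P1 i = - (4 * (real K)\<^sup>2 *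
      (max 0 (((\<Sum>j\<in>?S. M i j) - rreg s (20 + i)) / (1 - rreg s (20 + i)) - (1 - 1 / K)))\<^sup>2)" for i
  define P2 where "P2 i = - (4 * (real K)\<^sup>2 * (max 0 ((1 - 2 / K) - (\<Sum>j\<in>?S. M i j)))\<^sup>2)" for i
  have s3: "rreg s3 10 = rreg s2 10 + sum_list (map P1 [1..<p + 1])"
    unfolding s3_def
  proof (rule accumulate_sem[where W = "{I 4, I 6, R 10, R 11, R 12}"])
    fix i and s' :: store
    let ?W = "{I 4, I 6, R 10, R 11, R 12}"
    assume 1: "\<And>y. I y \<notin> ?W \<Longrightarrow> ireg s' y = ireg s2 y" "\<And>y. IA y \<notin> ?W \<Longrightarrow> iarr s' y = iarr s2 y"
      "\<And>y. R y \<notin> ?W \<Longrightarrow> rreg s' y = rreg s2 y" "\<And>y. RA y \<notin> ?W \<Longrightarrow> rarr s' y = rarr s2 y"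
    have "rarr s' = rarr s2" using 1(4) by auto
    then have "base K D n M s'" using fr2(1) 1(1,3) by (simp add: base_def)
    moreover have "stored_set n 3 s' = ?S" using fr2(2) 1(2) by (simp add: stored_set_def)
    moreover have "rreg s' (20 + i) = rreg s (20 + i)" using 1(3) fr2(3) fr1(3) by simp
    ultimately show "rreg (sem n f (ppen i) s') 10 = rreg s' 10 + P1 i"
      using pen_terms_sem(1)[of K D n M s' i ?S f] M by (simp add: P1_def)
  qed (simp add: ppen_writes)
  have fr3: "base K D n M s3" "stored_set n 3 s3 = ?S"
  proof -
    have W3: "writes (seqs (map ppen [1..<p + 1])) \<subseteq> {I 4, I 6, R 10, R 11, R 12}"
      by (auto simp: writes_seqs ppen_writes)
    show "base K D n M s3" unfolding s3_def using fr2(1) W3 by (intro base_frame) auto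
    have "iarr s3 3 = iarr s2 3" unfolding s3_def using W3 by (intro sem_frame) auto
    then show "stored_set n 3 s3 = ?S" using fr2(2) by (simp add: stored_set_def)
  qed
  have "rreg (sem n f (seqs (map cpen [p + 1..<p + c + 1])) s3) 10
      = rreg s3 10 + sum_list (map P2 [p + 1..<p + c + 1])"
  proof (rule accumulate_sem[where W = "{I 4, I 6, R 10, R 11, R 12}"])
    fix i and s' :: store
    let ?W = "{I 4, I 6, R 10, R 11, R 12}"
    assume 1: "\<And>y. I y \<notin> ?W \<Longrightarrow> ireg s' y = ireg s3 y" "\<And>y. IA y \<notin> ?W \<Longrightarrow> iarr s' y = iarr s3 y"
      "\<And>y. R y \<notin> ?W \<Longrightarrow> rreg s' y = rreg s3 y" "\<And>y. RA y \<notin> ?W \<Longrightarrow> rarr s' y = rarr s3 y"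
    have "rarr s' = rarr s3" using 1(4) by auto
    then have "base K D n M s'" using fr3(1) 1(1,3) by (simp add: base_def)
    moreover have "stored_set n 3 s' = ?S" using fr3(2) 1(2) by (simp add: stored_set_def)
    ultimately show "rreg (sem n f (cpen i) s') 10 = rreg s' 10 + P2 i"
      using pen_terms_sem(2)[of K D n M s' i ?S f] M by (simp add: P2_def)
  qed (simp add: cpen_writes)
  moreover have "sum_list (map P1 [1..<p + 1]) = (\<Sum>i=1..p. P1 i)"
    "sum_list (map P2 [p + 1..<p + c + 1]) = (\<Sum>i=p+1..p+c. P2 i)"
    by (simp_all only: interv_sum_list_conv_sum_set_nat set_upt Suc_eq_plus1[symmetric] atLeastLessThanSuc_atLeastAtMost)
  moreover have "sem n f (eval_pot p c K) s = sem n f (seqs (map cpen [p + 1..<p + c + 1])) s3"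
    unfolding s3_def s2_def s1_def s0_def eval_pot_def by (simp only: seqs_simps sem.simps)
  ultimately show ?thesis
    using s1 s3 fr2(3) by (simp add: potential_def g_def P1_def P2_def sum_negf del: upt_Suc)
qed

section \<open>The local search program\<close>

text \<open>A move is kept only if it gains more than the threshold in real register 7; otherwise
  the old slot, saved in index register 8, is restored. Addition of real register 0 serves as
  copying.\<close>

definition try_move :: "nat \<Rightarrow> nat \<Rightarrow> nat \<Rightarrow> nat \<Rightarrow> sprog" where
  "try_move p c K k = seqs [Do (ILoad 8 1 7), Do (IConst 5 k), Do (IStore 1 7 5), eval_pot p c K,
     Do (RAdd 11 13 7), If (RLess 11 10) (Do (RAdd 13 10 0)) (Do (IStore 1 7 8))]"

definition sweep :: "nat \<Rightarrow> nat \<Rightarrow> nat \<Rightarrow> sprog" where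
  "sweep p c K = For 7 (Seq (Do (ILoad 4 4 7))
     (If (ILess 3 4) (seqs (map (try_move p c K) [0..<K + 1])) Nop))"

lemma try_move_writes:
  "writes (try_move p c K k) \<subseteq> {I 4, I 5, I 6, I 8, IA 1, IA 2, IA 3, R 10, R 11, R 12, R 13, R 15}"
  using eval_writes[of p c K] by (auto simp: try_move_def)

lemma sweep_writes:
  "writes (sweep p c K) \<subseteq> {I 4, I 5, I 6, I 7, I 8, IA 1, IA 2, IA 3, R 10, R 11, R 12, R 13, R 15}"
proof -
  have "writes (try_move p c K k) \<subseteq> {I 4, I 5, I 6, I 7, I 8, IA 1, IA 2, IA 3, R 10, R 11, R 12, R 13, R 15}" for k
    using try_move_writes[of p c K k] by auto
  then show ?thesis by (auto simp: sweep_def writes_seqs simp del: upt_Suc)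
qed

text \<open>The nest is used as a clock: it runs its body a fixed number of times, a power of
  \<open>n + 1\<close>, and the body ignores the counters.\<close>

lemma nest_count:
  assumes "\<And>i s. P i s \<Longrightarrow> P (Suc i) (sem n f b s)"
    and "\<And>i s x v. x \<in> set xs \<Longrightarrow> P i s \<Longrightarrow> P i (set_ireg x v s)"
    and "P i s"
  shows "P (i + (n + 1) ^ length xs) (sem n f (nest xs b) s)"
  using assms(2,3)
proof (induction xs arbitrary: i s)
  case Nil
  then show ?case using assms(1) by simp
next
  case (Cons x xs)
  let ?k = "(n + 1) ^ length xs"
  have "P (i + Suc n * ?k) (fold (\<lambda>v s. sem n f (nest xs b) (set_ireg x v s)) [0..<Suc n] s)"
  proof (rule fold_invariant_upt[where P = "\<lambda>v. P (i + v * ?k)"])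
    fix v s assume "P (i + v * ?k) s"
    then have "P (i + v * ?k) (set_ireg x v s)" by (intro Cons.prems(1)) auto
    then have "P (i + v * ?k + ?k) (sem n f (nest xs b) (set_ireg x v s))"
      by (intro Cons.IH) (use Cons.prems(1) in auto)
    then show "P (i + Suc v * ?k) (sem n f (nest xs b) (set_ireg x v s))" by (simp add: algebra_simps)
  qed (use Cons.prems(2) in simp)
  then have "P (i + Suc n * ?k) (sem n f (nest (x # xs) b) s)"
    unfolding nest.simps sem.simps by (intro Cons.prems(1)) auto
  then show ?case by simp
qed

text \<open>Fixes what stays constant during the search for one guess: the contributions
  \<open>e\<close> of the guessed set, the guessed value \<open>V\<close>, the marks
  \<open>F\<close> of movable elements and the initial assignment \<open>z0\<close>, which unmarked
  elements keep.\<close>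

locale search =
  fixes p c K D n :: nat and M :: "nat \<Rightarrow> nat \<Rightarrow> real" and f :: "nat set \<Rightarrow> real"
    and e :: "nat \<Rightarrow> real" and V :: real and F z0 :: "nat \<Rightarrow> nat"
  assumes K: "2 \<le> K" and M0: "\<And>i. M i 0 = 0"
begin

abbreviation "\<Psi> \<equiv> potential p c K n f M e V"
abbreviation "\<eta> \<equiv> 1 / (2 * real K) / real (n + 1)"

definition inv :: "store \<Rightarrow> (nat \<Rightarrow> nat) \<Rightarrow> bool" where
  "inv s z \<longleftrightarrow> base K D n M s \<and> iarr s 1 = z \<and> iarr s 4 = F \<and> rreg s 8 = V \<and>
     (\<forall>i. rreg s (20 + i) = e i) \<and> rreg s 13 = \<Psi> z \<and>
     (\<forall>j\<le>n. if F j = 0 then z j = z0 j \<and> z0 j \<le> Suc K else z j \<le> K)"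

definition locopt :: "(nat \<Rightarrow> nat) \<Rightarrow> bool" where
  "locopt z \<longleftrightarrow> (\<forall>j\<le>n. F j \<noteq> 0 \<longrightarrow> (\<forall>k\<le>K. \<Psi> (z(j := k)) \<le> \<Psi> z + \<eta>))"

lemma inv_bounded: "inv s z \<Longrightarrow> \<forall>j\<le>n. z j \<le> Suc K"
  unfolding inv_def by (metis le_SucI)

lemma try_move_sem:
  assumes inv: "inv s z" and x: "ireg s 7 = x" "x \<le> n" "F x \<noteq> 0" and k: "k \<le> K"
  shows "(\<Psi> (z(x := k)) \<le> \<Psi> z + \<eta> \<and> inv (sem n f (try_move p c K k) s) z) \<or>
    (\<Psi> z + \<eta> < \<Psi> (z(x := k)) \<and> inv (sem n f (try_move p c K k) s) (z(x := k)))"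
proof -
  define s1 where "s1 = sem n f (seqs [Do (ILoad 8 1 7), Do (IConst 5 k), Do (IStore 1 7 5)]) s"
  define s2 where "s2 = sem n f (eval_pot p c K) s1"
  define s3 where "s3 = sem n f (seqs [Do (RAdd 11 13 7), If (RLess 11 10) (Do (RAdd 13 10 0)) (Do (IStore 1 7 8))]) s2"
  have s1: "base K D n M s1" "iarr s1 1 = z(x := k)" "iarr s1 4 = F" "ireg s1 7 = x" "ireg s1 8 = z x"
    "rreg s1 = rreg s"
    using inv x(1) by (auto simp: s1_def inv_def base_def)
  have W: "\<And>l. l \<notin> {I 4, I 6, IA 2, IA 3, R 10, R 11, R 12, R 15} \<Longrightarrow> l \<notin> writes (eval_pot p c K)"
    using eval_writes by blast
  have fr: "ireg s2 y = ireg s1 y" if "y \<notin> {4, 6}" for y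
    unfolding s2_def using that by (intro sem_frame W) auto
  have fa: "iarr s2 y = iarr s1 y" if "y \<notin> {2, 3}" for y
    unfolding s2_def using that by (intro sem_frame W) auto
  have fq: "rreg s2 y = rreg s y" if "y \<notin> {10, 11, 12, 15}" for y
    unfolding s1(6)[symmetric] s2_def using that by (intro sem_frame W) auto
  have b2: "base K D n M s2"
    unfolding s2_def using s1(1) W by (intro base_frame) auto
  have e: "(\<lambda>i. rreg s (20 + i)) = e" using inv by (simp add: inv_def)
  have V: "rreg s 8 = V" "rreg s 13 = \<Psi> z" using inv by (auto simp: inv_def)
  have r10: "rreg s2 10 = \<Psi> (z(x := k))"
    unfolding s2_def using s1 e V inv_bounded[OF inv] k K
    by (subst eval_sem[where D = D and M = M]) (auto simp: M0)
  have z_upd: "(z(x := k))(x := z x) = z" by simp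
  have b: "rreg s2 0 = 0" "rreg s2 7 = \<eta>" using b2 by (auto simp: base_def)
  have "sem n f (try_move p c K k) s = s3"
    by (simp only: try_move_def s3_def s2_def s1_def seqs_simps sem.simps)
  moreover have "inv s3 (if \<Psi> z + \<eta> < \<Psi> (z(x := k)) then z(x := k) else z)"
  proof -
    have "base K D n M s3" unfolding s3_def using b2 by (intro base_frame) auto
    moreover have "rreg s3 13 = \<Psi> (if \<Psi> z + \<eta> < \<Psi> (z(x := k)) then z(x := k) else z)"
      using b V fq[of 13] r10 by (simp add: s3_def)
    moreover have "iarr s3 1 = (if \<Psi> z + \<eta> < \<Psi> (z(x := k)) then z(x := k) else z)"
      using b V fq[of 13] r10 fa[of 1] fr[of 7] fr[of 8] s1 by (simp add: s3_def)
    moreover have "iarr s3 4 = F" using fa[of 4] s1(3) by (simp add: s3_def)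
    moreover have "rreg s3 8 = V" "\<forall>i. rreg s3 (20 + i) = e i"
      using fq V inv by (auto simp: s3_def inv_def)
    ultimately show ?thesis using inv x k unfolding inv_def by auto
  qed
  ultimately show ?thesis by (auto simp: not_less split: if_splits)
qed

text \<open>Invariant of one sweep started at \<open>y\<close>, after the moves in \<open>T\<close>
  were tried. As long as nothing was accepted, all of \<open>T\<close> is known to fail at
  \<open>y\<close> itself; after an acceptance the tested moves say nothing about the current
  assignment, but a gain above \<open>\<eta>\<close> is secured.\<close>

definition progress :: "(nat \<Rightarrow> nat) \<Rightarrow> (nat \<times> nat) set \<Rightarrow> (nat \<Rightarrow> nat) \<Rightarrow> bool" where
  "progress y T z \<longleftrightarrow> (z = y \<and> (\<forall>(x, k)\<in>T. \<Psi> (y(x := k)) \<le> \<Psi> y + \<eta>)) \<or> (\<Psi> y + \<eta> < \<Psi> z \<and> \<not> locopt y)"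

lemma progress_try:
  assumes "inv s z" "ireg s 7 = x" "x \<le> n" "F x \<noteq> 0" "k \<le> K" "progress y T z"
  shows "\<exists>z'. inv (sem n f (try_move p c K k) s) z' \<and> progress y (insert (x, k) T) z'"
proof -
  have \<eta>: "0 \<le> \<eta>" by simp
  consider "\<Psi> (z(x := k)) \<le> \<Psi> z + \<eta>" "inv (sem n f (try_move p c K k) s) z"
    | "\<Psi> z + \<eta> < \<Psi> (z(x := k))" "inv (sem n f (try_move p c K k) s) (z(x := k))"
    using try_move_sem[OF assms(1-5)] by blast
  then show ?thesis
  proof cases
    case 1
    then have "progress y (insert (x, k) T) z" using assms(6) by (auto simp: progress_def)
    then show ?thesis using 1 by blast
  next
    case 2
    have "progress y (insert (x, k) T) (z(x := k))"
    proof (cases "z = y")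
      case True
      \<comment> \<open>The first accepted move is itself a witness that \<open>y\<close> was not
        locally optimal.\<close>
      then have "\<not> locopt y" using 2 assms(3-5) by (force simp: locopt_def)
      then show ?thesis using 2 True by (simp add: progress_def)
    next
      case False
      then show ?thesis using assms(6) 2 \<eta> unfolding progress_def by linarith
    qed
    then show ?thesis using 2 by blast
  qed
qed

text \<open>If nothing is accepted, the sweep has tested every move at \<open>y\<close> and so
  certifies local optimality; the assignment then stays fixed in all later sweeps.\<close>

lemma sweep_sem:
  assumes inv: "inv s y"
  shows "\<exists>z. inv (sem n f (sweep p c K) s) z \<and>
    ((z = y \<and> locopt y) \<or> (\<Psi> y + \<eta> < \<Psi> z \<and> \<not> locopt y))"
proof -
  let ?T = "\<lambda>v. {(x, k). x < v \<and> F x \<noteq> 0 \<and> k \<le> K}"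
  let ?Q = "\<lambda>v s'. \<exists>z. inv s' z \<and> progress y (?T v) z"
  have insens: "inv (set_ireg 7 v s') z = inv s' z" for v s' z by (simp add: inv_def base_def)
  have "?Q (Suc n) (sem n f (sweep p c K) s)"
    unfolding sweep_def
  proof (rule For_rule[where P = ?Q and Q = "?Q (Suc n)"])
    show "?Q 0 s" using inv by (auto simp: progress_def)
    show "?Q (Suc n) (set_ireg 7 (Suc n) s')" if "?Q (Suc n) s'" for s' using that insens by simp
    fix v s' assume v: "v \<le> n" and "?Q v s'"
    then obtain z where z: "inv s' z" "progress y (?T v) z" by blast
    define s1 where "s1 = sem n f (Do (ILoad 4 4 7)) (set_ireg 7 v s')"
    have s1: "inv s1 z" "ireg s1 7 = v" "ireg s1 4 = F v" "ireg s1 3 = 0"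
      using z(1) by (auto simp: s1_def inv_def base_def)
    show "?Q (Suc v) (sem n f (Seq (Do (ILoad 4 4 7))
        (If (ILess 3 4) (seqs (map (try_move p c K) [0..<K + 1])) Nop)) (set_ireg 7 v s'))"
    proof (cases "F v = 0")
      case True
      then have "?T (Suc v) = ?T v" by (auto simp: less_Suc_eq)
      then show ?thesis using True s1 z by (auto simp: s1_def[symmetric, simplified])
    next
      case False
      let ?s2 = "sem n f (seqs (map (try_move p c K) [0..<K + 1])) s1"
      define ks where "ks = [0..<K + 1]"
      have ks: "set ks = {..K}" by (auto simp: ks_def)
      let ?P = "\<lambda>xs s'. ireg s' 7 = v \<and> (\<exists>z. inv s' z \<and> progress y (?T v \<union> {v} \<times> set xs) z)"
      have "?P ks (sem n f (seqs (map (try_move p c K) ks)) s1)"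
      proof (rule fold_map_invariant[where P = ?P])
        show "?P [] s1" using s1 z by auto
        fix xs k ys and s' :: store assume kk: "ks = xs @ k # ys" and "?P xs s'"
        then obtain z where z: "ireg s' 7 = v" "inv s' z" "progress y (?T v \<union> {v} \<times> set xs) z" by blast
        have "k \<in> set ks" using kk by simp
        then have "k \<le> K" using ks by simp
        from progress_try[OF z(2,1) v False this z(3)]
        have "\<exists>z'. inv (sem n f (try_move p c K k) s') z' \<and>
          progress y (insert (v, k) (?T v \<union> {v} \<times> set xs)) z'" .
        moreover have "insert (v, k) (?T v \<union> {v} \<times> set xs) = ?T v \<union> {v} \<times> set (xs @ [k])" by auto
        moreover have "ireg (sem n f (try_move p c K k) s') 7 = v"
          using z(1) try_move_writes[of p c K k] by (subst sem_frame) auto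
        ultimately show "?P (xs @ [k]) (sem n f (try_move p c K k) s')" by simp
      qed
      moreover have "?T v \<union> {v} \<times> set ks = ?T (Suc v)" using False ks by auto
      ultimately have "?Q (Suc v) ?s2" unfolding ks_def by simp
      moreover have "sem n f (Seq (Do (ILoad 4 4 7))
        (If (ILess 3 4) (seqs (map (try_move p c K) [0..<K + 1])) Nop)) (set_ireg 7 v s') = ?s2"
        unfolding sem.simps(3,4) s1_def[symmetric] using s1 False by simp
      ultimately show ?thesis by simp
    qed
  qed
  then obtain z where z: "inv (sem n f (sweep p c K) s) z" "progress y (?T (Suc n)) z" by blast
  have "locopt y" if "\<forall>(x, k)\<in>?T (Suc n). \<Psi> (y(x := k)) \<le> \<Psi> y + \<eta>"
    using that by (auto simp: locopt_def less_Suc_eq_le)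
  then show ?thesis using z unfolding progress_def by blast
qed

text \<open>Every sweep before a local optimum is reached gains at least \<open>\<eta>\<close>. With
  a nest long enough, the second alternative will contradict the range of the potential.\<close>

lemma local_search_sem:
  assumes inv: "inv s y" and cs: "\<And>x. x \<in> set cs \<Longrightarrow> 20 \<le> x"
  shows "\<exists>z. inv (sem n f (nest cs (sweep p c K)) s) z \<and>
    (locopt z \<or> \<Psi> y + (n + 1) ^ length cs * \<eta> \<le> \<Psi> z)"
proof -
  let ?P = "\<lambda>i s'. \<exists>z. inv s' z \<and> (locopt z \<or> \<Psi> y + real i * \<eta> \<le> \<Psi> z)"
  have "?P (0 + (n + 1) ^ length cs) (sem n f (nest cs (sweep p c K)) s)"
  proof (rule nest_count[where P = ?P])
    fix i s' assume "?P i s'"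
    then obtain z where z: "inv s' z" "locopt z \<or> \<Psi> y + real i * \<eta> \<le> \<Psi> z" by blast
    obtain z' where z': "inv (sem n f (sweep p c K) s') z'"
      "(z' = z \<and> locopt z) \<or> (\<Psi> z + \<eta> < \<Psi> z' \<and> \<not> locopt z)"
      using sweep_sem[OF z(1)] by blast
    \<comment> \<open>The threshold is generalised to a variable \<open>h\<close>, so that
      simplification does not expand the fraction.\<close>
    have "locopt z' \<or> \<Psi> y + real (Suc i) * h \<le> \<Psi> z'"
      if "locopt z \<or> \<Psi> y + real i * h \<le> \<Psi> z" "(z' = z \<and> locopt z) \<or> (\<Psi> z + h < \<Psi> z' \<and> \<not> locopt z)"
      for h
      using that by (auto simp: algebra_simps)
    from this[OF z(2) z'(2)] have "locopt z' \<or> \<Psi> y + real (Suc i) * \<eta> \<le> \<Psi> z'" .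
    then show "?P (Suc i) (sem n f (sweep p c K) s')" using z'(1) by blast
  next
    fix i s' x v assume "x \<in> set cs" "?P i s'"
    then have "20 \<le> x" using cs by simp
    then have "inv (set_ireg x v s') z = inv s' z" for z by (simp add: inv_def base_def)
    then show "?P i (set_ireg x v s')" using \<open>?P i s'\<close> by simp
  next
    show "?P 0 s" using inv by (intro exI[of _ y]) simp
  qed
  then show ?thesis by simp
qed

end

text \<open>Penalties only lower the potential, and after truncation the gain is at most the sum of
  all weights, one term \<open>\<rho> ^ (m - 1) / m\<close> for each size \<open>m\<close>, each at
  most 3.\<close>

lemma potential_le:
  assumes "2 \<le> K"
  shows "potential p c K n f M e V z \<le> 3 * K"
proof -
  define \<rho> where "\<rho> = 1 + (1 - 1 / real K) / K"
  note rb = rho_power_bounds[OF assms \<rho>_def]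
  have \<rho>1: "1 \<le> \<rho>" using assms by (simp add: \<rho>_def)
  have "potential p c K n f M e V z \<le> (\<Sum>J\<in>Pow {1..K}. coef \<rho> K (card J) * min (f (chosen n K z J) / V) 1)"
  proof -
    have "x - y - w \<le> x" if "0 \<le> y" "0 \<le> w" for x y w :: real using that by simp
    then show ?thesis unfolding potential_def \<rho>_def[symmetric]
      by (rule order_trans) (auto intro!: sum_nonneg)
  qed
  also have "\<dots> \<le> (\<Sum>J\<in>Pow {1..K}. coef \<rho> K (card J))"
    using \<rho>1 by (intro sum_mono mult_left_le) (auto intro: coef_nonneg)
  also have "\<dots> = (\<Sum>m\<le>K. real (K choose m) * coef \<rho> K m)"
    using sum_Pow_card[of "{1..K}" "coef \<rho> K"] by simp
  also have "\<dots> = (\<Sum>m\<in>{1..K}. real (K choose m) * coef \<rho> K m)"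
    by (rule sum.mono_neutral_right) (auto simp: coef_def not_less_eq_eq)
  also have "\<dots> \<le> (\<Sum>m\<in>{1..K}. 3)"
  proof (rule sum_mono)
    fix m assume m: "m \<in> {1..K}"
    have "\<rho> ^ (m - 1) \<le> \<rho> ^ K" using \<rho>1 m by (intro power_increasing) auto
    then have "\<rho> ^ (m - 1) \<le> 3" using rb by linarith
    moreover have "\<rho> ^ (m - 1) / m \<le> \<rho> ^ (m - 1) / 1" using m \<rho>1 by (intro divide_left_mono) auto
    moreover have "real (K choose m) * coef \<rho> K m = \<rho> ^ (m - 1) / m" using m by (simp add: coef_def)
    ultimately show "real (K choose m) * coef \<rho> K m \<le> 3" by simp
  qed
  finally show ?thesis by simp
qed

text \<open>Bound for the start of the search, where only the guessed set \<open>E\<close> is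
  chosen: the rescaled packing loads are 0, and each covering deficit is at most 1.\<close>

lemma potential_ge:
  assumes "2 \<le> K" and f: "\<And>S. S \<subseteq> {1..n} \<Longrightarrow> 0 \<le> f S" and V: "0 \<le> V"
    and E: "chosen n K z {1..K} = E" "\<And>i. i \<in> {1..p} \<Longrightarrow> (\<Sum>j\<in>E. M i j) = e i"
      "\<And>i. i \<in> {p+1..p+c} \<Longrightarrow> 0 \<le> (\<Sum>j\<in>E. M i j)"
  shows "- (4 * (real K)\<^sup>2 * c) \<le> potential p c K n f M e V z"
proof -
  define \<rho> where "\<rho> = 1 + (1 - 1 / real K) / K"
  have \<rho>0: "0 \<le> \<rho>" using assms(1) by (simp add: \<rho>_def)
  have 1: "0 \<le> (\<Sum>J\<in>Pow {1..K}. coef \<rho> K (card J) * min (f (chosen n K z J) / V) 1)"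
  proof -
    have "0 \<le> f (chosen n K z J) / V" for J
      using V by (intro divide_nonneg_nonneg f) (auto simp: chosen_def)
    then show ?thesis using \<rho>0 by (intro sum_nonneg mult_nonneg_nonneg coef_nonneg) auto
  qed
  have 2: "(\<Sum>i=1..p. 4 * K\<^sup>2 *
        (max 0 (((\<Sum>j\<in>chosen n K z {1..K}. M i j) - e i) / (1 - e i) - (1 - 1 / K)))\<^sup>2) = 0"
    unfolding E(1) using E(2) assms(1) by (intro sum.neutral) auto
  have 3: "(\<Sum>i=p+1..p+c. 4 * K\<^sup>2 *
        (max 0 ((1 - 2 / K) - (\<Sum>j\<in>chosen n K z {1..K}. M i j)))\<^sup>2) \<le> (\<Sum>i=p+1..p+c. real (4 * K\<^sup>2) * 1)"
  proof (intro sum_mono mult_left_mono)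
    fix i assume "i \<in> {p+1..p+c}"
    then have "0 \<le> (\<Sum>j\<in>E. M i j)" using E(3) by simp
    moreover have "0 \<le> 2 / real K" by simp
    ultimately have "(1 - 2 / K) - (\<Sum>j\<in>E. M i j) \<le> 1" by linarith
    then have "max 0 ((1 - 2 / K) - (\<Sum>j\<in>E. M i j)) \<le> 1" by simp
    then show "(max 0 ((1 - 2 / K) - (\<Sum>j\<in>chosen n K z {1..K}. M i j)))\<^sup>2 \<le> 1"
      unfolding E(1) by (intro power_le_one) auto
  qed simp
  then show ?thesis using 1 2 unfolding potential_def \<rho>_def[symmetric] by (simp add: algebra_simps)
qed

section \<open>Enumerating the guesses\<close>

text \<open>The guess is read off the loop counters in registers \<open>20 + i\<close>. Repetitions
  are allowed, and 0 is not an element, so all sets of at most \<open>mm\<close> elements are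
  reached.\<close>

definition guess_set :: "nat \<Rightarrow> nat \<Rightarrow> sprog" where
  "guess_set K mm = Seq (For 6 (Do (IStore 1 6 3)))
     (seqs (map (\<lambda>i. Seq (Do (IConst 4 (Suc K))) (Do (IStore 1 (20 + i) 4))) [0..<mm]))"

definition guess_rows :: "nat \<Rightarrow> nat \<Rightarrow> sprog" where
  "guess_rows p c = seqs (map (\<lambda>i. Seq (dot i) (Do (RAdd (20 + i) 11 0))) [1..<p + c + 1])"

text \<open>A counter only reaches \<open>n\<close>, so the multiplier of the value guess is the sum
  of \<open>2 * K\<close> counters.\<close>

definition guess_val :: "nat \<Rightarrow> nat \<Rightarrow> sprog" where
  "guess_val K mm = seqs [Do (Query 11 3), Do (IConst 5 0),
     seqs (map (\<lambda>i. Do (IAdd 5 5 (20 + i))) [mm..<mm + 2 * K]), Do (RNat 12 5), Do (RMul 11 11 12),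
     Do (IConst 5 K), Do (RNat 12 5), Do (RDiv 8 11 12)]"

definition ptest :: "nat \<Rightarrow> sprog" where
  "ptest i = seqs [Do (RSub 12 1 (20 + i)), Do (RMul 12 2 12), Do (RLoad 11 i 7),
     If (RLess 12 11) (Do (IConst 5 0)) Nop]"

definition ctest :: "nat \<Rightarrow> sprog" where
  "ctest i = seqs [Do (RLoad 11 i 7), If (RLess 2 11) (If (RLess (20 + i) 1) (Do (IConst 5 0)) Nop) Nop]"

definition restrict_move :: "nat \<Rightarrow> nat \<Rightarrow> sprog" where
  "restrict_move p c = seqs [Do (IConst 5 1), Do (ILoad 4 1 7), If (ILess 3 4) (Do (IConst 5 0)) Nop,
     seqs (map ptest [1..<p + 1]), seqs (map ctest [p + 1..<p + c + 1]), Do (IStore 4 7 5)]"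

definition restrict_moves :: "nat \<Rightarrow> nat \<Rightarrow> sprog" where
  "restrict_moves p c = For 7 (restrict_move p c)"

text \<open>\<open>mark K {}\<close> selects exactly the guessed elements. The final evaluation
  provides the initial current potential in real register 13.\<close>

definition prep :: "nat \<Rightarrow> nat \<Rightarrow> nat \<Rightarrow> nat \<Rightarrow> sprog" where
  "prep p c K mm = seqs [guess_set K mm, mark K {}, guess_rows p c, guess_val K mm, restrict_moves p c,
     eval_pot p c K, Do (RAdd 13 10 0)]"

lemma guess_set_writes: "writes (guess_set K mm) \<subseteq> {I 4, I 6, IA 1}"
  by (auto simp: guess_set_def writes_seqs)

lemma guess_rows_writes: "writes (guess_rows p c) \<subseteq> {I 4, I 6, R 11, R 12} \<union> R ` {20..}"
  by (auto simp: guess_rows_def writes_seqs dot_writes)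

lemma guess_val_writes: "writes (guess_val K mm) \<subseteq> {I 5, R 8, R 11, R 12}"
  by (auto simp: guess_val_def writes_seqs)

lemma tests_writes: "writes (ptest i) = {I 5, R 11, R 12}" "writes (ctest i) = {I 5, R 11}"
  by (auto simp: ptest_def ctest_def)

lemma restrict_moves_writes: "writes (restrict_moves p c) \<subseteq> {I 4, I 5, I 7, R 11, R 12, IA 4}"
  by (auto simp: restrict_moves_def restrict_move_def writes_seqs tests_writes)

lemma prep_writes: "writes (prep p c K mm) \<subseteq> {I 4, I 5, I 6, I 7, IA 1, IA 2, IA 3, IA 4,
   R 8, R 10, R 11, R 12, R 13, R 15} \<union> R ` {20..}"
  using guess_set_writes[of K mm] mark_writes[of K "{}"] guess_rows_writes[of p c] guess_val_writes[of K mm]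
    restrict_moves_writes[of p c] eval_writes[of p c K]
  by (auto simp: prep_def)

lemma guess_set_sem:
  assumes "base K D n M s"
  shows "\<forall>j\<le>n. iarr (sem n f (guess_set K mm) s) 1 j = (if \<exists>i<mm. ireg s (20 + i) = j then Suc K else 0)"
proof -
  define s1 where "s1 = sem n f (For 6 (Do (IStore 1 6 3))) s"
  have s1: "\<forall>j\<le>n. iarr s1 1 j = 0"
    unfolding s1_def
    by (rule For_rule[where P = "\<lambda>v s'. ireg s' 3 = 0 \<and> (\<forall>j<v. iarr s' 1 j = 0)"
        and Q = "\<lambda>s'. \<forall>j\<le>n. iarr s' 1 j = 0"])
      (use assms in \<open>auto simp: base_def elim!: less_SucE intro: le_imp_less_Suc\<close>)
  have fr: "ireg s1 (20 + i) = ireg s (20 + i)" for i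
    unfolding s1_def by (intro sem_frame) auto
  let ?P = "\<lambda>xs s'. (\<forall>i. ireg s' (20 + i) = ireg s (20 + i)) \<and>
    (\<forall>j\<le>n. iarr s' 1 j = (if \<exists>i\<in>set xs. ireg s (20 + i) = j then Suc K else 0))"
  define xs where "xs = [0..<mm]"
  have "?P xs (sem n f (seqs (map (\<lambda>i. Seq (Do (IConst 4 (Suc K))) (Do (IStore 1 (20 + i) 4))) xs)) s1)"
    by (rule fold_map_invariant[where P = ?P]) (use s1 fr in auto)
  then show ?thesis unfolding guess_set_def sem.simps(3) s1_def[symmetric] by (auto simp: xs_def)
qed

lemma guess_rows_sem:
  assumes b: "base K D n M s" and M: "\<And>i. M i 0 = 0"
  shows "\<forall>i\<in>{1..p + c}. rreg (sem n f (guess_rows p c) s) (20 + i) = (\<Sum>j\<in>stored_set n 3 s. M i j)"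
proof -
  let ?P = "\<lambda>xs s'. base K D n M s' \<and> iarr s' 3 = iarr s 3 \<and>
    (\<forall>i\<in>set xs. rreg s' (20 + i) = (\<Sum>j\<in>stored_set n 3 s. M i j))"
  define xs where "xs = [1..<p + c + 1]"
  have "?P xs (sem n f (seqs (map (\<lambda>i. Seq (dot i) (Do (RAdd (20 + i) 11 0))) xs)) s)"
  proof (rule fold_map_invariant[where P = ?P])
    fix ys i zs and s' :: store assume P: "?P ys s'"
    define s1 where "s1 = sem n f (dot i) s'"
    have b1: "base K D n M s1"
      unfolding s1_def using P by (intro base_frame) (auto simp: dot_writes)
    have fr: "rreg s1 (20 + k) = rreg s' (20 + k)" for k
      unfolding s1_def by (intro sem_frame) (simp add: dot_writes)
    have fa: "iarr s1 3 = iarr s 3"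
      unfolding s1_def using P by (subst sem_frame) (auto simp: dot_writes)
    have "stored_set n 3 s' = stored_set n 3 s" using P by (simp add: stored_set_def)
    then have "rreg s1 11 = (\<Sum>j\<in>stored_set n 3 s. M i j)"
      unfolding s1_def using P M by (subst dot_sem) (auto simp: base_def)
    moreover have "base K D n M (sem n f (Do (RAdd (20 + i) 11 0)) s1)"
      using b1 by (intro base_frame) auto
    ultimately show "?P (ys @ [i]) (sem n f (Seq (dot i) (Do (RAdd (20 + i) 11 0))) s')"
      using P b1 fr fa by (simp add: s1_def[symmetric]) (simp add: base_def)
  qed (use b in simp)
  then show ?thesis by (auto simp: guess_rows_def xs_def)
qed

lemma guess_val_sem:
  "rreg (sem n f (guess_val K mm) s) 8
    = f (stored_set n 3 s) * real (\<Sum>i=mm..<mm + 2 * K. ireg s (20 + i)) / K"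
proof -
  define s1 where "s1 = sem n f (seqs [Do (Query 11 3), Do (IConst 5 0)]) s"
  let ?P = "\<lambda>xs s'. rreg s' = rreg s1 \<and> (\<forall>i. ireg s' (20 + i) = ireg s (20 + i)) \<and>
    ireg s' 5 = sum_list (map (\<lambda>i. ireg s (20 + i)) xs)"
  define xs where "xs = [mm..<mm + 2 * K]"
  define s2 where "s2 = sem n f (seqs (map (\<lambda>i. Do (IAdd 5 5 (20 + i))) xs)) s1"
  have "?P xs s2"
    unfolding s2_def by (rule fold_map_invariant[where P = ?P]) (auto simp: s1_def)
  moreover have "sum_list (map (\<lambda>i. ireg s (20 + i)) xs) = (\<Sum>i=mm..<mm + 2 * K. ireg s (20 + i))"
    by (simp only: xs_def interv_sum_list_conv_sum_set_nat set_upt)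
  ultimately have s2: "rreg s2 11 = f (stored_set n 3 s)"
    "ireg s2 5 = (\<Sum>i=mm..<mm + 2 * K. ireg s (20 + i))" by (auto simp: s1_def)
  have "sem n f (guess_val K mm) s = sem n f (seqs [Do (RNat 12 5), Do (RMul 11 11 12),
     Do (IConst 5 K), Do (RNat 12 5), Do (RDiv 8 11 12)]) s2"
    by (simp only: guess_val_def s2_def s1_def xs_def seqs_simps sem.simps)
  then show ?thesis using s2 by simp
qed

lemma restrict_moves_sem:
  assumes b: "base K D n M s"
  shows "\<forall>j\<le>n. iarr (sem n f (restrict_moves p c) s) 4 j \<noteq> 0 \<longleftrightarrow>
    iarr s 1 j = 0 \<and> eligible p c n M (\<lambda>i. rreg s (20 + i)) (1 / D) j"
proof -
  let ?e = "\<lambda>i. rreg s (20 + i)"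
  let ?z = "iarr s 1"
  let ?el = "eligible p c n M ?e (1 / D)"
  let ?C = "\<lambda>s'. base K D n M s' \<and> iarr s' 1 = ?z \<and> (\<forall>i. rreg s' (20 + i) = ?e i)"
  let ?P = "\<lambda>v s'. ?C s' \<and> (\<forall>j<v. iarr s' 4 j \<noteq> 0 \<longleftrightarrow> ?z j = 0 \<and> ?el j)"
  show ?thesis
    unfolding restrict_moves_def
  proof (rule For_rule[where P = ?P and Q = "\<lambda>s'. \<forall>j\<le>n. iarr s' 4 j \<noteq> 0 \<longleftrightarrow> ?z j = 0 \<and> ?el j"])
    show "?P 0 s" using b by simp
    show "\<forall>j\<le>n. iarr (set_ireg 7 (Suc n) s') 4 j \<noteq> 0 \<longleftrightarrow> ?z j = 0 \<and> ?el j" if "?P (Suc n) s'" for s'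
      using that by (auto simp: less_Suc_eq_le)
    fix v s' assume v: "v \<le> n" and P: "?P v s'"
    let ?I = "\<lambda>s''. ?C s'' \<and> ireg s'' 7 = v \<and> iarr s'' 4 = iarr s' 4"
    define s1 where "s1 = sem n f (seqs [Do (IConst 5 1), Do (ILoad 4 1 7),
      If (ILess 3 4) (Do (IConst 5 0)) Nop]) (set_ireg 7 v s')"
    have s1: "?I s1" "ireg s1 5 \<noteq> 0 \<longleftrightarrow> ?z v = 0" using P by (auto simp: s1_def base_def)
    define xs where "xs = [1..<p + 1]"
    define ys where "ys = [p + 1..<p + c + 1]"
    define s2 where "s2 = sem n f (seqs (map ptest xs)) s1"
    define s3 where "s3 = sem n f (seqs (map ctest ys)) s2"
    let ?T = "\<lambda>xs s''. ?I s'' \<and> (ireg s'' 5 \<noteq> 0 \<longleftrightarrow> ireg s1 5 \<noteq> 0 \<and> (\<forall>i\<in>set xs. M i v \<le> 1 / D * (1 - ?e i)))"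
    have s2: "?T xs s2"
      unfolding s2_def
    proof (rule fold_map_invariant[where P = ?T])
      fix ys i zs and s'' :: store assume T: "?T ys s''"
      have "base K D n M (sem n f (ptest i) s'')" using T by (intro base_frame) (auto simp: tests_writes)
      moreover have "iarr (sem n f (ptest i) s'') = iarr s''"
        by (intro ext[of "iarr (sem n f (ptest i) s'')"] sem_frame) (auto simp: tests_writes)
      moreover have "ireg (sem n f (ptest i) s'') 7 = ireg s'' 7"
        by (intro sem_frame) (auto simp: tests_writes)
      moreover have "rreg (sem n f (ptest i) s'') (20 + k) = rreg s'' (20 + k)" for k
        by (intro sem_frame) (auto simp: tests_writes)
      moreover have "ireg (sem n f (ptest i) s'') 5
          = (if M i v \<le> 1 / D * (1 - ?e i) then ireg s'' 5 else 0)"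
        using T by (simp add: ptest_def base_def not_less)
      ultimately show "?T (ys @ [i]) (sem n f (ptest i) s'')" using T by simp
    qed (use s1 in simp)
    let ?U = "\<lambda>xs s''. ?I s'' \<and> (ireg s'' 5 \<noteq> 0 \<longleftrightarrow> ireg s2 5 \<noteq> 0 \<and> (\<forall>i\<in>set xs. M i v \<le> 1 / D \<or> 1 \<le> ?e i))"
    have s3: "?U ys s3"
      unfolding s3_def
    proof (rule fold_map_invariant[where P = ?U])
      fix ys i zs and s'' :: store assume T: "?U ys s''"
      have "base K D n M (sem n f (ctest i) s'')" using T by (intro base_frame) (auto simp: tests_writes)
      moreover have "iarr (sem n f (ctest i) s'') = iarr s''"
        by (intro ext[of "iarr (sem n f (ctest i) s'')"] sem_frame) (auto simp: tests_writes)
      moreover have "ireg (sem n f (ctest i) s'') 7 = ireg s'' 7"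
        by (intro sem_frame) (auto simp: tests_writes)
      moreover have "rreg (sem n f (ctest i) s'') (20 + k) = rreg s'' (20 + k)" for k
        by (intro sem_frame) (auto simp: tests_writes)
      moreover have "ireg (sem n f (ctest i) s'') 5
          = (if M i v \<le> 1 / D \<or> 1 \<le> ?e i then ireg s'' 5 else 0)"
        using T by (simp add: ctest_def base_def not_less)
      ultimately show "?U (ys @ [i]) (sem n f (ctest i) s'')" using T by simp
    qed (use s2 in simp)
    have sets: "set xs = {1..p}" "set ys = {p+1..p+c}" by (auto simp: xs_def ys_def)
    have flag: "ireg s3 5 \<noteq> 0 \<longleftrightarrow> ?z v = 0 \<and> ?el v"
      using s1 s2 s3 by (simp add: eligible_def sets)
    have eq: "sem n f (restrict_move p c) (set_ireg 7 v s') = sem n f (Do (IStore 4 7 5)) s3"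
      by (simp only: restrict_move_def s3_def s2_def s1_def xs_def ys_def seqs_simps sem.simps)
    have "base K D n M (sem n f (Do (IStore 4 7 5)) s3)" using s3 by (intro base_frame) auto
    then show "?P (Suc v) (sem n f (restrict_move p c) (set_ireg 7 v s'))"
      unfolding eq using s3 P flag by (auto elim!: less_SucE)
  qed
qed

lemma prep_sem:
  fixes p c K mm :: nat
  assumes b: "base K D n M s" and K: "2 \<le> K" and M: "\<And>i. M i 0 = 0"
  defines "E \<equiv> {j \<in> {1..n}. \<exists>i<mm. ireg s (20 + i) = j}"
  shows "\<exists>e F z0. search.inv p c K D n M f e
        (f E * real (\<Sum>i=mm..<mm + 2 * K. ireg s (20 + i)) / K) F z0 (sem n f (prep p c K mm) s) z0 \<and>
      (\<forall>j\<le>n. z0 j = (if \<exists>i<mm. ireg s (20 + i) = j then Suc K else 0)) \<and>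
      (\<forall>i\<in>{1..p + c}. e i = (\<Sum>j\<in>E. M i j)) \<and>
      (\<forall>j\<le>n. F j \<noteq> 0 \<longleftrightarrow> z0 j = 0 \<and> eligible p c n M e (1 / D) j)"
proof -
  define V where "V = f E * real (\<Sum>i=mm..<mm + 2 * K. ireg s (20 + i)) / K"
  define s1 where "s1 = sem n f (guess_set K mm) s"
  define s2 where "s2 = sem n f (mark K {}) s1"
  define s3 where "s3 = sem n f (guess_rows p c) s2"
  define s4 where "s4 = sem n f (guess_val K mm) s3"
  define s5 where "s5 = sem n f (restrict_moves p c) s4"
  define s6 where "s6 = sem n f (eval_pot p c K) s5"
  define s7 where "s7 = sem n f (Do (RAdd 13 10 0)) s6"
  have eq: "sem n f (prep p c K mm) s = s7"
    by (simp only: prep_def s7_def s6_def s5_def s4_def s3_def s2_def s1_def seqs_simps sem.simps)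
  define z0 where "z0 = iarr s1 1"
  have z0: "z0 j = (if \<exists>i<mm. ireg s (20 + i) = j then Suc K else 0)" if "j \<le> n" for j
    using guess_set_sem[OF b] that by (simp add: z0_def s1_def)
  have b1: "base K D n M s1"
    unfolding s1_def using b guess_set_writes[of K mm] by (intro base_frame) auto
  have b2: "base K D n M s2"
    unfolding s2_def using b1 mark_writes[of K "{}"] by (intro base_frame) auto
  have b3: "base K D n M s3"
    unfolding s3_def using b2 guess_rows_writes[of p c] by (intro base_frame) auto
  have b4: "base K D n M s4"
    unfolding s4_def using b3 guess_val_writes[of K mm] by (intro base_frame) auto
  have b5: "base K D n M s5"
    unfolding s5_def using b4 restrict_moves_writes[of p c] by (intro base_frame) auto
  have b6: "base K D n M s6"
    unfolding s6_def using b5 eval_writes[of p c K] by (intro base_frame) auto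
  have b7: "base K D n M s7"
    unfolding s7_def using b6 by (intro base_frame) auto
  have z2: "iarr s2 1 = z0" unfolding s2_def z0_def using mark_writes[of K "{}"] by (intro sem_frame) auto
  have z3: "iarr s3 1 = z0" unfolding s3_def z2[symmetric] using guess_rows_writes[of p c] by (intro sem_frame) auto
  have z4: "iarr s4 1 = z0" unfolding s4_def z3[symmetric] using guess_val_writes[of K mm] by (intro sem_frame) auto
  have z5: "iarr s5 1 = z0" unfolding s5_def z4[symmetric] using restrict_moves_writes[of p c] by (intro sem_frame) auto
  have z6: "iarr s6 1 = z0" unfolding s6_def z5[symmetric] using eval_writes[of p c K] by (intro sem_frame) auto
  have z7: "iarr s7 1 = z0" using z6 by (simp add: s7_def)
  have E2: "stored_set n 3 s2 = E"
  proof -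
    have "stored_set n 3 s2 = chosen n K z0 {}"
      unfolding s2_def z0_def using b1 z0 by (intro mark_stored_set) (auto simp: base_def z0_def)
    then show ?thesis using z0 by (auto simp: chosen_def E_def)
  qed
  have "iarr s3 3 = iarr s2 3"
    unfolding s3_def using guess_rows_writes[of p c] by (intro sem_frame) auto
  then have E3: "stored_set n 3 s3 = E" using E2 by (simp add: stored_set_def)
  have e3: "\<forall>i\<in>{1..p + c}. rreg s3 (20 + i) = (\<Sum>j\<in>E. M i j)"
    unfolding s3_def using guess_rows_sem[OF b2 M] E2 by simp
  have g3: "ireg s3 (20 + i) = ireg s (20 + i)" for i
  proof -
    have "ireg s3 (20 + i) = ireg s2 (20 + i)"
      unfolding s3_def using guess_rows_writes[of p c] by (intro sem_frame) auto
    also have "\<dots> = ireg s1 (20 + i)"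
      unfolding s2_def using mark_writes[of K "{}"] by (intro sem_frame) auto
    also have "\<dots> = ireg s (20 + i)"
      unfolding s1_def using guess_set_writes[of K mm] by (intro sem_frame) auto
    finally show ?thesis .
  qed
  have V4: "rreg s4 8 = V" unfolding s4_def guess_val_sem E3 g3 V_def ..
  define e where "e i = rreg s4 (20 + i)" for i
  have e: "\<forall>i\<in>{1..p + c}. e i = (\<Sum>j\<in>E. M i j)"
  proof -
    have "e i = rreg s3 (20 + i)" for i
      unfolding e_def s4_def using guess_val_writes[of K mm] by (intro sem_frame) auto
    then show ?thesis using e3 by simp
  qed
  have r5: "rreg s5 x = rreg s4 x" if "x \<noteq> 11" "x \<noteq> 12" for x
    unfolding s5_def using restrict_moves_writes[of p c] that by (intro sem_frame) auto
  have r6: "rreg s6 x = rreg s4 x" if "x \<notin> {10, 11, 12, 15}" for x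
  proof -
    have "rreg s6 x = rreg s5 x"
      unfolding s6_def using that eval_writes[of p c K] by (intro sem_frame) auto
    then show ?thesis using r5 that by simp
  qed
  have r7: "rreg s7 8 = V" "\<forall>i. rreg s7 (20 + i) = e i"
    using r6 V4 by (auto simp: s7_def e_def)
  define F where "F = iarr s5 4"
  have F: "\<forall>j\<le>n. F j \<noteq> 0 \<longleftrightarrow> z0 j = 0 \<and> eligible p c n M e (1 / D) j"
  proof -
    have "e = (\<lambda>i. rreg s4 (20 + i))" by (rule ext) (simp add: e_def)
    then show ?thesis using restrict_moves_sem[OF b4, of f p c] z4 by (simp add: F_def s5_def)
  qed
  have F7: "iarr s7 4 = F"
  proof -
    have "iarr s6 4 = iarr s5 4" unfolding s6_def using eval_writes[of p c K] by (intro sem_frame) auto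
    then show ?thesis by (simp add: s7_def F_def)
  qed
  have p10: "rreg s6 10 = potential p c K n f M e V z0"
  proof -
    have "(\<lambda>i. rreg s5 (20 + i)) = e" using r5 by (auto simp: e_def)
    moreover have "rreg s5 8 = V" using r5 V4 by simp
    ultimately show ?thesis
      unfolding s6_def using eval_sem[OF b5, of f p c] z5 z0 K M by simp
  qed
  have p13: "rreg s7 13 = potential p c K n f M e V z0"
    using p10 b6 by (simp add: s7_def base_def)
  have "z0 j \<le> Suc K" if "j \<le> n" for j using z0[OF that] by simp
  then have bound: "\<forall>j\<le>n. if F j = 0 then z0 j = z0 j \<and> z0 j \<le> Suc K else z0 j \<le> K"
    using F by auto
  have search: "search K M" using K M by unfold_locales
  have "search.inv p c K D n M f e V F z0 s7 z0"
    unfolding search.inv_def[OF search] using b7 z7 F7 r7 p13 bound by blast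
  then show ?thesis using z0 e F unfolding eq V_def by blast
qed

section \<open>Testing candidates and recording the best one\<close>

definition accepted :: "nat \<Rightarrow> nat \<Rightarrow> nat \<Rightarrow> (nat \<Rightarrow> nat \<Rightarrow> real) \<Rightarrow> nat set \<Rightarrow> bool" where
  "accepted p c K M S \<longleftrightarrow> (\<forall>i\<in>{1..p}. (\<Sum>j\<in>S. M i j) \<le> 1) \<and>
     (\<forall>i\<in>{p+1..p+c}. 1 - 3 / K \<le> (\<Sum>j\<in>S. M i j))"

definition pcheck :: "nat \<Rightarrow> sprog" where
  "pcheck i = Seq (dot i) (If (RLess 1 11) (Do (IConst 5 0)) Nop)"

text \<open>The two occurrences of 5 differ: real register 5 holds the threshold
  \<open>1 - 3 / K\<close>, index register 5 is the flag of the test.\<close>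

definition ccheck :: "nat \<Rightarrow> sprog" where
  "ccheck i = Seq (dot i) (If (RLess 11 5) (Do (IConst 5 0)) Nop)"

definition save_best :: sprog where
  "save_best = Seq (Do (Query 11 3)) (If (RLess 14 11)
     (Seq (Do (RAdd 14 11 0)) (For 6 (Seq (Do (ILoad 4 3 6)) (Do (IStore 0 6 4))))) Nop)"

definition finish :: "nat \<Rightarrow> nat \<Rightarrow> nat \<Rightarrow> sprog" where
  "finish p c K = seqs [mark K {1..K}, Do (IConst 5 1), seqs (map pcheck [1..<p + 1]),
     seqs (map ccheck [p + 1..<p + c + 1]), If (ILess 3 5) save_best Nop]"

lemma check_writes: "writes (pcheck i) = {I 4, I 5, I 6, R 11, R 12}" "writes (ccheck i) = {I 4, I 5, I 6, R 11, R 12}"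
  by (auto simp: pcheck_def ccheck_def dot_writes)

lemma save_best_writes: "writes save_best = {I 4, I 6, IA 0, R 11, R 14}"
  by (auto simp: save_best_def)

lemma finish_writes:
  "writes (finish p c K) \<subseteq> {I 4, I 5, I 6, IA 0, IA 2, IA 3, R 11, R 12, R 14}" (is "_ \<subseteq> ?W")
proof -
  have "writes (mark K {1..K}) \<subseteq> ?W" by (rule order_trans[OF mark_writes]) simp
  moreover have "writes (seqs (map pcheck xs)) \<subseteq> ?W" "writes (seqs (map ccheck xs)) \<subseteq> ?W" for xs
    by (auto simp: writes_seqs check_writes)
  moreover have "writes save_best \<subseteq> ?W" by (simp add: save_best_writes)
  ultimately show ?thesis unfolding finish_def seqs_simps writes.simps by simp
qed

lemma save_best_sem:
  assumes "base K D n M s"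
  shows "if rreg s 14 < f (stored_set n 3 s)
    then rreg (sem n f save_best s) 14 = f (stored_set n 3 s) \<and> stored_set n 0 (sem n f save_best s) = stored_set n 3 s
    else rreg (sem n f save_best s) 14 = rreg s 14 \<and> stored_set n 0 (sem n f save_best s) = stored_set n 0 s"
proof -
  define s1 where "s1 = sem n f (Do (Query 11 3)) s"
  define s2 where "s2 = sem n f (Do (RAdd 14 11 0)) s1"
  let ?L = "For 6 (Seq (Do (ILoad 4 3 6)) (Do (IStore 0 6 4)))"
  have "\<forall>j\<le>n. iarr (sem n f ?L s2) 0 j = iarr s2 3 j"
    by (rule For_rule[where P = "\<lambda>v s'. iarr s' 3 = iarr s2 3 \<and> (\<forall>j<v. iarr s' 0 j = iarr s2 3 j)"
        and Q = "\<lambda>s'. \<forall>j\<le>n. iarr s' 0 j = iarr s2 3 j"])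
      (auto elim!: less_SucE intro: le_imp_less_Suc)
  moreover have "iarr s2 3 = iarr s 3" by (simp add: s1_def s2_def)
  ultimately have "stored_set n 0 (sem n f ?L s2) = stored_set n 3 s" by (auto simp: stored_set_def simp del: sem.simps)
  moreover have "rreg (sem n f ?L s2) 14 = rreg s2 14" by (intro sem_frame) auto
  moreover have "rreg s2 14 = f (stored_set n 3 s)" using assms by (simp add: s1_def s2_def base_def)
  moreover have "sem n f save_best s = (if rreg s 14 < f (stored_set n 3 s) then sem n f ?L s2 else s1)"
    unfolding save_best_def sem.simps(3,4) s2_def s1_def by simp
  moreover have "rreg s1 14 = rreg s 14" "stored_set n 0 s1 = stored_set n 0 s"
    by (simp_all add: s1_def stored_set_def)
  ultimately show ?thesis by simp
qed

lemma finish_sem: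
  fixes p c K :: nat and f :: "nat set \<Rightarrow> real"
  assumes b: "base K D n M s" and z: "\<forall>j\<le>n. iarr s 1 j \<le> Suc K" and M: "\<And>i. M i 0 = 0"
  defines "S \<equiv> chosen n K (iarr s 1) {1..K}"
  defines "s' \<equiv> sem n f (finish p c K) s"
  shows "if accepted p c K M S \<and> rreg s 14 < f S
    then rreg s' 14 = f S \<and> stored_set n 0 s' = S
    else rreg s' 14 = rreg s 14 \<and> stored_set n 0 s' = stored_set n 0 s"
proof -
  define s1 where "s1 = sem n f (Do (IConst 5 1)) (sem n f (mark K {1..K}) s)"
  define xs where "xs = [1..<p + 1]"
  define ys where "ys = [p + 1..<p + c + 1]"
  define s2 where "s2 = sem n f (seqs (map pcheck xs)) s1"
  define s3 where "s3 = sem n f (seqs (map ccheck ys)) s2"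
  let ?I = "\<lambda>t. base K D n M t \<and> iarr t 3 = iarr s1 3 \<and> iarr t 0 = iarr s 0 \<and> rreg t 14 = rreg s 14"
  have s1: "?I s1" "ireg s1 5 \<noteq> 0"
  proof -
    have "base K D n M s1"
      unfolding s1_def using b mark_writes[of K "{1..K}"] by (intro base_frame) auto
    moreover have "iarr s1 0 = iarr s 0" "rreg s1 14 = rreg s 14"
      using mark_writes[of K "{1..K}"] by (auto simp: s1_def intro!: sem_frame)
    ultimately show "?I s1" "ireg s1 5 \<noteq> 0" by (auto simp: s1_def)
  qed
  have S1: "stored_set n 3 s1 = S"
    using mark_stored_set[of s n K f "{1..K}"] b z by (simp add: s1_def S_def stored_set_def base_def)
  have St: "stored_set n 3 t = S" if "?I t" for t using that S1 by (simp add: stored_set_def)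
  let ?T = "\<lambda>xs t. ?I t \<and> (ireg t 5 \<noteq> 0 \<longleftrightarrow> (\<forall>i\<in>set xs. (\<Sum>j\<in>S. M i j) \<le> 1))"
  have dot: "rreg (sem n f (dot i) t) 11 = (\<Sum>j\<in>S. M i j) \<and> ireg (sem n f (dot i) t) 5 = ireg t 5 \<and>
      (\<forall>r. r \<noteq> 11 \<longrightarrow> r \<noteq> 12 \<longrightarrow> rreg (sem n f (dot i) t) r = rreg t r)" if "?I t" for t i
  proof -
    have "rreg (sem n f (dot i) t) 11 = (\<Sum>j\<in>S. M i j)"
      using that M St[OF that] by (subst dot_sem) (auto simp: base_def)
    then show ?thesis by (auto simp: dot_writes intro!: sem_frame)
  qed
  have step: "?I (sem n f h t)" if "?I t" "writes h = {I 4, I 5, I 6, R 11, R 12}" for t h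
  proof (intro conjI)
    have "writes h \<inter> (I ` {..3} \<union> R ` {..7} \<union> range RA) = {}" unfolding that(2) by auto
    then show "base K D n M (sem n f h t)" by (rule base_frame[OF conjunct1[OF that(1)]])
    have "IA 3 \<notin> writes h" "IA 0 \<notin> writes h" "R 14 \<notin> writes h" unfolding that(2) by auto
    show "iarr (sem n f h t) 3 = iarr s1 3" "iarr (sem n f h t) 0 = iarr s 0" "rreg (sem n f h t) 14 = rreg s 14"
      using that(1) by (simp_all only: sem_frame \<open>IA 3 \<notin> writes h\<close> \<open>IA 0 \<notin> writes h\<close> \<open>R 14 \<notin> writes h\<close> not_False_eq_True)
  qed
  have s2: "?T xs s2"
    unfolding s2_def
  proof (rule fold_map_invariant[where P = ?T])
    fix ys i zs and t :: store assume T: "?T ys t"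
    then have "?I (sem n f (pcheck i) t)" using step check_writes by auto
    moreover have "ireg (sem n f (pcheck i) t) 5 = (if (\<Sum>j\<in>S. M i j) \<le> 1 then ireg t 5 else 0)"
      using T dot[of t i] by (simp add: pcheck_def base_def not_less)
    ultimately show "?T (ys @ [i]) (sem n f (pcheck i) t)" using T by auto
  qed (use s1 in simp)
  let ?U = "\<lambda>xs t. ?I t \<and> (ireg t 5 \<noteq> 0 \<longleftrightarrow> ireg s2 5 \<noteq> 0 \<and> (\<forall>i\<in>set xs. 1 - 3 / K \<le> (\<Sum>j\<in>S. M i j)))"
  have s3: "?U ys s3"
    unfolding s3_def
  proof (rule fold_map_invariant[where P = ?U])
    fix ys i zs and t :: store assume T: "?U ys t"
    then have "?I (sem n f (ccheck i) t)" using step check_writes by auto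
    moreover have "ireg (sem n f (ccheck i) t) 5 = (if 1 - 3 / K \<le> (\<Sum>j\<in>S. M i j) then ireg t 5 else 0)"
      using T dot[of t i] by (simp add: ccheck_def base_def not_less)
    ultimately show "?U (ys @ [i]) (sem n f (ccheck i) t)" using T by auto
  qed (use s2 in simp)
  have flag: "ireg s3 5 \<noteq> 0 \<longleftrightarrow> accepted p c K M S"
  proof -
    have "set xs = {1..p}" "set ys = {p+1..p+c}" by (auto simp: xs_def ys_def)
    then show ?thesis using s2 s3 by (simp add: accepted_def)
  qed
  have b3: "base K D n M s3" "stored_set n 3 s3 = S" "rreg s3 14 = rreg s 14"
    "stored_set n 0 s3 = stored_set n 0 s"
    using s3 St[of s3] by (auto simp: stored_set_def)
  have "s' = sem n f (If (ILess 3 5) save_best Nop) s3"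
    unfolding s'_def by (simp only: finish_def s3_def s2_def s1_def xs_def ys_def seqs_simps sem.simps)
  then have "s' = (if accepted p c K M S then sem n f save_best s3 else s3)"
    using flag b3(1) by (simp add: base_def)
  then show ?thesis using save_best_sem[OF b3(1), of f] b3 by (auto split: if_splits)
qed

definition body :: "nat \<Rightarrow> nat \<Rightarrow> nat \<Rightarrow> nat \<Rightarrow> nat list \<Rightarrow> sprog" where
  "body p c K mm cs = seqs [prep p c K mm, nest cs (sweep p c K), finish p c K]"

text \<open>The value \<open>-1\<close> means that nothing has been recorded; it lies below all
  values of \<open>f\<close>, so the first accepted candidate is always stored.\<close>

definition best_inv :: "nat \<Rightarrow> nat \<Rightarrow> nat \<Rightarrow> nat \<Rightarrow> nat \<Rightarrow> (nat \<Rightarrow> nat \<Rightarrow> real) \<Rightarrow> (nat set \<Rightarrow> real) \<Rightarrow> store \<Rightarrow> bool" where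
  "best_inv p c K D n M f s \<longleftrightarrow> base K D n M s \<and> (rreg s 14 = -1 \<or>
     (rreg s 14 = f (stored_set n 0 s) \<and> accepted p c K M (stored_set n 0 s)))"

lemma body_writes:
  "writes (body p c K mm cs) \<subseteq> {I 4, I 5, I 6, I 7, I 8} \<union> I ` set cs \<union> range IA \<union> R ` {8..}"
    (is "_ \<subseteq> ?W")
proof -
  have "writes (prep p c K mm) \<subseteq> ?W" by (rule order_trans[OF prep_writes]) auto
  moreover have "writes (sweep p c K) \<subseteq> ?W" by (rule order_trans[OF sweep_writes]) auto
  moreover have "writes (finish p c K) \<subseteq> ?W" by (rule order_trans[OF finish_writes]) auto
  ultimately show ?thesis unfolding body_def seqs_simps writes.simps writes_nest by blast
qed

text \<open>Holds for every content of the guess registers: a wrong guess keeps the record valid and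
  never lowers it. The last claim collects what is needed to show that the right guess
  succeeds.\<close>

lemma body_sem:
  fixes p c K mm :: nat and f :: "nat set \<Rightarrow> real"
  assumes inv: "best_inv p c K D n M f s" and K: "2 \<le> K" and M: "\<And>i. M i 0 = 0"
    and cs: "\<forall>x\<in>set cs. 20 \<le> x"
  defines "E \<equiv> {j \<in> {1..n}. \<exists>i<mm. ireg s (20 + i) = j}"
  defines "V \<equiv> f E * real (\<Sum>i=mm..<mm + 2 * K. ireg s (20 + i)) / K"
  defines "s' \<equiv> sem n f (body p c K mm cs) s"
  shows "best_inv p c K D n M f s'" and "rreg s 14 \<le> rreg s' 14"
    and "\<exists>e F z0 z. (\<forall>j\<le>n. z0 j = (if \<exists>i<mm. ireg s (20 + i) = j then Suc K else 0)) \<and>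
      (\<forall>i\<in>{1..p + c}. e i = (\<Sum>j\<in>E. M i j)) \<and>
      (\<forall>j\<le>n. F j \<noteq> 0 \<longleftrightarrow> z0 j = 0 \<and> eligible p c n M e (1 / D) j) \<and>
      (\<forall>j\<le>n. if F j = 0 then z j = z0 j else z j \<le> K) \<and>
      (search.locopt p c K n M f e V F z \<or>
        potential p c K n f M e V z0 + real ((n + 1) ^ length cs) * (1 / (2 * real K) / real (n + 1))
          \<le> potential p c K n f M e V z) \<and>
      (accepted p c K M (chosen n K z {1..K}) \<longrightarrow> f (chosen n K z {1..K}) \<le> rreg s' 14)" (is ?ex)
proof -
  have b: "base K D n M s" using inv by (simp add: best_inv_def)
  define s1 where "s1 = sem n f (prep p c K mm) s"
  define s2 where "s2 = sem n f (nest cs (sweep p c K)) s1"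
  have s': "s' = sem n f (finish p c K) s2"
    unfolding s'_def by (simp only: body_def s2_def s1_def seqs_simps sem.simps)
  have search: "search K M" using K M by unfold_locales
  note prep = prep_sem[OF b K M, where p = p and c = c and mm = mm and f = f, folded E_def, folded V_def, folded s1_def]
  obtain e F z0 where i1: "search.inv p c K D n M f e V F z0 s1 z0"
    and z0: "\<forall>j\<le>n. z0 j = (if \<exists>i<mm. ireg s (20 + i) = j then Suc K else 0)"
    and e: "\<forall>i\<in>{1..p + c}. e i = (\<Sum>j\<in>E. M i j)"
    and F: "\<forall>j\<le>n. F j \<noteq> 0 \<longleftrightarrow> z0 j = 0 \<and> eligible p c n M e (1 / D) j"
    using prep by (elim exE conjE)
  obtain z where i2: "search.inv p c K D n M f e V F z0 s2 z"
    and opt: "search.locopt p c K n M f e V F z \<or> potential p c K n f M e V z0 +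
       real ((n + 1) ^ length cs) * (1 / (2 * real K) / real (n + 1)) \<le> potential p c K n f M e V z"
    using search.local_search_sem[OF search i1 bspec[OF cs]] unfolding s2_def by blast
  have b2: "base K D n M s2" and z: "iarr s2 1 = z" "\<forall>j\<le>n. if F j = 0 then z j = z0 j else z j \<le> K"
    using i2 unfolding search.inv_def[OF search] by (auto split: if_splits)
  have zb: "\<forall>j\<le>n. iarr s2 1 j \<le> Suc K" using search.inv_bounded[OF search i2] z by simp
  have "rreg s1 14 = rreg s 14" "iarr s1 0 = iarr s 0"
    unfolding s1_def using prep_writes[of p c K mm] by (auto intro!: sem_frame)
  moreover have "rreg s2 14 = rreg s1 14" "iarr s2 0 = iarr s1 0"
    unfolding s2_def using sweep_writes[of p c K] by (auto simp: writes_nest intro!: sem_frame)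
  ultimately have best2: "rreg s2 14 = rreg s 14" "stored_set n 0 s2 = stored_set n 0 s"
    by (auto simp: stored_set_def)
  note fin = finish_sem[OF b2 zb M, where p = p and c = c and f = f, folded s', unfolded z(1) best2]
  have "base K D n M s'"
    unfolding s' using b2 finish_writes[of p c K] by (intro base_frame) auto
  then show "best_inv p c K D n M f s'"
    using fin inv by (auto simp: best_inv_def split: if_splits)
  show "rreg s 14 \<le> rreg s' 14" using fin by (auto split: if_splits)
  have "accepted p c K M (chosen n K z {1..K}) \<longrightarrow> f (chosen n K z {1..K}) \<le> rreg s' 14"
    using fin by (auto split: if_splits)
  with z0 e F z(2) opt show ?ex by blast
qed

section \<open>Reaching one prescribed guess in the enumeration\<close>

lemma nest_preserve:
  assumes "\<And>s. P s \<Longrightarrow> P (sem n f b s)" and "\<And>s x v. x \<in> set xs \<Longrightarrow> P s \<Longrightarrow> P (set_ireg x v s)" and "P s"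
  shows "P (sem n f (nest xs b) s)"
proof -
  have "(\<lambda>_. P) (0 + (n + 1) ^ length xs) (sem n f (nest xs b) s)"
    by (rule nest_count[where P = "\<lambda>_ :: nat. P"]) (use assms in auto)
  then show ?thesis .
qed

text \<open>\<open>I'\<close> is an invariant and \<open>R'\<close> a goal that is never lost again; some iteration of the nested loops
  has exactly the register values \<open>g\<close> and reaches it.\<close>

lemma nest_hit:
  assumes Ib: "\<And>s. I' s \<Longrightarrow> I' (sem n f b s)" and Rb: "\<And>s. R' s \<Longrightarrow> R' (sem n f b s)"
    and Iv: "\<And>s x v. x \<in> X \<Longrightarrow> I' s \<Longrightarrow> I' (set_ireg x v s)"
    and Rv: "\<And>s x v. x \<in> X \<Longrightarrow> R' s \<Longrightarrow> R' (set_ireg x v s)"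
    and hit: "\<And>s. I' s \<Longrightarrow> (\<And>x. x \<in> X \<Longrightarrow> ireg s x = g x) \<Longrightarrow> R' (sem n f b s)"
    and w: "\<And>x. x \<in> X \<Longrightarrow> I x \<notin> writes b" and g: "\<And>x. x \<in> X \<Longrightarrow> g x \<le> n"
  shows "distinct xs \<Longrightarrow> set xs \<subseteq> X \<Longrightarrow> I' s \<Longrightarrow> (\<And>x. x \<in> X - set xs \<Longrightarrow> ireg s x = g x)
    \<Longrightarrow> R' (sem n f (nest xs b) s)"
proof (induction xs arbitrary: s)
  case Nil
  then show ?case using hit by simp
next
  case (Cons x xs)
  let ?P = "\<lambda>v s'. I' s' \<and> (\<forall>y\<in>X - set (x # xs). ireg s' y = g y) \<and> (g x < v \<longrightarrow> R' s')"
  have xX: "x \<in> X" "g x \<le> n" using Cons.prems g by auto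
  have nI: "I' (sem n f (nest xs b) s')" if "I' s'" for s'
    by (rule nest_preserve[OF Ib _ that]) (use Iv Cons.prems in auto)
  have nR: "R' (sem n f (nest xs b) s')" if "R' s'" for s'
    by (rule nest_preserve[OF Rb _ that]) (use Rv Cons.prems in auto)
  have "?P (Suc n) (fold (\<lambda>v s. sem n f (nest xs b) (set_ireg x v s)) [0..<Suc n] s)"
  proof (rule fold_invariant_upt[where P = ?P])
    show "?P 0 s" using Cons.prems by simp
    fix v s' assume P: "?P v s'"
    let ?s = "set_ireg x v s'"
    have I1: "I' ?s" using P xX Iv by simp
    have regs: "\<forall>y\<in>X - set (x # xs). ireg (sem n f (nest xs b) ?s) y = g y"
    proof
      fix y assume y: "y \<in> X - set (x # xs)"
      then have "ireg (sem n f (nest xs b) ?s) y = ireg ?s y"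
        using w by (intro sem_frame) (auto simp: writes_nest)
      then show "ireg (sem n f (nest xs b) ?s) y = g y" using P y by auto
    qed
    have "R' (sem n f (nest xs b) ?s)" if "g x < Suc v"
    proof (cases "v = g x")
      case True
      show ?thesis
        by (rule Cons.IH) (use Cons.prems I1 P True in auto)
    next
      case False
      then have "R' ?s" using that P xX Rv by simp
      then show ?thesis by (rule nR)
    qed
    then show "?P (Suc v) (sem n f (nest xs b) ?s)" using nI[OF I1] regs by blast
  qed
  then have "R' (fold (\<lambda>v s. sem n f (nest xs b) (set_ireg x v s)) [0..<Suc n] s)"
    using xX by auto
  then show ?case unfolding nest.simps sem.simps using Rv[OF xX(1)] by blast
qed

text \<open>Smallness \<open>1 / dpar\<close> makes the second-order errors of all penalties,
  weighted as in the potential, at most \<open>1 / (2 * K)\<close>. The threshold of the search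
  accounts for the other half of the error \<open>1 / K\<close>.\<close>

definition dpar :: "nat \<Rightarrow> nat \<Rightarrow> nat \<Rightarrow> nat" where "dpar p c K = 8 * K ^ 3 * (3 * p + 5 * c + 1)"
text \<open>One greedy prefix for \<open>f\<close> and one for each of the \<open>c\<close> covering
  rows; the prefix length is at least \<open>p * D * K\<close> and at least \<open>D\<close>, as
  \<open>good_guess\<close> requires.\<close>

definition gpar :: "nat \<Rightarrow> nat \<Rightarrow> nat \<Rightarrow> nat" where "gpar p c K = (c + 1) * ((p + 1) * dpar p c K * K)"
text \<open>The range of the potential times \<open>2 * K\<close>, plus 1 to compensate the factor
  \<open>n + 1\<close> in the denominator of the threshold.\<close>

definition spar :: "nat \<Rightarrow> nat \<Rightarrow> nat" where "spar c K = 2 * K * (3 * K + 4 * K\<^sup>2 * c) + 1"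

text \<open>Surplus positions of the enumeration get 0, which the program ignores.\<close>

lemma enumerate_subset:
  fixes E :: "nat set"
  assumes "finite E" "card E \<le> m"
  shows "\<exists>g. (\<forall>i. g i \<in> insert 0 E) \<and> E \<subseteq> g ` {..<m}"
proof -
  obtain h where h: "bij_betw h {0..<card E} E" using ex_bij_betw_nat_finite[OF assms(1)] by blast
  define g where "g i = (if i < card E then h i else 0)" for i
  have "E = h ` {0..<card E}" using h by (simp add: bij_betw_imp_surj_on)
  also have "\<dots> = g ` {0..<card E}" by (intro image_cong) (auto simp: g_def)
  also have "\<dots> \<subseteq> g ` {..<m}" using assms(2) by (intro image_mono) auto
  finally have "E \<subseteq> g ` {..<m}" .
  moreover have "g i \<in> insert 0 E" for i using h by (auto simp: g_def bij_betw_def)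
  ultimately show ?thesis by blast
qed

lemma bounded_sum: "k \<le> l * n \<Longrightarrow> \<exists>g. (\<forall>i. g i \<le> n) \<and> (\<Sum>i<l. g i) = (k::nat)"
proof (induction l arbitrary: k)
  case 0
  then show ?case by (intro exI[of _ "\<lambda>_. 0"]) auto
next
  case (Suc l)
  have "k - min k n \<le> l * n" using Suc.prems by (auto simp: min_def le_diff_conv algebra_simps)
  then obtain g where g: "\<forall>i. g i \<le> n" "(\<Sum>i<l. g i) = k - min k n" using Suc.IH by blast
  show ?case
    using g by (intro exI[of _ "g(l := min k n)"]) (auto simp: min_def)
qed

lemma eligible_cong:
  "(\<And>i. i \<in> {1..p + c} \<Longrightarrow> e i = e' i) \<Longrightarrow> eligible p c n M e d j = eligible p c n M e' d j"
  unfolding eligible_def by (intro arg_cong2[where f = "(\<and>)"] ball_cong) auto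

text \<open>The counters have to spell out the set \<open>E\<close> of \<open>good_guess\<close> and
  the multiplier of \<open>guess_value\<close>. The search then ends in a local optimum toward
  \<open>Q\<close>, which passes the test, so the record is at least as good.\<close>

lemma right_guess:
  fixes n p c K :: nat and T :: "nat set" and f :: "nat set \<Rightarrow> real" and M :: "nat \<Rightarrow> nat \<Rightarrow> real"
  assumes n: "1 \<le> n"
    and f: "submodular_on {1..n} f" "mono_on (Pow {1..n}) f" "\<And>S. S \<subseteq> {1..n} \<Longrightarrow> 0 \<le> f S"
    and M: "\<And>i j. i \<in> {1..p+c} \<Longrightarrow> j \<in> {1..n} \<Longrightarrow> 0 \<le> M i j" and M0: "\<And>i. M i 0 = 0"
    and T: "T \<subseteq> {1..n}" "\<And>i. i \<in> {1..p} \<Longrightarrow> (\<Sum>j\<in>T. M i j) \<le> 1"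
      "\<And>i. i \<in> {p+1..p+c} \<Longrightarrow> 1 \<le> (\<Sum>j\<in>T. M i j)"
    and K: "16 \<le> K" and cs: "\<forall>x\<in>set cs. 20 \<le> x" "length cs = spar c K"
  shows "\<exists>g. (\<forall>x. g x \<le> n) \<and> (\<forall>s. best_inv p c K (dpar p c K) n M f s \<longrightarrow>
    (\<forall>x\<in>{20..<20 + gpar p c K + 2 * K}. ireg s x = g x) \<longrightarrow>
    (1 - 1 / exp 1 - 5 / K) * f T \<le> rreg (sem n f (body p c K (gpar p c K) cs) s) 14)"
proof -
  let ?D = "dpar p c K"
  let ?m = "(p + 1) * ?D * K"
  let ?mm = "gpar p c K"
  have K0: "0 < K" and K2: "2 \<le> K" using K by auto
  have D: "0 < ?D" using K0 by (simp add: dpar_def)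
  have m: "p * ?D * K \<le> ?m" "?D \<le> ?m"
  proof -
    show "p * ?D * K \<le> ?m" by simp
    have "?D * 1 \<le> ?D * ((p + 1) * K)" using K0 by (intro mult_left_mono) auto
    then show "?D \<le> ?m" by (simp only: mult.commute mult.left_commute mult_1_right)
  qed
  have "\<exists>E Q. E \<subseteq> T \<and> card E \<le> (c + 1) * ?m \<and> f T \<le> (n + 1) * f E \<and>
    Q \<subseteq> {j \<in> {1..n} - E. eligible p c n M (\<lambda>i. \<Sum>j\<in>E. M i j) (1 / ?D) j} \<and>
    (\<forall>i\<in>{1..p}. (\<Sum>j\<in>E. M i j) \<le> 1 \<and> (\<Sum>j\<in>Q. M i j) \<le> 1 - (\<Sum>j\<in>E. M i j)) \<and>
    (\<forall>i\<in>{p+1..p+c}. 1 - 1 / K \<le> (\<Sum>j\<in>E. M i j) + (\<Sum>j\<in>Q. M i j)) \<and>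
    (1 - 1 / K) * f T \<le> f (Q \<union> E)"
    by (rule good_guess; fact f M T K0 D m)
  then obtain E Q where ET: "E \<subseteq> T" and cE: "card E \<le> (c + 1) * ?m" and fT: "f T \<le> (n + 1) * f E"
    and Q: "Q \<subseteq> {j \<in> {1..n} - E. eligible p c n M (\<lambda>i. \<Sum>j\<in>E. M i j) (1 / ?D) j}"
    and QP: "\<forall>i\<in>{1..p}. (\<Sum>j\<in>E. M i j) \<le> 1 \<and> (\<Sum>j\<in>Q. M i j) \<le> 1 - (\<Sum>j\<in>E. M i j)"
    and QC: "\<forall>i\<in>{p+1..p+c}. 1 - 1 / K \<le> (\<Sum>j\<in>E. M i j) + (\<Sum>j\<in>Q. M i j)"
    and fQ: "(1 - 1 / K) * f T \<le> f (Q \<union> E)"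
    by (elim exE conjE)
  have En: "E \<subseteq> {1..n}" using ET T(1) by auto
  have fE: "0 \<le> f E" "f E \<le> f T" using f(3)[OF En] ET T(1) by (auto intro!: mono_onD[OF f(2)])
  obtain k where k: "k \<le> 2 * K * n" and V: "f E * k / K \<le> f T" "(1 - 1 / K) * f T \<le> f E * k / K"
    using guess_value[OF fE fT n K0] by blast
  obtain g1 where g1: "\<forall>i. g1 i \<in> insert 0 E" "E \<subseteq> g1 ` {..<?mm}"
    using enumerate_subset[of E ?mm] cE En finite_subset[of E "{1..n}"] by (auto simp: gpar_def)
  obtain g2 where g2: "\<forall>i. g2 i \<le> n" "(\<Sum>i<2 * K. g2 i) = k"
    using bounded_sum[OF k] by blast
  define g where "g x = (if x < 20 + ?mm then g1 (x - 20) else g2 (x - 20 - ?mm))" for x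
  have gn: "g x \<le> n" for x
  proof -
    have "g1 i \<le> n" for i using g1(1) En by (metis atLeastAtMost_iff insertE subsetD zero_le)
    then show ?thesis using g2(1) by (simp add: g_def)
  qed
  have "(1 - 1 / exp 1 - 5 / K) * f T \<le> rreg (sem n f (body p c K ?mm cs) s) 14"
    if inv: "best_inv p c K ?D n M f s" and regs: "\<forall>x\<in>{20..<20 + ?mm + 2 * K}. ireg s x = g x" for s
  proof -
    have r1: "ireg s (20 + i) = g1 i" if "i < ?mm" for i using regs that by (simp add: g_def)
    have Es: "{j \<in> {1..n}. \<exists>i<?mm. ireg s (20 + i) = j} = E" (is "?Es = E")
    proof
      show "?Es \<subseteq> E" using r1 g1(1) by auto (metis insertE not_less_eq_eq zero_le)
      show "E \<subseteq> ?Es"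
      proof
        fix j assume j: "j \<in> E"
        then obtain i where "i < ?mm" "g1 i = j" using g1(2) by auto
        then show "j \<in> ?Es" using r1[of i] j En by auto
      qed
    qed
    have zE: "(\<exists>i<?mm. ireg s (20 + i) = j) \<longleftrightarrow> j \<in> E" if "j \<in> {1..n}" for j using Es that by blast
    have "(\<Sum>i=?mm..<?mm + 2 * K. ireg s (20 + i)) = (\<Sum>i=?mm..<?mm + 2 * K. g2 (i - ?mm))"
      using regs by (intro sum.cong) (auto simp: g_def)
    also have "\<dots> = (\<Sum>i<2 * K. g2 i)"
      by (rule sum.reindex_bij_witness[where i = "\<lambda>i. i + ?mm" and j = "\<lambda>i. i - ?mm"]) auto
    finally have sk: "(\<Sum>i=?mm..<?mm + 2 * K. ireg s (20 + i)) = k" using g2 by simp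
    define V where "V = f E * k / K"
    have V0: "0 \<le> V" using fE by (simp add: V_def)
    obtain e F z0 z where z0: "\<forall>j\<le>n. z0 j = (if \<exists>i<?mm. ireg s (20 + i) = j then Suc K else 0)"
      and e: "\<forall>i\<in>{1..p + c}. e i = (\<Sum>j\<in>E. M i j)"
      and F: "\<forall>j\<le>n. F j \<noteq> 0 \<longleftrightarrow> z0 j = 0 \<and> eligible p c n M e (1 / ?D) j"
      and z: "\<forall>j\<le>n. if F j = 0 then z j = z0 j else z j \<le> K"
      and opt: "search.locopt p c K n M f e V F z \<or>
        potential p c K n f M e V z0 + real ((n + 1) ^ length cs) * (1 / (2 * real K) / real (n + 1))
          \<le> potential p c K n f M e V z"
      and out: "accepted p c K M (chosen n K z {1..K}) \<longrightarrow>
        f (chosen n K z {1..K}) \<le> rreg (sem n f (body p c K ?mm cs) s) 14"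
      using body_sem(3)[OF inv K2 M0 cs(1), where mm = ?mm] unfolding Es sk V_def[symmetric]
      by (elim exE conjE)
    define N where "N = {j \<in> {1..n}. F j \<noteq> 0}"
    have z0E: "z0 j = (if j \<in> E then Suc K else 0)" if "j \<in> {1..n}" for j using z0 zE[OF that] that by auto
    have N: "N = {j \<in> {1..n} - E. eligible p c n M (\<lambda>i. \<Sum>j\<in>E. M i j) (1 / ?D) j}"
    proof -
      have "eligible p c n M e (1 / ?D) j = eligible p c n M (\<lambda>i. \<Sum>j\<in>E. M i j) (1 / ?D) j" for j
        by (rule eligible_cong) (use e in auto)
      then show ?thesis using F z0E by (auto simp: N_def)
    qed
    have search: "search K M" using K2 M0 by unfold_locales
    have "search.locopt p c K n M f e V F z"
    proof (rule ccontr)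
      assume "\<not> search.locopt p c K n M f e V F z"
      then have le: "potential p c K n f M e V z0
          + real ((n + 1) ^ length cs) * (1 / (2 * real K) / real (n + 1)) \<le> potential p c K n f M e V z"
        using opt by simp
      have "potential p c K n f M e V z \<le> 3 * K" by (rule potential_le[OF K2])
      moreover have "- (4 * (real K)\<^sup>2 * c) \<le> potential p c K n f M e V z0"
      proof (rule potential_ge[OF K2 f(3) V0])
        show "chosen n K z0 {1..K} = E" using z0E En by (auto simp: chosen_def split: if_splits)
        show "(\<Sum>j\<in>E. M i j) = e i" if "i \<in> {1..p}" for i using e that by auto
        show "0 \<le> (\<Sum>j\<in>E. M i j)" if "i \<in> {p+1..p+c}" for i
          using M[of i] that En by (intro sum_nonneg) auto
      qed auto
      \<comment> \<open>Were no local optimum reached, the gains of all sweeps would exceed the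
        whole range of the potential.\<close>
      moreover have "3 * K + 4 * (real K)\<^sup>2 * c < real ((n + 1) ^ length cs) * (1 / (2 * real K) / real (n + 1))"
      proof -
        let ?X = "2 * K * (3 * K + 4 * K\<^sup>2 * c)"
        \<comment> \<open>An exponential bound suffices, because \<open>n \<ge> 1\<close> allows
          replacing 2 by \<open>n + 1\<close>.\<close>
        have "?X < 2 ^ ?X" by (rule less_exp)
        also have "(2::nat) ^ ?X \<le> (n + 1) ^ ?X" using n by (intro power_mono) auto
        finally have "real ?X < real ((n + 1) ^ ?X)" by (simp only: of_nat_less_iff)
        moreover define P where "P = real ((n + 1) ^ ?X)"
        moreover have "real ?X = (3 * K + 4 * (real K)\<^sup>2 * c) * (2 * real K)" by simp
        ultimately have "(3 * K + 4 * (real K)\<^sup>2 * c) * (2 * real K) < P" by (simp only:)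
        then have "3 * K + 4 * (real K)\<^sup>2 * c < P / (2 * real K)"
          using K0 by (subst pos_less_divide_eq) auto
        also have "\<dots> = P * real (n + 1) * (1 / (2 * real K) / real (n + 1))" by simp
        also have "P * real (n + 1) = real ((n + 1) ^ length cs)"
          unfolding P_def cs(2) spar_def by (simp only: of_nat_mult power_add power_one_right)
        finally show ?thesis .
      qed
      ultimately show False using le by linarith
    qed
    then have lo: "potential p c K n f M e V (z(j := k)) \<le> potential p c K n f M e V z + 1 / (2 * real K) / real (n + 1)"
      if "j \<in> N" "k \<le> K" for j k
      using that by (simp add: search.locopt_def[OF search] N_def)
    define S where "S = chosen n K z {1..K}"
    have NE: "E \<union> N \<subseteq> {1..n}" "E \<inter> N = {}" using N En by auto
    have QN: "Q \<subseteq> N" using Q N by simp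
    have elig: "eligible p c n M e (1 / ?D) j" if "j \<in> N" for j using that F by (auto simp: N_def)
    have zz: "z j = Suc K" if "j \<in> E" for j
    proof -
      have "j \<in> {1..n}" "j \<notin> N" using that En NE by auto
      then show ?thesis using z z0E[of j] that by (auto simp: N_def)
    qed
    have zN: "z j \<le> K" if "j \<in> N" for j using z that by (auto simp: N_def)
    have z00: "z j = 0" if "j \<in> {1..n} - E - N" for j
      using z z0E[of j] that by (auto simp: N_def)
    have err: "n * (1 / (2 * real K) / real (n + 1)) + 4 * K\<^sup>2 * (1 / ?D) * (3 * p + 5 * c) \<le> 1 / real K"
    proof -
      have "n * (1 / (2 * real K) / real (n + 1)) = real n / real (n + 1) * (1 / (2 * real K))" by simp
      also have "\<dots> \<le> 1 * (1 / (2 * real K))" by (intro mult_right_mono) auto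
      finally have 1: "n * (1 / (2 * real K) / real (n + 1)) \<le> 1 / (2 * real K)" by simp
      have "4 * K\<^sup>2 * (1 / ?D) * (3 * p + 5 * c) = real (3 * p + 5 * c) / real (3 * p + 5 * c + 1) * (1 / (2 * real K))"
      proof -
        have "4 * k\<^sup>2 * (1 / (8 * k ^ 3 * B)) * A = A / B * (1 / (2 * k))" if "k \<noteq> 0" "B \<noteq> 0"
          for k A B :: real
          using that by (simp add: field_simps power2_eq_square power3_eq_cube)
        from this[of "real K" "real (3 * p + 5 * c + 1)" "real (3 * p + 5 * c)"] show ?thesis
          unfolding dpar_def using K0 by (simp only: of_nat_mult of_nat_power of_nat_numeral)
      qed
      also have "\<dots> \<le> 1 * (1 / (2 * real K))" by (intro mult_right_mono) auto
      finally show ?thesis using 1 by simp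
    qed
    have D1: "0 < 1 / real ?D" "1 / real ?D \<le> 1" using D by auto
    have P1: "e i \<le> 1" "(\<Sum>j\<in>Q. M i j) \<le> 1 - e i" if "i \<in> {1..p}" for i using QP e that by auto
    have P2: "1 - 1 / K \<le> e i + (\<Sum>j\<in>Q. M i j)" if "i \<in> {p+1..p+c}" for i using QC e that by auto
    have P3: "M i j \<le> 1 / ?D * (1 - e i)" if "i \<in> {1..p}" "j \<in> N" for i j
      using elig[OF that(2)] that(1) unfolding eligible_def by blast
    have P4: "M i j \<le> 1 / ?D \<or> 1 \<le> e i" if "i \<in> {p+1..p+c}" "j \<in> N" for i j
      using elig[OF that(2)] that(1) unfolding eligible_def by blast
    have P0: "e i = (\<Sum>j\<in>E. M i j)" if "i \<in> {1..p+c}" for i using e that by blast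
    have eta0: "0 \<le> 1 / (2 * real K) / real (n + 1)" by simp
    note local = local_optimum[where R = M and E = E and N = N and e = e and z = z and d = "1 / ?D" and f = f
        and \<eta> = "1 / (2 * real K) / real (n + 1)" and V = V and Q = Q and c = c and p = p]
    note facts = f M NE P0 P1 P3 P4 zz zN z00 lo QN P2 K2 D1 eta0 V0 err
    have acc: "accepted p c K M S"
      unfolding accepted_def S_def
    proof (intro conjI ballI)
      show "(\<Sum>j\<in>chosen n K z {1..K}. M i j) \<le> 1" if "i \<in> {1..p}" for i
        by (rule local(1); fact facts that)
      show "1 - 3 / K \<le> (\<Sum>j\<in>chosen n K z {1..K}. M i j)" if "i \<in> {p+1..p+c}" for i
        by (rule local(2); fact facts that)
    qed
    have val: "(1 - 1 / exp 1 - 2 / K) * min (f (Q \<union> E) / V) 1 - 1 / K \<le> min (f S / V) 1"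
      unfolding S_def by (rule local(3); fact facts)
    have "(1 - 1 / exp 1 - 5 / K) * f T \<le> f S"
    \<comment> \<open>Dividing by \<open>V\<close> is meaningless here, but
      \<open>(1 - 1 / K) * f T \<le> V\<close> then forces \<open>f T = 0\<close>.\<close>
    proof (cases "V = 0")
      case True
      have "0 < 1 - 1 / real K" using K2 by simp
      moreover have "(1 - 1 / K) * f T \<le> 0" using V(2) True by (simp only: V_def)
      ultimately have "f T \<le> 0" by (simp add: mult_le_0_iff)
      then have "f T = 0" using fE by simp
      moreover have "S \<subseteq> {1..n}" by (auto simp: S_def chosen_def)
      ultimately show ?thesis using f(3)[of S] by simp
    next
      case False
      then have Vp: "0 < V" using V0 by simp
      have VT: "V \<le> f T" "(1 - 1 / K) * f T \<le> V" using V by (auto simp: V_def)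
      define b where "b = 1 - 1 / exp (1::real)"
      have b: "1 / 2 \<le> b" "b \<le> 1"
      proof -
        have "1 / exp (1::real) \<le> 1 / 2" using exp_ge_add_one_self[of 1] by (intro divide_left_mono) auto
        then show "1 / 2 \<le> b" by (simp add: b_def)
      qed (simp add: b_def)
        define x where "x = 1 / real K"
      have x: "0 < x" "x \<le> 1 / 16" using K by (auto simp: x_def divide_left_mono)
      have "(1 - x) * V \<le> f (Q \<union> E)"
      proof -
        have "(1 - x) * V \<le> (1 - x) * f T" using VT x by (intro mult_left_mono) auto
        then show ?thesis using fQ by (simp add: x_def)
      qed
      then have "1 - x \<le> f (Q \<union> E) / V" using Vp by (simp add: le_divide_eq)
      \<comment> \<open>Since \<open>V \<le> f T\<close>, the cap at 1 loses no more than giving up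
        \<open>B\<close> does.\<close>
      then have W: "1 - x \<le> min (f (Q \<union> E) / V) 1" using x by simp
      have "(b - 2 * x) * (1 - x) \<le> (b - 2 * x) * min (f (Q \<union> E) / V) 1"
        using W b x by (intro mult_left_mono) auto
      then have "(b - 2 * x) * (1 - x) - x \<le> min (f S / V) 1"
        using val by (simp add: b_def x_def)
      moreover have "b * x \<le> x" "0 \<le> x * x" using b x by (simp_all add: mult_left_le_one_le)
      moreover have "(b - 2 * x) * (1 - x) = b - 2 * x - b * x + 2 * (x * x)" by (simp add: algebra_simps)
      \<comment> \<open>Of the lost multiples of \<open>x\<close>, two come from the powers of
        \<open>\<rho>\<close>, one from the elements given up and one from the error of the local
        optimum. The fifth is due to the rounding of \<open>V\<close>. Since
        \<open>K \<ge> 16\<close>, the factor \<open>b - 4 * x\<close> is nonnegative.\<close>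
      ultimately have "b - 4 * x \<le> f S / V" by linarith
      then have "(b - 4 * x) * V \<le> f S" using Vp by (simp add: le_divide_eq)
      moreover have "(b - 4 * x) * ((1 - x) * f T) \<le> (b - 4 * x) * V"
      proof (rule mult_left_mono)
        show "(1 - x) * f T \<le> V" using VT by (simp add: x_def)
        show "0 \<le> b - 4 * x" using b x by linarith
      qed
      moreover have "(b - 5 * x) * f T \<le> (b - 4 * x) * ((1 - x) * f T)"
      proof -
        have "(b - 4 * x) * (1 - x) = b - 4 * x - b * x + 4 * (x * x)" by (simp add: algebra_simps)
        then have "b - 5 * x \<le> (b - 4 * x) * (1 - x)"
          using \<open>b * x \<le> x\<close> \<open>0 \<le> x * x\<close> by linarith
        then have "(b - 5 * x) * f T \<le> (b - 4 * x) * (1 - x) * f T" using fE by (intro mult_right_mono) auto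
        then show ?thesis by (simp add: mult.assoc)
      qed
      ultimately show ?thesis by (simp add: b_def x_def)
    qed
    then show ?thesis using out acc by (simp add: S_def)
  qed
  then show ?thesis using gn by blast
qed

section \<open>The whole program and its correctness\<close>

definition consts_prog :: "nat \<Rightarrow> nat \<Rightarrow> sprog" where
  "consts_prog K D = seqs [Do (RNat 1 2), lit 2 1 D, lit 3 (K - 1) K, lit 4 (K - 2) K, lit 5 (K - 3) K,
     lit 6 (4 * K * K) 1, lit 7 1 (2 * K), Do (RNat 12 1), Do (RDiv 7 7 12), Do (RSub 14 0 1)]"

text \<open>The registers from 20 on are loop counters: the first \<open>g\<close> encode the guess,
  the next \<open>spar c K\<close> form the clock of the local search.\<close>

definition main_prog :: "nat \<Rightarrow> nat \<Rightarrow> nat \<Rightarrow> sprog" where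
  "main_prog p c K = (let g = gpar p c K + 2 * K in
     Seq (consts_prog K (dpar p c K))
       (nest [20..<20 + g] (body p c K (gpar p c K) [20 + g..<20 + g + spar c K])))"

definition program :: "nat \<Rightarrow> nat \<Rightarrow> nat \<Rightarrow> com" where
  "program p c K = SEQ (DO (IConst 2 1)) (SEQ (DO (IAdd 1 0 2)) (compile (main_prog p c K)))"

lemma wf_blocks:
  "wf_sprog (lit r a b)" "wf_sprog (mark K J)" "wf_sprog (dot i)" "wf_sprog pen"
  by (auto simp: lit_def mark_def dot_def pen_def wf_seqs writes_seqs)

lemma wf_eval: "wf_sprog (eval_pot p c K)"
  by (auto simp: eval_pot_def gterm_def ppen_def cpen_def wf_seqs wf_blocks simp del: upt_Suc)

lemma wf_sweep: "wf_sprog (sweep p c K)"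
proof -
  have "I 7 \<notin> writes (try_move p c K k)" for k using try_move_writes[of p c K k] by auto
  moreover have "wf_sprog (try_move p c K k)" for k by (simp add: try_move_def wf_eval)
  ultimately show ?thesis by (auto simp: sweep_def wf_seqs writes_seqs simp del: upt_Suc)
qed

lemma wf_prep: "wf_sprog (prep p c K mm)"
  by (auto simp: prep_def guess_set_def guess_rows_def guess_val_def restrict_moves_def restrict_move_def ptest_def ctest_def
      wf_seqs writes_seqs wf_blocks wf_eval simp del: upt_Suc)

lemma wf_finish: "wf_sprog (finish p c K)"
  by (auto simp: finish_def pcheck_def ccheck_def save_best_def wf_seqs wf_blocks simp del: upt_Suc)

lemma wf_body:
  assumes "distinct cs" "\<forall>x\<in>set cs. 20 \<le> x"
  shows "wf_sprog (body p c K mm cs)"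
proof -
  have "wf_sprog (nest cs (sweep p c K))"
  proof (rule wf_nest[OF wf_sweep assms(1)])
    fix x assume "x \<in> set cs"
    then have x: "20 \<le> x" using assms(2) by blast
    then have "I x \<notin> {I 4, I 5, I 6, I 7, I 8, IA 1, IA 2, IA 3, R 10, R 11, R 12, R 13, R 15}" by simp
    then have "I x \<notin> writes (sweep p c K)" using sweep_writes by blast
    then show "x \<noteq> 1 \<and> x \<noteq> 2 \<and> I x \<notin> writes (sweep p c K)" using x by simp
  qed
  then show ?thesis by (simp add: body_def wf_prep wf_finish)
qed

lemma wf_main: "wf_sprog (main_prog p c K)"
proof -
  define g where "g = gpar p c K + 2 * K"
  define b where "b = body p c K (gpar p c K) [20 + g..<20 + g + spar c K]"
  have "wf_sprog b" unfolding b_def by (intro wf_body) auto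
  moreover have "I x \<notin> writes b" if "x \<in> set [20..<20 + g]" for x
    using that body_writes[of p c K "gpar p c K" "[20 + g..<20 + g + spar c K]"] by (auto simp: b_def)
  ultimately have "wf_sprog (nest [20..<20 + g] b)" by (intro wf_nest) auto
  moreover have "wf_sprog (consts_prog K (dpar p c K))" by (simp add: consts_prog_def wf_blocks)
  ultimately show ?thesis by (simp add: main_prog_def Let_def g_def b_def)
qed

lemma consts_sem:
  assumes s: "ireg s 0 = n" "ireg s 1 = Suc n" "ireg s 2 = 1" "ireg s 3 = 0" "rreg s 0 = 0" "rarr s = M"
    and K: "16 \<le> K"
  shows "best_inv p c K D n M f (sem n f (consts_prog K D) s)"
proof -
  have "real (K - 1) / K = 1 - 1 / K" "real (K - 2) / K = 1 - 2 / K" "real (K - 3) / K = 1 - 3 / K"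
    using K by (simp_all add: of_nat_diff diff_divide_distrib)
  then show ?thesis
    using s K by (simp add: best_inv_def base_def consts_prog_def lit_def power2_eq_square of_nat_diff diff_divide_distrib)
qed

lemma mat_vec_indicator: "S \<subseteq> {1..n} \<Longrightarrow> mat_vec n M (indicator S) i = (\<Sum>j\<in>S. M i j)"
  unfolding mat_vec_def by (rule sum.mono_neutral_cong_right) (auto simp: indicator_def)

lemma program_correct:
  assumes inst: "pcsm_instance p c n f P C" and opt: "optimal p c n f P C Opt" and K: "16 \<le> K"
  shows "\<exists>t s. t \<le> cost n (main_prog p c K) + 4 \<and>
    steps n f t (program p c K) (input_store p c n P C) SKIP s \<and>
    (1 - 1 / exp 1 - 5 / K) * f Opt \<le> f (stored_set n 0 s) \<and>
    packing p n P (stored_set n 0 s) \<and> covering c n C (1 - 3 / K) (stored_set n 0 s)"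
proof -
  define M where "M = rarr (input_store p c n P C)"
  define D where "D = dpar p c K"
  define mm where "mm = gpar p c K"
  define g where "g = mm + 2 * K"
  define cs where "cs = [20 + g..<20 + g + spar c K]"
  have n: "1 \<le> n" and f: "submodular_on {1..n} f" "mono_on (Pow {1..n}) f" "\<And>S. S \<subseteq> {1..n} \<Longrightarrow> 0 \<le> f S"
    using inst by (auto simp: pcsm_instance_def)
  have fe: "feasible p c n P C Opt" using opt by (simp add: optimal_def is_arg_max_def)
  have M0: "M i 0 = 0" for i by (simp add: M_def input_store_def)
  have MP: "M i j = P i j" if "i \<in> {1..p}" "j \<in> {1..n}" for i j
    using that by (simp add: M_def input_store_def)
  have MC: "M (p + i) j = C i j" if "i \<in> {1..c}" "j \<in> {1..n}" for i j
    using that by (simp add: M_def input_store_def)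
  have Mnn: "0 \<le> M i j" if "i \<in> {1..p + c}" "j \<in> {1..n}" for i j
  proof (cases "i \<le> p")
    case True
    then show ?thesis using that inst MP[of i j] by (auto simp: pcsm_instance_def nonneg_mat_def)
  next
    case False
    then have "i - p \<in> {1..c}" "p + (i - p) = i" using that by auto
    then show ?thesis using that inst MC[of "i - p" j] by (auto simp: pcsm_instance_def nonneg_mat_def)
  qed
  have pk: "packing p n P S \<longleftrightarrow> (\<forall>i\<in>{1..p}. (\<Sum>j\<in>S. M i j) \<le> 1)" if S: "S \<subseteq> {1..n}" for S
  proof -
    have "(\<Sum>j\<in>S. M i j) = mat_vec n P (indicator S) i" if "i \<in> {1..p}" for i
      unfolding mat_vec_indicator[OF S] using S that by (intro sum.cong) (auto intro!: MP)
    then show ?thesis by (simp add: packing_def)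
  qed
  have cv: "covering c n C \<beta> S \<longleftrightarrow> (\<forall>i\<in>{p+1..p+c}. \<beta> \<le> (\<Sum>j\<in>S. M i j))" if S: "S \<subseteq> {1..n}" for S \<beta>
  proof -
    have *: "(\<Sum>j\<in>S. M (p + i) j) = mat_vec n C (indicator S) i" if "i \<in> {1..c}" for i
      unfolding mat_vec_indicator[OF S] using S that by (intro sum.cong) (auto intro!: MC)
    have eq: "{p+1..p+c} = (\<lambda>i. p + i) ` {1..c}" by (simp add: image_add_atLeastAtMost)
    show ?thesis unfolding covering_def eq ball_simps using * by auto
  qed
  have On: "Opt \<subseteq> {1..n}" using fe by (simp add: feasible_def)
  have O1: "(\<Sum>j\<in>Opt. M i j) \<le> 1" if "i \<in> {1..p}" for i using fe pk[OF On] that by (auto simp: feasible_def)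
  have O2: "1 \<le> (\<Sum>j\<in>Opt. M i j)" if "i \<in> {p+1..p+c}" for i using fe cv[OF On] that by (auto simp: feasible_def)
  have cs: "\<forall>x\<in>set cs. 20 \<le> x" "length cs = spar c K" by (auto simp: cs_def)
  define b where "b = body p c K mm cs"
  define \<tau> where "\<tau> = (1 - 1 / exp 1 - 5 / K) * f Opt"
  have "\<exists>G. (\<forall>x. G x \<le> n) \<and> (\<forall>s. best_inv p c K (dpar p c K) n M f s \<longrightarrow>
    (\<forall>x\<in>{20..<20 + gpar p c K + 2 * K}. ireg s x = G x) \<longrightarrow>
    (1 - 1 / exp 1 - 5 / K) * f Opt \<le> rreg (sem n f (body p c K (gpar p c K) cs) s) 14)"
    by (rule right_guess; fact n f Mnn M0 On O1 O2 K cs)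
  moreover have "20 + gpar p c K + 2 * K = 20 + g" by (simp add: g_def mm_def)
  ultimately have "\<exists>G. (\<forall>x. G x \<le> n) \<and> (\<forall>s. best_inv p c K D n M f s \<longrightarrow>
    (\<forall>x\<in>{20..<20 + g}. ireg s x = G x) \<longrightarrow> \<tau> \<le> rreg (sem n f b s) 14)"
    unfolding D_def b_def \<tau>_def mm_def by (simp only:)
  then obtain G where G: "\<forall>x. G x \<le> n" and hit: "\<forall>s. best_inv p c K D n M f s \<longrightarrow>
    (\<forall>x\<in>{20..<20 + g}. ireg s x = G x) \<longrightarrow> \<tau> \<le> rreg (sem n f b s) 14"
    by (elim exE conjE)
  define s0 where "s0 = input_store p c n P C"
  define s1 where "s1 = set_ireg 1 (Suc n) (set_ireg 2 1 s0)"
  define s2 where "s2 = sem n f (consts_prog K D) s1"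
  define s3 where "s3 = sem n f (nest [20..<20 + g] b) s2"
  have s1: "ireg s1 0 = n" "ireg s1 1 = Suc n" "ireg s1 2 = 1" "ireg s1 3 = 0" "rreg s1 0 = 0" "rarr s1 = M"
    by (auto simp: s1_def s0_def input_store_def M_def)
  have inv2: "best_inv p c K D n M f s2" unfolding s2_def by (rule consts_sem[OF s1 K])
  let ?R = "\<lambda>s. best_inv p c K D n M f s \<and> \<tau> \<le> rreg s 14"
  have K2: "2 \<le> K" using K by simp
  have insens: "best_inv p c K D n M f (set_ireg x v s) \<longleftrightarrow> best_inv p c K D n M f s" if "20 \<le> x" for x v s
    using that by (simp add: best_inv_def base_def stored_set_def)
  have bi: "best_inv p c K D n M f (sem n f b s)" "rreg s 14 \<le> rreg (sem n f b s) 14"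
    if "best_inv p c K D n M f s" for s
    unfolding b_def using body_sem(1,2)[OF that K2 M0 cs(1)] by auto
  have "?R s3"
    unfolding s3_def
  proof (rule nest_hit[where X = "{20..<20 + g}" and g = G and I' = "best_inv p c K D n M f" and R' = ?R])
    show "best_inv p c K D n M f (sem n f b s)" if "best_inv p c K D n M f s" for s using bi that by simp
    show "?R (sem n f b s)" if "?R s" for s using bi[of s] that by auto
    show "?R (sem n f b s)" if "best_inv p c K D n M f s" "\<And>x. x \<in> {20..<20 + g} \<Longrightarrow> ireg s x = G x" for s
      using bi[of s] hit that by auto
    show "I x \<notin> writes b" if "x \<in> {20..<20 + g}" for x
      using that body_writes[of p c K mm cs] by (auto simp: b_def cs_def)
  qed (use insens G inv2 in auto)
  \<comment> \<open>Nonnegativity excludes the initial record \<open>-1\<close>, so the output is an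
    accepted set.\<close>
  have "0 \<le> \<tau>"
  proof -
    have "1 / exp (1::real) \<le> 1 / 2" using exp_ge_add_one_self[of 1] by (intro divide_left_mono) auto
    moreover have "5 / real K \<le> 5 / 16" using K by (intro divide_left_mono) auto
    ultimately have "0 \<le> 1 - 1 / exp 1 - 5 / real K" by linarith
    then show ?thesis unfolding \<tau>_def using f(3)[OF On] by (rule mult_nonneg_nonneg)
  qed
  then have best: "\<tau> \<le> f (stored_set n 0 s3)" "accepted p c K M (stored_set n 0 s3)"
    using \<open>?R s3\<close> by (auto simp: best_inv_def)
  have sub: "stored_set n 0 s3 \<subseteq> {1..n}" by (auto simp: stored_set_def)
  have main: "sem n f (main_prog p c K) s1 = s3"
    by (simp add: main_prog_def Let_def s3_def s2_def b_def cs_def g_def mm_def D_def)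
  obtain t where t: "t \<le> cost n (main_prog p c K)" "steps n f t (compile (main_prog p c K)) s1 SKIP s3"
    using compile_correct[OF wf_main[of p c K] s1(2,3), of f] main by auto
  have st1: "steps n f 1 (DO (IConst 2 1)) s0 SKIP (set_ireg 2 1 s0)"
    using steps_DO[of "IConst 2 1" n f s0] by simp
  have "steps n f 1 (DO (IAdd 1 0 2)) (set_ireg 2 1 s0) SKIP s1"
    using steps_DO[of "IAdd 1 0 2" n f "set_ireg 2 1 s0"] by (simp add: s1_def s0_def input_store_def)
  from steps_seq[OF st1 steps_seq[OF this t(2)]]
  \<comment> \<open>Four extra steps: the two initial assignments and the two \<open>SKIP\<close>s
    left behind by them.\<close>
  have "steps n f (1 + (1 + t + 1) + 1) (program p c K) s0 SKIP s3" by (simp only: program_def)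
  moreover have "1 + (1 + t + 1) + 1 \<le> cost n (main_prog p c K) + 4" using t(1) by simp
  ultimately show ?thesis
    using best pk[OF sub] cv[OF sub] unfolding s0_def \<tau>_def accepted_def by blast
qed

section \<open>Running time\<close>

definition pbounded :: "(nat \<Rightarrow> nat) \<Rightarrow> bool" where
  "pbounded g \<longleftrightarrow> (\<exists>A B. \<forall>K\<ge>1. g K \<le> A * K ^ B)"

text \<open>The evaluation of the potential is unrolled over all sets of slots, so the program size
  is exponential in \<open>K\<close>. This is affordable, since 2 to a polynomial in
  \<open>K\<close> is at most \<open>n + 1\<close> to the same polynomial.\<close>

definition ebounded :: "(nat \<Rightarrow> nat) \<Rightarrow> bool" where
  "ebounded h \<longleftrightarrow> (\<exists>g. pbounded g \<and> (\<forall>K\<ge>1. h K \<le> 2 ^ g K))"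

lemma pbounded_const: "pbounded (\<lambda>_. a)"
  unfolding pbounded_def by (intro exI[of _ a] exI[of _ 0]) simp

lemma pbounded_id: "pbounded (\<lambda>K. K)"
  unfolding pbounded_def by (intro exI[of _ 1]) simp

lemma pbounded_add:
  assumes "pbounded g" "pbounded h" shows "pbounded (\<lambda>K. g K + h K)"
proof -
  obtain A B A' B' where gh: "\<forall>K\<ge>1. g K \<le> A * K ^ B" "\<forall>K\<ge>1. h K \<le> A' * K ^ B'"
    using assms unfolding pbounded_def by blast
  have "g K + h K \<le> (A + A') * K ^ (B + B')" if K: "1 \<le> K" for K
  proof -
    have "A * K ^ B \<le> A * K ^ (B + B')" "A' * K ^ B' \<le> A' * K ^ (B + B')"
      using K by (intro mult_left_mono power_increasing; simp)+
    then have "g K \<le> A * K ^ (B + B')" "h K \<le> A' * K ^ (B + B')" using gh K le_trans by blast+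
    then show ?thesis by (simp only: add_mult_distrib add_mono)
  qed
  then show ?thesis unfolding pbounded_def by blast
qed

lemma pbounded_mult:
  assumes "pbounded g" "pbounded h" shows "pbounded (\<lambda>K. g K * h K)"
proof -
  obtain A B A' B' where gh: "\<forall>K\<ge>1. g K \<le> A * K ^ B" "\<forall>K\<ge>1. h K \<le> A' * K ^ B'"
    using assms unfolding pbounded_def by blast
  have "g K * h K \<le> (A * A') * K ^ (B + B')" if K: "1 \<le> K" for K
  proof -
    have "g K * h K \<le> (A * K ^ B) * (A' * K ^ B')" using gh K by (intro mult_mono) auto
    then show ?thesis by (simp add: power_add mult_ac)
  qed
  then show ?thesis unfolding pbounded_def by blast
qed

lemma pbounded_power: "pbounded g \<Longrightarrow> pbounded (\<lambda>K. g K ^ m)"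
  by (induction m) (auto intro: pbounded_mult pbounded_const)

lemmas pbounded_intros = pbounded_const pbounded_id pbounded_add pbounded_mult pbounded_power

lemma ebounded_pbounded: "pbounded g \<Longrightarrow> ebounded g"
  unfolding ebounded_def by (intro exI[of _ g]) (auto intro: less_imp_le less_exp)

lemma ebounded_power2: "ebounded (\<lambda>K. 2 ^ K)"
  unfolding ebounded_def by (intro exI[of _ "\<lambda>K. K"]) (auto intro: pbounded_id)

lemma ebounded_mult:
  assumes "ebounded g" "ebounded h" shows "ebounded (\<lambda>K. g K * h K)"
proof -
  obtain a b where ab: "pbounded a" "\<forall>K\<ge>1. g K \<le> 2 ^ a K" "pbounded b" "\<forall>K\<ge>1. h K \<le> 2 ^ b K"
    using assms unfolding ebounded_def by blast
  have "g K * h K \<le> 2 ^ (a K + b K)" if "1 \<le> K" for K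
    unfolding power_add using ab that by (intro mult_mono) auto
  then show ?thesis unfolding ebounded_def using pbounded_add[OF ab(1,3)] by blast
qed

lemma ebounded_add:
  assumes "ebounded g" "ebounded h" shows "ebounded (\<lambda>K. g K + h K)"
proof -
  obtain a b where ab: "pbounded a" "\<forall>K\<ge>1. g K \<le> 2 ^ a K" "pbounded b" "\<forall>K\<ge>1. h K \<le> 2 ^ b K"
    using assms unfolding ebounded_def by blast
  have "g K + h K \<le> 2 ^ (a K + b K + 1)" if "1 \<le> K" for K
  proof -
    have "(2::nat) ^ a K \<le> 2 ^ (a K + b K)" "(2::nat) ^ b K \<le> 2 ^ (a K + b K)"
      by (intro power_increasing; simp)+
    then have "g K \<le> 2 ^ (a K + b K)" "h K \<le> 2 ^ (a K + b K)" using ab(2,4) that le_trans by blast+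
    then show ?thesis by simp
  qed
  moreover have "pbounded (\<lambda>K. a K + b K + 1)" using ab by (intro pbounded_intros)
  ultimately show ?thesis unfolding ebounded_def by blast
qed

lemmas ebounded_intros = ebounded_power2 ebounded_mult ebounded_add
  ebounded_pbounded[OF pbounded_const] ebounded_pbounded[OF pbounded_id]

text \<open>Upper bounds compose without tracking exact sizes; the numerals in the following lemmas
  are generous and only their growth in \<open>K\<close> matters.\<close>

definition fits :: "nat \<Rightarrow> nat \<Rightarrow> sprog \<Rightarrow> bool" where
  "fits b d c \<longleftrightarrow> code_size c \<le> b \<and> depth c \<le> d"

lemma fits_seqs: "(\<And>c. c \<in> set cs \<Longrightarrow> fits b d c) \<Longrightarrow> fits (length cs * (b + 1) + 1) d (seqs cs)"
  unfolding fits_def by (induction cs) fastforce+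

lemma fits_seqs_map:
  "(\<And>x. x \<in> set xs \<Longrightarrow> fits b d (h x)) \<Longrightarrow> fits (length xs * (b + 1) + 1) d (seqs (map h xs))"
  using fits_seqs[of "map h xs" b d] by auto

lemma fits_nest: "fits b d c \<Longrightarrow> fits (b + 7 * length xs) (length xs + d) (nest xs c)"
  unfolding fits_def by (induction xs) auto

lemma fits_mark: "fits (4 * K + 40) 1 (mark K J)"
  using fits_seqs_map[of "[0..<K + 2]" 3 0
    "\<lambda>k. Seq (Do (IConst 4 k)) (Do (IStore 2 4 (if k \<in> J \<or> k = Suc K then 2 else 3)))"]
  by (simp add: mark_def fits_def del: upt_Suc)

definition eval_size :: "nat \<Rightarrow> nat \<Rightarrow> nat \<Rightarrow> nat" where
  "eval_size p c K = 2 ^ K * (4 * K + 101) + 4 * K + (p + c) * 101 + 100"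

lemma fits_eval: "fits (eval_size p c K) 1 (eval_pot p c K)"
proof -
  have "fits (4 * K + 100) 1 (gterm K J)" for J
    using fits_mark[of K "set J"] by (simp add: gterm_def lit_def fits_def)
  then have "fits (length (subseqs [1..<K + 1]) * (4 * K + 100 + 1) + 1) 1
      (seqs (map (gterm K) (subseqs [1..<K + 1])))" by (intro fits_seqs_map)
  moreover have "length (subseqs [1..<K + 1]) = 2 ^ K" by (simp add: length_subseqs del: upt_Suc)
  moreover have ps: "fits (length xs * (100 + 1) + 1) 1 (seqs (map ppen xs))"
    "fits (length xs * (100 + 1) + 1) 1 (seqs (map cpen xs))" for xs
    by (intro fits_seqs_map; simp add: ppen_def cpen_def dot_def pen_def fits_def)+
  ultimately show ?thesis
    using ps(1)[of "[1..<p + 1]"] ps(2)[of "[p + 1..<p + c + 1]"] fits_mark[of K "{1..K}"] by (simp add: eval_pot_def eval_size_def fits_def algebra_simps del: upt_Suc)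
qed

definition sweep_size :: "nat \<Rightarrow> nat \<Rightarrow> nat \<Rightarrow> nat" where
  "sweep_size p c K = (K + 1) * (eval_size p c K + 41) + 40"

lemma fits_sweep: "fits (sweep_size p c K) 2 (sweep p c K)"
proof -
  have "fits (eval_size p c K + 40) 1 (try_move p c K k)" for k
    using fits_eval[of p c K] by (simp add: try_move_def fits_def)
  then have "fits (length [0..<K + 1] * (eval_size p c K + 40 + 1) + 1) 1 (seqs (map (try_move p c K) [0..<K + 1]))"
    by (intro fits_seqs_map)
  then show ?thesis by (simp add: sweep_def sweep_size_def fits_def algebra_simps del: upt_Suc)
qed

definition prep_size :: "nat \<Rightarrow> nat \<Rightarrow> nat \<Rightarrow> nat \<Rightarrow> nat" where
  "prep_size p c K mm = mm * 4 + (p + c) * 160 + 8 * K + eval_size p c K + 300"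

lemma fits_prep: "fits (prep_size p c K mm) 2 (prep p c K mm)"
proof -
  have "fits (length [0..<mm] * (3 + 1) + 1) 0
    (seqs (map (\<lambda>i. Seq (Do (IConst 4 (Suc K))) (Do (IStore 1 (20 + i) 4))) [0..<mm]))"
    by (intro fits_seqs_map) (simp add: fits_def)
  moreover have "fits (length [1..<p + c + 1] * (40 + 1) + 1) 1 (guess_rows p c)"
    unfolding guess_rows_def by (intro fits_seqs_map) (simp add: dot_def fits_def)
  moreover have "fits (length [mm..<mm + 2 * K] * (1 + 1) + 1) 0
    (seqs (map (\<lambda>i. Do (IAdd 5 5 (20 + i))) [mm..<mm + 2 * K]))"
    by (intro fits_seqs_map) (simp add: fits_def)
  moreover have ps: "fits (length xs * (40 + 1) + 1) 0 (seqs (map ptest xs))"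
    "fits (length xs * (40 + 1) + 1) 0 (seqs (map ctest xs))" for xs
    by (intro fits_seqs_map; simp add: ptest_def ctest_def fits_def)+
  ultimately show ?thesis
    using ps(1)[of "[1..<p + 1]"] ps(2)[of "[p + 1..<p + c + 1]"] fits_mark[of K "{}"] fits_eval[of p c K]
    by (simp add: prep_def guess_set_def guess_val_def restrict_moves_def restrict_move_def prep_size_def
        fits_def algebra_simps del: upt_Suc)
qed

lemma fits_finish: "fits (4 * K + (p + c) * 41 + 150) 1 (finish p c K)"
proof -
  have "fits (length xs * (40 + 1) + 1) 1 (seqs (map pcheck xs))"
    "fits (length xs * (40 + 1) + 1) 1 (seqs (map ccheck xs))" for xs
    by (intro fits_seqs_map; simp add: pcheck_def ccheck_def dot_def fits_def)+
  from this(1)[of "[1..<p + 1]"] this(2)[of "[p + 1..<p + c + 1]"] show ?thesis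
    using fits_mark[of K "{1..K}"] by (simp add: finish_def save_best_def fits_def algebra_simps del: upt_Suc)
qed

definition main_size :: "nat \<Rightarrow> nat \<Rightarrow> nat \<Rightarrow> nat" where
  "main_size p c K = prep_size p c K (gpar p c K) + sweep_size p c K + 7 * spar c K
     + (4 * K + (p + c) * 41 + 150) + 7 * (gpar p c K + 2 * K) + 300"

definition main_depth :: "nat \<Rightarrow> nat \<Rightarrow> nat \<Rightarrow> nat" where
  "main_depth p c K = gpar p c K + 2 * K + spar c K + 2"

lemma fits_main: "fits (main_size p c K) (main_depth p c K) (main_prog p c K)"
proof -
  define g where "g = gpar p c K + 2 * K"
  have "fits (sweep_size p c K + 7 * spar c K) (spar c K + 2) (nest [20 + g..<20 + g + spar c K] (sweep p c K))"
    using fits_nest[OF fits_sweep, where xs = "[20 + g..<20 + g + spar c K]"] by simp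
  then have "fits (prep_size p c K (gpar p c K) + sweep_size p c K + 7 * spar c K + (4 * K + (p + c) * 41 + 150) + 10)
    (spar c K + 2) (body p c K (gpar p c K) [20 + g..<20 + g + spar c K])"
    using fits_prep[of p c K "gpar p c K"] fits_finish[where p = p and c = c and K = K] by (simp add: body_def fits_def)
  from fits_nest[OF this, where xs = "[20..<20 + g]"] show ?thesis
    by (simp add: main_prog_def Let_def consts_prog_def lit_def main_size_def main_depth_def fits_def
        g_def[symmetric] del: upt_Suc)
qed

lemma pbounded_params: "pbounded (gpar p c)" "pbounded (spar c)"
proof -
  have "pbounded (\<lambda>K. (c + 1) * ((p + 1) * (8 * K ^ 3 * (3 * p + 5 * c + 1)) * K))"
    by (intro pbounded_intros)
  then show "pbounded (gpar p c)" by (simp add: gpar_def[abs_def] dpar_def)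
  have "pbounded (\<lambda>K. 2 * K * (3 * K + 4 * K\<^sup>2 * c) + 1)" by (intro pbounded_intros)
  then show "pbounded (spar c)" by (simp add: spar_def[abs_def])
qed

lemma ebounded_main_size: "ebounded (\<lambda>K. main_size p c K + 4)"
  unfolding main_size_def prep_size_def sweep_size_def eval_size_def
  by (intro ebounded_intros ebounded_pbounded[OF pbounded_params(1)] ebounded_pbounded[OF pbounded_params(2)])

lemma pbounded_main_depth: "pbounded (main_depth p c)"
  unfolding main_depth_def[abs_def] by (intro pbounded_intros pbounded_params)

text \<open>The size of the program is absorbed into the exponent next to the loop depth, by
  \<open>2 \<le> n + 1\<close>. Both contributions to the exponent are polynomial in
  \<open>K\<close>, with constants depending only on \<open>p\<close> and \<open>c\<close>.\<close>

lemma time_bound: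
  "\<exists>A B. \<forall>K\<ge>1. \<forall>n\<ge>1. cost n (main_prog p c K) + 4 \<le> (n + 1) ^ (A * K ^ B)"
proof -
  obtain g where g: "pbounded g" "\<forall>K\<ge>1. main_size p c K + 4 \<le> 2 ^ g K"
    using ebounded_main_size unfolding ebounded_def by blast
  have "pbounded (\<lambda>K. g K + main_depth p c K)" by (intro pbounded_add g pbounded_main_depth)
  then obtain A B where AB: "\<forall>K\<ge>1. g K + main_depth p c K \<le> A * K ^ B" unfolding pbounded_def by blast
  have "cost n (main_prog p c K) + 4 \<le> (n + 1) ^ (A * K ^ B)" if K: "1 \<le> K" and n: "1 \<le> n" for K n
  proof -
    let ?d = "(n + 1) ^ main_depth p c K"
    have "cost n (main_prog p c K) \<le> code_size (main_prog p c K) * (n + 1) ^ depth (main_prog p c K)"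
      by (rule cost_le)
    also have "\<dots> \<le> main_size p c K * ?d"
      using fits_main[of p c K] by (intro mult_mono power_increasing) (auto simp: fits_def)
    finally have "cost n (main_prog p c K) + 4 \<le> main_size p c K * ?d + 4 * 1" by simp
    also have "\<dots> \<le> main_size p c K * ?d + 4 * ?d" by (intro add_left_mono mult_left_mono) auto
    also have "\<dots> = (main_size p c K + 4) * ?d" by (simp only: add_mult_distrib)
    also have "\<dots> \<le> 2 ^ g K * ?d" using g(2) K by (intro mult_right_mono) auto
    also have "\<dots> \<le> (n + 1) ^ g K * ?d" using n by (intro mult_right_mono power_mono) auto
    also have "\<dots> = (n + 1) ^ (g K + main_depth p c K)" by (simp only: power_add)
    also have "\<dots> \<le> (n + 1) ^ (A * K ^ B)" using AB K by (intro power_increasing) auto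
    finally show ?thesis .
  qed
  then show ?thesis by blast
qed

theorem theorem1:
  fixes p c :: nat
  shows "\<exists>q :: real poly. \<forall>\<epsilon> :: real. 0 < \<epsilon> \<longrightarrow> (\<exists>prg :: com.
    \<forall>n f P C Opt. pcsm_instance p c n f P C \<and> optimal p c n f P C Opt \<longrightarrow>
      (\<exists>t :: nat.
         real t \<le> real (n + 1) powr poly q (1 / \<epsilon>) \<and>
         halts_within n f prg (input_store p c n P C) t \<and>
         measure_pmf.prob (output_pmf n f prg (input_store p c n P C) t)
           {S. S \<subseteq> {1..n} \<and>
               f S \<ge> (1 - 1 / exp 1 - \<epsilon>) * f Opt \<and>
               packing p n P S \<and> covering c n C (1 - \<epsilon>) S}
         \<ge> 1 - 1 / real (n + 1)))"
proof -
  obtain A B where AB: "\<And>K n. 1 \<le> K \<Longrightarrow> 1 \<le> n \<Longrightarrow> cost n (main_prog p c K) + 4 \<le> (n + 1) ^ (A * K ^ B)"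
    using time_bound[of p c] by blast
  \<comment> \<open>The polynomial has to be fixed before \<open>\<epsilon>\<close>; the inner
    factor 17 + 16 X, taken at \<open>1 / \<epsilon>\<close>, bounds the rounded-up \<open>K\<close>
    chosen below.\<close>
  define q :: "real poly" where "q = smult (real A) ([:17, 16:] ^ B)"
  show ?thesis
  proof (intro exI[of _ q] allI impI)
    fix \<epsilon> :: real assume \<epsilon>: "0 < \<epsilon>"
    \<comment> \<open>The first summand makes \<open>5 / K\<close> and \<open>3 / K\<close> at most
      \<open>\<epsilon>\<close>, the second ensures \<open>K \<ge> 16\<close> even for large
      \<open>\<epsilon>\<close>.\<close>
    define K where "K = nat \<lceil>16 / \<epsilon>\<rceil> + 16"
    have K16: "16 \<le> K" by (simp add: K_def)
    have Klo: "16 / \<epsilon> \<le> real K" unfolding K_def by linarith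
    have Khi: "real K \<le> 17 + 16 * (1 / \<epsilon>)" using \<epsilon> unfolding K_def by simp linarith
    have small: "5 / K \<le> \<epsilon>" "3 / K \<le> \<epsilon>"
    proof -
      have "16 \<le> \<epsilon> * K" using Klo \<epsilon> by (simp add: divide_le_eq mult.commute)
      then show "5 / K \<le> \<epsilon>" "3 / K \<le> \<epsilon>" using K16 by (simp_all add: divide_le_eq)
    qed
    let ?good = "\<lambda>n f P C Opt. {S. S \<subseteq> {1..n} \<and> f S \<ge> (1 - 1 / exp 1 - \<epsilon>) * f Opt \<and>
      packing p n P S \<and> covering c n C (1 - \<epsilon>) S}"
    show "\<exists>prg. \<forall>n f P C Opt. pcsm_instance p c n f P C \<and> optimal p c n f P C Opt \<longrightarrow>
      (\<exists>t :: nat. real t \<le> real (n + 1) powr poly q (1 / \<epsilon>) \<and>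
         halts_within n f prg (input_store p c n P C) t \<and>
         measure_pmf.prob (output_pmf n f prg (input_store p c n P C) t) (?good n f P C Opt)
         \<ge> 1 - 1 / real (n + 1))"
    proof (intro exI[of _ "program p c K"] allI impI, elim conjE)
      fix n f P C Opt
      assume inst: "pcsm_instance p c n f P C" and opt: "optimal p c n f P C Opt"
      obtain t s where t: "t \<le> cost n (main_prog p c K) + 4"
        and st: "steps n f t (program p c K) (input_store p c n P C) SKIP s"
        and val: "(1 - 1 / exp 1 - 5 / K) * f Opt \<le> f (stored_set n 0 s)"
        and feas: "packing p n P (stored_set n 0 s)" "covering c n C (1 - 3 / K) (stored_set n 0 s)"
        using program_correct[OF inst opt K16] by blast
      have run: "run n f t (program p c K) (input_store p c n P C) = return_pmf (SKIP, s)"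
        by (rule steps_run[OF st])
      have n: "1 \<le> n" using inst by (simp add: pcsm_instance_def)
      have "0 \<le> f Opt"
        using inst opt by (auto simp: pcsm_instance_def optimal_def is_arg_max_def feasible_def)
      then have "(1 - 1 / exp 1 - \<epsilon>) * f Opt \<le> (1 - 1 / exp 1 - 5 / K) * f Opt"
        using small by (intro mult_right_mono) auto
      then have "stored_set n 0 s \<in> ?good n f P C Opt"
        using val feas small by (force simp: stored_set_def covering_def)
      \<comment> \<open>The run is deterministic, so the output distribution is a point mass and the
        success probability is 1.\<close>
      then have "measure_pmf.prob (output_pmf n f (program p c K) (input_store p c n P C) t) (?good n f P C Opt) = 1"
        unfolding output_pmf_def run by (simp add: measure_return_pmf)
      moreover have "halts_within n f (program p c K) (input_store p c n P C) t"
        by (simp add: halts_within_def run)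
      moreover have "real t \<le> real (n + 1) powr poly q (1 / \<epsilon>)"
      proof -
        have "t \<le> (n + 1) ^ (A * K ^ B)" using t AB[of K n] K16 n by linarith
        then have "real t \<le> real ((n + 1) ^ (A * K ^ B))" by (rule of_nat_mono)
        also have "\<dots> = real (n + 1) powr real (A * K ^ B)" by (subst powr_realpow) simp_all
        also have "\<dots> \<le> real (n + 1) powr poly q (1 / \<epsilon>)"
        proof (intro powr_mono)
          have "real A * real K ^ B \<le> real A * (17 + 16 * (1 / \<epsilon>)) ^ B"
            using Khi by (intro mult_left_mono power_mono) auto
          then show "real (A * K ^ B) \<le> poly q (1 / \<epsilon>)" by (simp add: q_def poly_power mult.commute)
        qed simp
        finally show ?thesis .
      qed
      ultimately show "\<exists>t :: nat. real t \<le> real (n + 1) powr poly q (1 / \<epsilon>) \<and>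
         halts_within n f (program p c K) (input_store p c n P C) t \<and>
         measure_pmf.prob (output_pmf n f (program p c K) (input_store p c n P C) t) (?good n f P C Opt)
         \<ge> 1 - 1 / real (n + 1)"
        by (intro exI[of _ t]) simp
    qed
  qed
qed

end
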